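(* Let $n\ge 3$, let $D_n=\langle a,b\mid a^n=b^2=e,\ bab=a^{-1}\rangle$ be the dihedral group of order $2n$, let $\xi$ be a primitive $n$-th root of unity and let $K=\mathbb{Q}(\xi+\xi^{-1})$, with ring of integers $\mathcal{O}_K$; $K$ is the field of definition of the faithful irreducible two-dimensional representations of $D_n$. Let $\psi:D_n\to\mathrm{GL}_2(K)$ be a faithful irreducible representation. If $n$ is a prime power or twice a prime power, then the number of $\mathrm{GL}_2(\mathcal{O}_K)$-conjugacy classes of homomorphisms $D_n\to\mathrm{GL}_2(\mathcal{O}_K)$ that are $\mathrm{GL}_2(K)$-conjugate to $\psi$ is exactly $2h_K(2)$; otherwise this number is exactly $h_K(2)$.
   Context: $h_K(2)$ denotes the order of the subgroup $\mathcal{G}_K(2)$ of the ideal class group of $K$ consisting of classes $\bar I$ with $\bar I^2$ trivial (equivalently, fractional ideals $I$ with $I^2$ principal). Example of such $\psi$: $\psi(a)=\begin{pmatrix}0&-1\\1&\xi^k+\xi^{-k}\end{pmatrix}$, $\psi(b)=\begin{pmatrix}0&1\\1&0\end{pmatrix}$ with $\gcd(k,n)=1$. *)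

theory Defs
  imports
    "HOL-Analysis.Analysis"
    "HOL-Algebra.Algebra"
    "HOL-Algebra.Algebraic_Closure_Type"
    "HOL-Number_Theory.Prime_Powers"
begin

section \<open>Dihedral groups\<close>

text \<open>
  The pair \<open>(i, s)\<close> stands for \<open>a\<^sup>i\<close> if \<open>s\<close> is false and for \<open>a\<^sup>i b\<close> if \<open>s\<close> is true.  The lemmas
  below show that, for positive \<open>n\<close>, this is the group presented by
  \<open>a\<^sup>n = b\<^sup>2 = e\<close>, \<open>b a b = a\<^sup>-\<^sup>1\<close>.
\<close>

definition dihedral :: "nat \<Rightarrow> (int \<times> bool) monoid" where
  "dihedral n =
     \<lparr>carrier = {0..<int n} \<times> UNIV,
      mult = (\<lambda>(i, s) (j, t). ((if s then i - j else i + j) mod int n, s \<noteq> t)),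
      one = (0, False)\<rparr>"

definition dih_a :: "nat \<Rightarrow> int \<times> bool" where
  "dih_a n = (1 mod int n, False)"

definition dih_b :: "int \<times> bool" where
  "dih_b = (0, True)"

lemma dihedral_simps:
  "carrier (dihedral n) = {0..<int n} \<times> UNIV"
  "(i, s) \<otimes>\<^bsub>dihedral n\<^esub> (j, t) = ((if s then i - j else i + j) mod int n, s \<noteq> t)"
  "\<one>\<^bsub>dihedral n\<^esub> = (0, False)"
  by (simp_all add: dihedral_def)

lemma group_dihedral:
  assumes "n > 0"
  shows "group (dihedral n)"
proof (rule groupI)
  fix x assume "x \<in> carrier (dihedral n)"
  then obtain i s where x: "x = (i, s)" "0 \<le> i" "i < int n"
    by (auto simp: dihedral_simps)
  have "(if s then i else (- i) mod int n, s) \<in> carrier (dihedral n)"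
    using x assms by (auto simp: dihedral_simps)
  moreover have "(if s then i else (- i) mod int n, s) \<otimes>\<^bsub>dihedral n\<^esub> x = \<one>\<^bsub>dihedral n\<^esub>"
    using x by (auto simp: dihedral_simps mod_simps)
  ultimately show "\<exists>y\<in>carrier (dihedral n). y \<otimes>\<^bsub>dihedral n\<^esub> x = \<one>\<^bsub>dihedral n\<^esub>"
    by blast
qed (use assms in \<open>auto simp: dihedral_simps mod_simps algebra_simps\<close>)

lemma order_dihedral: "order (dihedral n) = 2 * n"
  by (simp add: order_def dihedral_simps card_cartesian_product UNIV_bool)

lemma dih_a_pow: "dih_a n [^]\<^bsub>dihedral n\<^esub> (k::nat) = (int k mod int n, False)"
proof (induction k)
  case 0
  then show ?case by (simp add: dihedral_simps)
next
  case (Suc k)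
  have "dih_a n [^]\<^bsub>dihedral n\<^esub> Suc k = (int k mod int n, False) \<otimes>\<^bsub>dihedral n\<^esub> dih_a n"
    using Suc by simp
  then show ?case
    by (simp add: dih_a_def dihedral_simps mod_simps add.commute)
qed

lemma dihedral_relations:
  assumes "n > 0"
  shows "dih_a n \<in> carrier (dihedral n)" "dih_b \<in> carrier (dihedral n)"
    and "dih_a n [^]\<^bsub>dihedral n\<^esub> n = \<one>\<^bsub>dihedral n\<^esub>"
    and "dih_b [^]\<^bsub>dihedral n\<^esub> (2::nat) = \<one>\<^bsub>dihedral n\<^esub>"
    and "dih_b \<otimes>\<^bsub>dihedral n\<^esub> dih_a n \<otimes>\<^bsub>dihedral n\<^esub> dih_b = inv\<^bsub>dihedral n\<^esub> (dih_a n)"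
proof -
  interpret group "dihedral n" by (rule group_dihedral[OF assms])
  show a: "dih_a n \<in> carrier (dihedral n)" and b: "dih_b \<in> carrier (dihedral n)"
    using assms by (auto simp: dih_a_def dih_b_def dihedral_simps)
  show "dih_a n [^]\<^bsub>dihedral n\<^esub> n = \<one>\<^bsub>dihedral n\<^esub>"
    by (simp add: dih_a_pow dihedral_simps)
  show "dih_b [^]\<^bsub>dihedral n\<^esub> (2::nat) = \<one>\<^bsub>dihedral n\<^esub>"
    by (simp add: numeral_2_eq_2 dih_b_def dihedral_simps)
  have "dih_b \<otimes>\<^bsub>dihedral n\<^esub> dih_a n \<otimes>\<^bsub>dihedral n\<^esub> dih_b \<otimes>\<^bsub>dihedral n\<^esub> dih_a n = \<one>\<^bsub>dihedral n\<^esub>"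
    by (simp add: dih_a_def dih_b_def dihedral_simps mod_simps)
  then show "dih_b \<otimes>\<^bsub>dihedral n\<^esub> dih_a n \<otimes>\<^bsub>dihedral n\<^esub> dih_b = inv\<^bsub>dihedral n\<^esub> (dih_a n)"
    using a b by (metis inv_equality m_closed)
qed

lemma dihedral_normal_form:
  assumes "(i, s) \<in> carrier (dihedral n)"
  shows "(i, s) = dih_a n [^]\<^bsub>dihedral n\<^esub> nat i \<otimes>\<^bsub>dihedral n\<^esub> (if s then dih_b else \<one>\<^bsub>dihedral n\<^esub>)"
  using assms by (auto simp: dih_a_pow dih_b_def dihedral_simps)

lemma dihedral_generated:
  assumes "n > 0"
  shows "generate (dihedral n) {dih_a n, dih_b} = carrier (dihedral n)"
proof
  interpret group "dihedral n" by (rule group_dihedral[OF assms])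
  let ?H = "generate (dihedral n) {dih_a n, dih_b}"
  have sub: "{dih_a n, dih_b} \<subseteq> carrier (dihedral n)"
    using dihedral_relations[OF assms] by blast
  show "?H \<subseteq> carrier (dihedral n)"
    by (rule generate_incl[OF sub])
  have pow: "dih_a n [^]\<^bsub>dihedral n\<^esub> (k::nat) \<in> ?H" for k
    by (induction k) (auto intro: generate.intros)
  show "carrier (dihedral n) \<subseteq> ?H"
  proof
    fix x assume x: "x \<in> carrier (dihedral n)"
    obtain i s where ix: "x = (i, s)" by force
    have "dih_a n [^]\<^bsub>dihedral n\<^esub> nat i \<otimes>\<^bsub>dihedral n\<^esub> (if s then dih_b else \<one>\<^bsub>dihedral n\<^esub>) \<in> ?H"
      by (intro generate.eng pow) (auto intro: generate.one generate.incl)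
    then show "x \<in> ?H"
      using dihedral_normal_form x ix by metis
  qed
qed

lemma dihedral_universal:
  assumes "n > 0" and "group H" and x: "x \<in> carrier H" and y: "y \<in> carrier H"
    and xn: "x [^]\<^bsub>H\<^esub> n = \<one>\<^bsub>H\<^esub>" and y2: "y [^]\<^bsub>H\<^esub> (2::nat) = \<one>\<^bsub>H\<^esub>"
    and yxy: "y \<otimes>\<^bsub>H\<^esub> x \<otimes>\<^bsub>H\<^esub> y = inv\<^bsub>H\<^esub> x"
  shows "\<exists>h\<in>hom (dihedral n) H. h (dih_a n) = x \<and> h dih_b = y"
proof -
  interpret H: group H by fact
  define h where "h = (\<lambda>(i::int, s). x [^]\<^bsub>H\<^esub> i \<otimes>\<^bsub>H\<^esub> (if s then y else \<one>\<^bsub>H\<^esub>))"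
  have yy: "y \<otimes>\<^bsub>H\<^esub> y = \<one>\<^bsub>H\<^esub>"
    using y2 y by (simp add: numeral_2_eq_2)
  have pow_mod: "x [^]\<^bsub>H\<^esub> (i mod int n) = x [^]\<^bsub>H\<^esub> i" for i :: int
  proof -
    have "x [^]\<^bsub>H\<^esub> i = x [^]\<^bsub>H\<^esub> (int n * (i div int n) + i mod int n)"
      by simp
    also have "\<dots> = (x [^]\<^bsub>H\<^esub> int n) [^]\<^bsub>H\<^esub> (i div int n) \<otimes>\<^bsub>H\<^esub> x [^]\<^bsub>H\<^esub> (i mod int n)"
      using x by (simp only: H.int_pow_mult H.int_pow_pow)
    also have "\<dots> = x [^]\<^bsub>H\<^esub> (i mod int n)"
      using x xn by (simp add: H.int_pow_one int_pow_int)
    finally show ?thesis by simp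
  qed
  have yx: "y \<otimes>\<^bsub>H\<^esub> x = inv\<^bsub>H\<^esub> x \<otimes>\<^bsub>H\<^esub> y"
    using yxy yy x y by (metis H.m_assoc H.m_closed H.r_one)
  have yx': "y \<otimes>\<^bsub>H\<^esub> inv\<^bsub>H\<^esub> x = x \<otimes>\<^bsub>H\<^esub> y"
    by (metis yxy yy x y H.m_assoc H.m_closed H.r_one H.l_one H.inv_closed H.l_inv H.r_inv)
  have ypow_nat: "y \<otimes>\<^bsub>H\<^esub> x [^]\<^bsub>H\<^esub> k = inv\<^bsub>H\<^esub> x [^]\<^bsub>H\<^esub> k \<otimes>\<^bsub>H\<^esub> y" for k :: nat
  proof (induction k)
    case (Suc k)
    have "y \<otimes>\<^bsub>H\<^esub> x [^]\<^bsub>H\<^esub> Suc k = inv\<^bsub>H\<^esub> x [^]\<^bsub>H\<^esub> k \<otimes>\<^bsub>H\<^esub> (y \<otimes>\<^bsub>H\<^esub> x)"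
      using Suc x y by (simp add: H.m_assoc[symmetric])
    then show ?case using x y by (simp add: yx H.m_assoc)
  qed (use y in simp)
  have ypow_nat': "y \<otimes>\<^bsub>H\<^esub> inv\<^bsub>H\<^esub> x [^]\<^bsub>H\<^esub> k = x [^]\<^bsub>H\<^esub> k \<otimes>\<^bsub>H\<^esub> y" for k :: nat
  proof (induction k)
    case (Suc k)
    have "y \<otimes>\<^bsub>H\<^esub> inv\<^bsub>H\<^esub> x [^]\<^bsub>H\<^esub> Suc k = x [^]\<^bsub>H\<^esub> k \<otimes>\<^bsub>H\<^esub> (y \<otimes>\<^bsub>H\<^esub> inv\<^bsub>H\<^esub> x)"
      using Suc x y by (simp add: H.m_assoc[symmetric])
    then show ?case using x y by (simp add: yx' H.m_assoc)
  qed (use y in simp)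
  have ypow: "y \<otimes>\<^bsub>H\<^esub> x [^]\<^bsub>H\<^esub> i = x [^]\<^bsub>H\<^esub> (- i) \<otimes>\<^bsub>H\<^esub> y" for i :: int
  proof (cases i rule: int_cases2)
    case (nonneg k)
    then show ?thesis
      using ypow_nat[of k] x by (simp add: H.int_pow_neg int_pow_int H.nat_pow_inv)
  next
    case (nonpos k)
    then show ?thesis
      using ypow_nat'[of k] x by (simp add: H.int_pow_neg int_pow_int H.nat_pow_inv)
  qed
  have "h \<in> hom (dihedral n) H"
  proof (rule homI)
    fix p assume "p \<in> carrier (dihedral n)"
    then show "h p \<in> carrier H" using x y by (cases p) (simp add: h_def)
  next
    fix p q assume "p \<in> carrier (dihedral n)" "q \<in> carrier (dihedral n)"
    obtain i s j t where pq: "p = (i, s)" "q = (j, t)" by (metis surj_pair)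
    show "h (p \<otimes>\<^bsub>dihedral n\<^esub> q) = h p \<otimes>\<^bsub>H\<^esub> h q"
    proof (cases s)
      case False
      then show ?thesis
        using x y by (simp add: pq h_def dihedral_simps pow_mod H.int_pow_mult H.m_assoc)
    next
      case True
      let ?u = "if t then y else \<one>\<^bsub>H\<^esub>"
      have u: "?u \<in> carrier H" using y by simp
      have "h p \<otimes>\<^bsub>H\<^esub> h q = x [^]\<^bsub>H\<^esub> i \<otimes>\<^bsub>H\<^esub> (y \<otimes>\<^bsub>H\<^esub> x [^]\<^bsub>H\<^esub> j) \<otimes>\<^bsub>H\<^esub> ?u"
        using True x y u by (simp add: pq h_def H.m_assoc)
      also have "\<dots> = x [^]\<^bsub>H\<^esub> (i - j) \<otimes>\<^bsub>H\<^esub> (y \<otimes>\<^bsub>H\<^esub> ?u)"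
        using x y u H.int_pow_mult[of x i "- j"] by (simp add: ypow H.m_assoc)
      also have "y \<otimes>\<^bsub>H\<^esub> ?u = (if t then \<one>\<^bsub>H\<^esub> else y)"
        using y yy by simp
      finally show ?thesis
        using True by (simp add: pq h_def dihedral_simps pow_mod)
    qed
  qed
  moreover have "h (dih_a n) = x" "h dih_b = y"
    using x y by (simp_all add: h_def dih_a_def dih_b_def pow_mod H.int_pow_1)
  ultimately show ?thesis by blast
qed


section \<open>Number fields inside the complex numbers\<close>

definition rat_adjoin :: "complex \<Rightarrow> complex set" where
  "rat_adjoin \<alpha> = generate_field ring_of_type_algebra {\<alpha>}"

definition ring_of_integers :: "complex set \<Rightarrow> complex set" where
  "ring_of_integers K = {x \<in> K. algebraic_int x}"

definition primitive_root_of_unity :: "nat \<Rightarrow> complex \<Rightarrow> bool" where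
  "primitive_root_of_unity n \<xi> \<longleftrightarrow> \<xi> ^ n = 1 \<and> (\<forall>m. 0 < m \<and> m < n \<longrightarrow> \<xi> ^ m \<noteq> 1)"


section \<open>The ideal class group\<close>

definition fractional_ideal :: "complex set \<Rightarrow> complex set \<Rightarrow> bool" where
  "fractional_ideal K I \<longleftrightarrow>
     I \<subseteq> K \<and> 0 \<in> I \<and> I \<noteq> {0} \<and>
     (\<forall>x\<in>I. \<forall>y\<in>I. x + y \<in> I) \<and>
     (\<forall>r\<in>ring_of_integers K. \<forall>x\<in>I. r * x \<in> I) \<and>
     (\<exists>d\<in>ring_of_integers K. d \<noteq> 0 \<and> (\<forall>x\<in>I. d * x \<in> ring_of_integers K))"

definition frac_ideal_mult :: "complex set \<Rightarrow> complex set \<Rightarrow> complex set" where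
  "frac_ideal_mult I J =
     {\<Sum>i<m. x i * y i | (m::nat) x y. \<forall>i<m. x i \<in> I \<and> y i \<in> J}"

definition frac_ideal_group :: "complex set \<Rightarrow> complex set monoid" where
  "frac_ideal_group K =
     \<lparr>carrier = {I. fractional_ideal K I}, mult = frac_ideal_mult, one = ring_of_integers K\<rparr>"

definition principal_frac_ideals :: "complex set \<Rightarrow> complex set set" where
  "principal_frac_ideals K = {(\<lambda>r. x * r) ` ring_of_integers K | x. x \<in> K \<and> x \<noteq> 0}"

definition class_group :: "complex set \<Rightarrow> complex set set monoid" where
  "class_group K = frac_ideal_group K Mod principal_frac_ideals K"

definition class_group_2_torsion :: "complex set \<Rightarrow> complex set set set" where
  "class_group_2_torsion K =
     {c \<in> carrier (class_group K). c \<otimes>\<^bsub>class_group K\<^esub> c = \<one>\<^bsub>class_group K\<^esub>}"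

definition h2 :: "complex set \<Rightarrow> nat" where
  "h2 K = card (class_group_2_torsion K)"


section \<open>Two-dimensional representations\<close>

definition GL2 :: "complex set \<Rightarrow> (complex^2^2) monoid" where
  "GL2 R = units_of \<lparr>carrier = {A. \<forall>i j. A $ i $ j \<in> R}, mult = (**), one = mat 1\<rparr>"

definition K_subspace :: "complex set \<Rightarrow> (complex^2) set \<Rightarrow> bool" where
  "K_subspace K V \<longleftrightarrow>
     V \<subseteq> {v. \<forall>i. v $ i \<in> K} \<and> 0 \<in> V \<and>
     (\<forall>v\<in>V. \<forall>w\<in>V. v + w \<in> V) \<and> (\<forall>c\<in>K. \<forall>v\<in>V. c *s v \<in> V)"

definition irreducible_rep ::
    "('g, 'm) monoid_scheme \<Rightarrow> complex set \<Rightarrow> ('g \<Rightarrow> complex^2^2) \<Rightarrow> bool" where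
  "irreducible_rep G K \<rho> \<longleftrightarrow>
     (\<forall>V. K_subspace K V \<and> (\<forall>g\<in>carrier G. \<forall>v\<in>V. \<rho> g *v v \<in> V) \<longrightarrow>
        V = {0} \<or> V = {v. \<forall>i. v $ i \<in> K})"

definition conjugate_homs ::
    "('g, 'm) monoid_scheme \<Rightarrow> ('h, 'k) monoid_scheme \<Rightarrow> ('g \<Rightarrow> 'h) \<Rightarrow> ('g \<Rightarrow> 'h) \<Rightarrow> bool" where
  "conjugate_homs G H \<phi> \<psi> \<longleftrightarrow>
     (\<exists>P\<in>carrier H. \<forall>g\<in>carrier G. \<psi> g = P \<otimes>\<^bsub>H\<^esub> \<phi> g \<otimes>\<^bsub>H\<^esub> inv\<^bsub>H\<^esub> P)"

text \<open>
  Elements of \<open>hom\<close> are unconstrained outside the carrier.  Since conjugacy only looks at the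
  carrier, functions agreeing there lie in the same class, so the quotient below is not inflated.
\<close>

definition integral_forms ::
    "('g, 'm) monoid_scheme \<Rightarrow> complex set \<Rightarrow> ('g \<Rightarrow> complex^2^2) \<Rightarrow> ('g \<Rightarrow> complex^2^2) set" where
  "integral_forms G K \<psi> =
     {\<phi> \<in> hom G (GL2 (ring_of_integers K)). conjugate_homs G (GL2 K) \<psi> \<phi>}"

definition integral_form_classes ::
    "('g, 'm) monoid_scheme \<Rightarrow> complex set \<Rightarrow> ('g \<Rightarrow> complex^2^2) \<Rightarrow> ('g \<Rightarrow> complex^2^2) set set" where
  "integral_form_classes G K \<psi> =
     integral_forms G K \<psi> //
       {(\<phi>, \<phi>'). conjugate_homs G (GL2 (ring_of_integers K)) \<phi> \<phi>'}"

end

(*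
  Let L = K(zeta) be the n-th cyclotomic field.  A faithful irreducible representation of D_n over K
  is L itself, with a acting as multiplication by zeta and b as complex conjugation, so its
  integral forms up to conjugacy are the lattices in L that are stable under O_K, zeta and
  conjugation and free over O_K, up to scaling by K*.

  Write such a lattice as M, and let I be its intersection with K.  If zeta - 1/zeta is a unit, which
  happens unless n is a prime power or twice a prime power, then M = I + I zeta.  Otherwise, up to
  the sign of zeta, the norm of lam = 1 - zeta is a prime element of O_K with residue field F_p, and M
  is either I' + I' zeta or lam (I' + I' zeta) for an ideal I' of K, but not both.

  Finally I + I zeta is free over O_K if and only if I^2 is principal: one direction takes
  determinants, and conversely, if I^2 = (c), then c = x u + y v for some x, y, u, v in I, and the
  vectors (x, y) and (-v, u), having determinant c, form a basis of I x I.
*)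

theory Submission
  imports "Jordan_Normal_Form.Char_Poly" Defs
begin

hide_const (open) Polynomials.lead_coeff Polynomials.degree
  up_ring.coeff up_ring.monom Divisibility.prime
hide_const (open) Matrix.mat Matrix.vec Matrix.row Matrix.col Determinant.det
no_notation fps_nth (infixl "$" 75)
no_notation Matrix.vec_index (infixl "$" 100)
no_notation Matrix.transpose_mat ("(_\<^sup>T)" [1000])

section \<open>Algebraic integers\<close>

text \<open>Arguments are made with elements: divisibility is tested by multiplying into the
  integers, and the place of localization at \<pi> = \<open>lam * cnj lam\<close> is taken by
  multipliers \<open>c\<close> in O_K that \<pi> does not divide.

  Scalars from K* are the only ambiguity because a linear map commuting with multiplication by
  \<zeta> is multiplication by an element of L, and commuting with conjugation puts that element in
  K. The root \<zeta> is read off from the representation and may be a different primitive root from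
  the given \<xi>.

  The dividing line is \<zeta> - 1/\<zeta> because its square \<tau>^2 - 4 is the discriminant of
  X^2 - \<tau> X + 1, and splitting an element of M into its coordinates in 1 and \<zeta> costs
  exactly this factor. Multiplication by \<open>lam\<close> is O_K-linear, so the second kind of
  lattice is free under the same condition on the ideal; this is where the factor 2 in the count
  comes from. If n is twice an odd prime power, -\<zeta> has prime power order and the same stable
  lattices, whence the change of sign.\<close>

definition int_span :: "complex set \<Rightarrow> complex set" where
  "int_span S = {\<Sum>s\<in>S. of_int (c s) * s | c. True}"

lemma int_spanI: "(\<Sum>s\<in>S. of_int (c s) * s) \<in> int_span S"
  unfolding int_span_def by blast

lemma int_span_add: "x \<in> int_span S \<Longrightarrow> y \<in> int_span S \<Longrightarrow> x + y \<in> int_span S"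
proof -
  assume "x \<in> int_span S" "y \<in> int_span S"
  then obtain c d where "x = (\<Sum>s\<in>S. of_int (c s) * s)" "y = (\<Sum>s\<in>S. of_int (d s) * s)"
    unfolding int_span_def by blast
  then have "x + y = (\<Sum>s\<in>S. of_int (c s + d s) * s)"
    by (simp add: sum.distrib algebra_simps)
  then show ?thesis using int_spanI by metis
qed

lemma int_span_scale: "x \<in> int_span S \<Longrightarrow> of_int k * x \<in> int_span S"
proof -
  assume "x \<in> int_span S"
  then obtain c where "x = (\<Sum>s\<in>S. of_int (c s) * s)"
    unfolding int_span_def by blast
  then have "of_int k * x = (\<Sum>s\<in>S. of_int (k * c s) * s)"
    by (simp add: sum_distrib_left algebra_simps)
  then show ?thesis using int_spanI by metis
qed

lemma int_span_0: "0 \<in> int_span S"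
  using int_spanI[where S = S and c = "\<lambda>_. 0"] by simp

lemma int_span_sum: "(\<And>i. i \<in> A \<Longrightarrow> f i \<in> int_span S) \<Longrightarrow> sum f A \<in> int_span S"
  by (induction A rule: infinite_finite_induct) (auto intro: int_span_0 int_span_add)

lemma int_span_base: "finite S \<Longrightarrow> s \<in> S \<Longrightarrow> s \<in> int_span S"
  using int_spanI[where S = S and c = "\<lambda>t. if t = s then 1 else 0"] by (simp add: if_distrib if_distribR cong: if_cong)

lemma int_span_mult_closed:
  assumes "\<And>s. s \<in> S \<Longrightarrow> z * s \<in> int_span S" and "x \<in> int_span S"
  shows "z * x \<in> int_span S"
proof -
  obtain c where "x = (\<Sum>s\<in>S. of_int (c s) * s)"
    using assms(2) unfolding int_span_def by blast
  then have "z * x = (\<Sum>s\<in>S. of_int (c s) * (z * s))"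
    by (simp add: sum_distrib_left algebra_simps)
  then show ?thesis using assms(1) by (auto intro!: int_span_sum int_span_scale)
qed

text \<open>The vector of elements of \<open>S\<close> is an eigenvector, with eigenvalue \<open>z\<close>, of an integer matrix.\<close>

lemma algebraic_int_eigenvalue:
  fixes z :: complex
  assumes fin: "finite S" and one: "1 \<in> S" and closed: "\<And>s. s \<in> S \<Longrightarrow> z * s \<in> int_span S"
  shows "algebraic_int z"
proof -
  obtain g where g: "bij_betw g {..<card S} S"
    using ex_bij_betw_nat_finite[OF fin] atLeast0LessThan by metis
  define N where "N = card S"
  have "\<exists>c. z * s = (\<Sum>t\<in>S. of_int (c t) * t)" if "s \<in> S" for s
    using closed[OF that] unfolding int_span_def by blast
  then obtain c :: "complex \<Rightarrow> complex \<Rightarrow> int"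
    where c: "\<And>s. s \<in> S \<Longrightarrow> z * s = (\<Sum>t\<in>S. of_int (c s t) * t)" by metis
  define A where "A = Matrix.mat N N (\<lambda>(i,j). c (g i) (g j))"
  define B where "B = map_mat (of_int :: int \<Rightarrow> complex) A"
  define v where "v = Matrix.vec N g"
  have A: "A \<in> carrier_mat N N" and B: "B \<in> carrier_mat N N" by (auto simp: A_def B_def)
  have v: "v \<in> carrier_vec N" by (auto simp: v_def)
  have "B *\<^sub>v v = z \<cdot>\<^sub>v v"
  proof (rule eq_vecI)
    fix i assume "i < dim_vec (z \<cdot>\<^sub>v v)"
    then have i: "i < N" by (simp add: v_def)
    then have gi: "g i \<in> S" using g by (auto simp: N_def bij_betw_def)
    have "vec_index (B *\<^sub>v v) i = (\<Sum>j<N. of_int (c (g i) (g j)) * g j)"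
      using i by (simp add: B_def A_def v_def scalar_prod_def atLeast0LessThan)
    also have "\<dots> = (\<Sum>t\<in>S. of_int (c (g i) t) * t)"
      unfolding N_def by (rule sum.reindex_bij_betw[OF g])
    also have "\<dots> = vec_index (z \<cdot>\<^sub>v v) i" using c[OF gi] i by (simp add: v_def)
    finally show "vec_index (B *\<^sub>v v) i = vec_index (z \<cdot>\<^sub>v v) i" .
  qed (use B in \<open>auto simp: v_def\<close>)
  moreover have "v \<noteq> 0\<^sub>v N"
  proof
    assume v0: "v = 0\<^sub>v N"
    obtain i where i: "i < N" "g i = 1" using g one unfolding N_def bij_betw_def by (metis imageE lessThan_iff)
    then have "vec_index v i = 1" by (simp add: v_def)
    with v0 i show False by simp
  qed
  ultimately have "eigenvalue B z"
    unfolding eigenvalue_def eigenvector_def using v B by auto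
  then have "poly (char_poly B) z = 0" using eigenvalue_root_char_poly[OF B] by simp
  moreover have "char_poly B = map_poly of_int (char_poly A)"
    unfolding B_def by (rule of_int_hom.char_poly_hom[OF A])
  moreover have "lead_coeff (char_poly A) = 1"
    using degree_monic_char_poly[OF A] by simp
  ultimately show ?thesis
    unfolding algebraic_int_altdef_ipoly by auto
qed

text \<open>A monic equation of degree n rewrites x^n, hence every power, through lower powers.
  \<open>n > 0\<close> is kept so that 1 = x^0 belongs to the spanning set, as the eigenvalue
  criterion asks.\<close>

lemma algebraic_int_power_span:
  assumes "algebraic_int (x :: complex)"
  obtains n where "\<And>k. x ^ k \<in> int_span ((\<lambda>i. x ^ i) ` {..<n})" "n > 0"
proof -
  obtain p where p: "poly (map_poly of_int p) x = 0" "lead_coeff (p :: int poly) = 1"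
    using assms unfolding algebraic_int_altdef_ipoly by blast
  define n where "n = degree p"
  have n: "n > 0"
  proof (rule ccontr)
    assume "\<not> n > 0"
    then obtain a where "p = [:a:]" by (metis degree_eq_zeroE n_def neq0_conv)
    with p(2) have "p = 1" by (simp add: one_pCons)
    with p(1) show False by simp
  qed
  let ?S = "(\<lambda>i. x ^ i) ` {..<n}"
  have lt: "x ^ k \<in> int_span ?S" if "k < n" for k
    using that by (intro int_span_base) auto
  have "0 = (\<Sum>i\<le>n. of_int (coeff p i) * x ^ i)"
    using p(1) by (simp add: poly_altdef n_def degree_map_poly coeff_map_poly)
  also have "\<dots> = x ^ n + (\<Sum>i<n. of_int (coeff p i) * x ^ i)"
    using p(2) by (simp add: n_def lessThan_Suc_atMost[symmetric])
  finally have xn: "x ^ n = (\<Sum>i<n. of_int (- coeff p i) * x ^ i)"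
    by (simp add: sum_negf add_eq_0_iff2)
  have xn': "x ^ n \<in> int_span ?S"
    unfolding xn by (intro int_span_sum int_span_scale lt) auto
  have step: "x * s \<in> int_span ?S" if sS: "s \<in> ?S" for s
  proof -
    obtain i where i: "i < n" "s = x ^ i" using sS by auto
    show ?thesis
    proof (cases "Suc i < n")
      case True
      then show ?thesis using lt[OF True] i by simp
    next
      case False
      then have "Suc i = n" using i by simp
      then show ?thesis using xn' i by (metis power_Suc)
    qed
  qed
  have "x ^ k \<in> int_span ?S" for k
  proof (induction k)
    case 0 then show ?case using lt[OF n] by simp
  next
    case (Suc k)
    then show ?case using int_span_mult_closed[OF step] by simp
  qed
  then show ?thesis using that n by blast
qed

text \<open>The finitely many products x^i y^j span a group that contains 1 and is stable under both
  x and y, so x + y and x y are eigenvalues of integer matrices.\<close>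

lemma
  fixes x y :: complex
  assumes "algebraic_int x" "algebraic_int y"
  shows algebraic_int_add: "algebraic_int (x + y)"
    and algebraic_int_times: "algebraic_int (x * y)"
proof -
  obtain n where n: "\<And>k. x ^ k \<in> int_span ((\<lambda>i. x ^ i) ` {..<n})" "n > 0"
    using algebraic_int_power_span[OF assms(1)] by blast
  obtain m where m: "\<And>k. y ^ k \<in> int_span ((\<lambda>i. y ^ i) ` {..<m})" "m > 0"
    using algebraic_int_power_span[OF assms(2)] by blast
  define A where "A = (\<lambda>i. x ^ i) ` {..<n}"
  define B where "B = (\<lambda>i. y ^ i) ` {..<m}"
  define S where "S = (\<lambda>(a,b). a * b) ` (A \<times> B)"
  have fin: "finite S" "finite A" "finite B" by (auto simp: S_def A_def B_def)
  have prod: "u * v \<in> int_span S" if "u \<in> int_span A" "v \<in> int_span B" for u v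
  proof -
    obtain c d where "u = (\<Sum>s\<in>A. of_int (c s) * s)" "v = (\<Sum>s\<in>B. of_int (d s) * s)"
      using \<open>u \<in> int_span A\<close> \<open>v \<in> int_span B\<close> unfolding int_span_def by blast
    then have "u * v = (\<Sum>s\<in>A. \<Sum>t\<in>B. of_int (c s * d t) * (s * t))"
      by (simp add: sum_product algebra_simps)
    also have "\<dots> \<in> int_span S"
      using fin by (intro int_span_sum int_span_scale int_span_base) (auto simp: S_def)
    finally show ?thesis .
  qed
  have one: "1 \<in> S"
    using n(2) m(2) by (auto simp: S_def A_def B_def image_iff intro!: bexI[of _ 0])
  have xs: "x * s \<in> int_span S" and ys: "y * s \<in> int_span S" if "s \<in> S" for s
  proof -
    obtain i j where s: "s = x ^ i * y ^ j" using \<open>s \<in> S\<close> by (auto simp: S_def A_def B_def)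
    have "x ^ Suc i * y ^ j \<in> int_span S" "x ^ i * y ^ Suc j \<in> int_span S"
      using prod n(1) m(1) by (auto simp: A_def B_def simp del: power_Suc)
    then show "x * s \<in> int_span S" "y * s \<in> int_span S" by (simp_all add: s algebra_simps)
  qed
  show "algebraic_int (x + y)"
    by (rule algebraic_int_eigenvalue[OF fin(1) one])
      (use xs ys in \<open>auto simp: distrib_right intro: int_span_add\<close>)
  show "algebraic_int (x * y)"
    by (rule algebraic_int_eigenvalue[OF fin(1) one])
      (use int_span_mult_closed[OF xs] ys in \<open>auto simp: mult.assoc\<close>)
qed


lemma algebraic_int_sum: "(\<And>i. i \<in> A \<Longrightarrow> algebraic_int (f i :: complex)) \<Longrightarrow> algebraic_int (sum f A)"
  by (induction A rule: infinite_finite_induct) (auto intro: algebraic_int_add)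

lemma algebraic_int_prod: "(\<And>i. i \<in> A \<Longrightarrow> algebraic_int (f i :: complex)) \<Longrightarrow> algebraic_int (prod f A)"
  by (induction A rule: infinite_finite_induct) (auto intro: algebraic_int_times)

lemma algebraic_int_power: "algebraic_int (x :: complex) \<Longrightarrow> algebraic_int (x ^ n)"
  by (induction n) (auto intro: algebraic_int_times)

lemma algebraic_int_diff: "algebraic_int (x :: complex) \<Longrightarrow> algebraic_int y \<Longrightarrow> algebraic_int (x - y)"
  using algebraic_int_add[of x "- y"] by simp

lemma algebraic_int_of_int: "algebraic_int (of_int k :: complex)"
  by (rule int_imp_algebraic_int) simp

lemma algebraic_int_of_nat: "algebraic_int (of_nat k :: complex)"
  by (rule int_imp_algebraic_int) simp

lemmas algebraic_int_intros = algebraic_int_add algebraic_int_times algebraic_int_diff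
  algebraic_int_minus algebraic_int_power algebraic_int_of_int algebraic_int_of_nat
  algebraic_int_sum algebraic_int_prod

lemma algebraic_int_poly:
  "algebraic_int (x :: complex) \<Longrightarrow> algebraic_int (poly (of_int_poly p) x)"
  unfolding poly_altdef
  by (intro algebraic_int_sum algebraic_int_times algebraic_int_power)
    (auto simp: coeff_map_poly algebraic_int_of_int)

text \<open>Stripping factors X from an integral equation leaves a nonzero constant term, which is a
  multiple of x. The cofactor is an integer polynomial in x, so it stays in every ring that contains
  x; this does the work of a norm.\<close>

lemma algebraic_int_dvd_int:
  assumes "algebraic_int (x :: complex)" "x \<noteq> 0"
  obtains N :: int and p :: "int poly" where "N \<noteq> 0" "x * poly (of_int_poly p) x = of_int N"
proof -
  obtain p where p: "poly (of_int_poly p) x = 0" "lead_coeff (p :: int poly) = 1"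
    using assms(1) unfolding algebraic_int_altdef_ipoly by blast
  then have "p \<noteq> 0" by auto
  have "\<exists>r N. N \<noteq> 0 \<and> x * poly (of_int_poly r) x = of_int N"
    if "poly (of_int_poly p) x = 0" "p \<noteq> 0" for p :: "int poly"
    using that
  proof (induction p)
    case (pCons a p)
    have *: "of_int a + x * poly (of_int_poly p) x = 0"
      using pCons.prems by (simp add: map_poly_pCons)
    show ?case
    proof (cases "a = 0")
      case True
      then have "p \<noteq> 0" using pCons by auto
      moreover have "poly (of_int_poly p) x = 0" using * True assms(2) by simp
      ultimately show ?thesis using pCons.IH by blast
    next
      case False
      then have "x * poly (of_int_poly p) x = of_int (- a)" using * by (simp add: add_eq_0_iff)
      then show ?thesis using False by (metis neg_equal_0_iff_equal)
    qed
  qed simp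
  then show ?thesis using that p(1) \<open>p \<noteq> 0\<close> by blast
qed

text \<open>The powers of s lie in a finitely generated group, which has finitely many classes
  modulo N; they are eventually periodic there, and some power is idempotent. The quotient is given
  as a polynomial in s to keep it inside O_K.\<close>

lemma algebraic_int_eventually_idempotent_mod:
  assumes s: "algebraic_int (s :: complex)" and N: "N \<noteq> (0 :: int)"
  obtains M p where "M > 0" "s ^ M * (1 - s ^ M) = of_int N * poly (of_int_poly p) s"
proof -
  obtain n where n: "\<And>k. s ^ k \<in> int_span ((\<lambda>i. s ^ i) ` {..<n})"
    using algebraic_int_power_span[OF s] by metis
  define S where "S = (\<lambda>i. s ^ i) ` {..<n}"
  have finS: "finite S" by (simp add: S_def)
  have "\<exists>c. s ^ k = (\<Sum>t\<in>S. of_int (c t) * t)" for k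
    using n[of k] unfolding int_span_def S_def by blast
  then obtain c :: "nat \<Rightarrow> complex \<Rightarrow> int" where c: "\<And>k. s ^ k = (\<Sum>t\<in>S. of_int (c k t) * t)"
    by metis
  define f where "f k = restrict (\<lambda>t. c k t mod N) S" for k
  have "finite (\<Union>k. {f k})"
  proof (rule finite_subset)
    show "(\<Union>k. {f k}) \<subseteq> PiE S (\<lambda>_. (\<lambda>r. r mod N) ` UNIV)" by (auto simp: f_def)
    have "finite ((\<lambda>r. r mod N) ` UNIV)"
      by (rule finite_subset[of _ "{- \<bar>N\<bar><..<\<bar>N\<bar>}"])
        (use abs_mod_less[OF N] in \<open>auto simp: abs_less_iff minus_less_iff\<close>)
    then show "finite (PiE S (\<lambda>_. (\<lambda>r. r mod N) ` UNIV))" using finS by (intro finite_PiE)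
  qed
  then have "finite (range f)" by (simp add: UNION_singleton_eq_range)
  then have "\<not> inj f" using finite_imageD infinite_UNIV_nat by blast
  then obtain i j where ij: "f i = f j" "i < j"
    unfolding inj_def by (metis linorder_neqE_nat)
  define l where "l = j - i"
  have "\<exists>p. t = poly (of_int_poly p) s" if tS: "t \<in> S" for t
  proof -
    obtain i where "t = s ^ i" using tS by (auto simp: S_def)
    then have "t = poly (of_int_poly (monom 1 i)) s" by (simp add: poly_monom)
    then show ?thesis by blast
  qed
  then obtain P where P: "\<And>t. t \<in> S \<Longrightarrow> t = poly (of_int_poly (P t)) s" by metis
  define q where "q = (\<Sum>t\<in>S. Polynomial.smult ((c i t - c j t) div N) (P t))"
  have cN: "(of_int (c i t) - of_int (c j t) :: complex) = of_int N * of_int ((c i t - c j t) div N)"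
    if "t \<in> S" for t
  proof -
    have "c i t mod N = c j t mod N" using ij(1) that by (metis f_def restrict_apply')
    then have "N dvd c i t - c j t" by (simp add: mod_eq_dvd_iff)
    then have "c i t - c j t = N * ((c i t - c j t) div N)" by simp
    then show ?thesis by (metis of_int_diff of_int_mult)
  qed
  have poly_sum_of_int: "poly (of_int_poly (sum g A)) s = (\<Sum>t\<in>A. poly (of_int_poly (g t)) s)"
    for g :: "complex \<Rightarrow> int poly" and A
    by (induction A rule: infinite_finite_induct) (simp_all add: of_int_hom.map_poly_hom_add)
  have "s ^ i - s ^ j = (\<Sum>t\<in>S. (of_int (c i t) - of_int (c j t)) * t)"
    by (simp add: c sum_subtractf left_diff_distrib)
  also have "\<dots> = (\<Sum>t\<in>S. of_int N * (of_int ((c i t - c j t) div N) * poly (of_int_poly (P t)) s))"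
    by (intro sum.cong refl) (metis cN P mult.assoc)
  also have "\<dots> = of_int N * poly (of_int_poly q) s"
    unfolding q_def poly_sum_of_int by (simp add: sum_distrib_left of_int_hom.map_poly_hom_smult)
  finally have base: "s ^ i - s ^ (i + l) = of_int N * poly (of_int_poly q) s"
    using ij by (simp add: l_def)
  \<comment> \<open>A multiple of the period \<open>l\<close> that is at least the preperiod
    \<open>i\<close>: adding M to the exponent M changes nothing modulo N, so s^(2M) and s^M
    agree.\<close>
  define M where "M = l * (i + 1)"
  have M: "M > 0" using ij by (auto simp: M_def l_def)
  have "1 * (i + 1) \<le> l * (i + 1)" using ij by (intro mult_right_mono) (auto simp: l_def)
  then have Mi: "M \<ge> i" by (simp add: M_def)
  have "\<exists>p. s ^ M - s ^ (M + l * k) = of_int N * poly (of_int_poly p) s" for k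
  proof (induction k)
    case 0
    then show ?case by (intro exI[of _ 0]) simp
  next
    case (Suc k)
    then obtain p where p: "s ^ M - s ^ (M + l * k) = of_int N * poly (of_int_poly p) s" by blast
    have "s ^ (M + l * k) - s ^ (M + l * Suc k) = s ^ (M + l * k - i) * (s ^ i - s ^ (i + l))"
      using Mi by (simp add: algebra_simps flip: power_add)
    also have "\<dots> = of_int N * poly (of_int_poly (monom 1 (M + l * k - i) * q)) s"
      by (simp add: base poly_monom of_int_poly_hom.hom_mult)
    finally have "s ^ M - s ^ (M + l * Suc k) = of_int N * poly (of_int_poly (p + monom 1 (M + l * k - i) * q)) s"
      using p by (simp add: of_int_poly_hom.hom_add distrib_left algebra_simps)
    then show ?case by blast
  qed
  from this[of "i + 1"] obtain p where "s ^ M - s ^ (M + M) = of_int N * poly (of_int_poly p) s"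
    by (auto simp: M_def)
  then show ?thesis using that M by (simp add: right_diff_distrib power_add)
qed


section \<open>Number fields\<close>

text \<open>Algebraicity is stated as the existence of an integer denominator, the form in which it
  serves to clear denominators.\<close>

locale number_field =
  fixes K :: "complex set"
  assumes one_mem [simp, intro]: "1 \<in> K"
    and add_mem [intro]: "x \<in> K \<Longrightarrow> y \<in> K \<Longrightarrow> x + y \<in> K"
    and mult_mem [intro]: "x \<in> K \<Longrightarrow> y \<in> K \<Longrightarrow> x * y \<in> K"
    and uminus_mem [intro]: "x \<in> K \<Longrightarrow> - x \<in> K"
    and inverse_mem [intro]: "x \<in> K \<Longrightarrow> inverse x \<in> K"
    and algebraic_mem: "x \<in> K \<Longrightarrow> \<exists>N. N \<noteq> (0 :: int) \<and> algebraic_int (of_int N * x)"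
begin

abbreviation \<O> where "\<O> \<equiv> ring_of_integers K"

lemma diff_mem [intro]: "x \<in> K \<Longrightarrow> y \<in> K \<Longrightarrow> x - y \<in> K"
  using add_mem[of x "- y"] uminus_mem[of y] by simp

lemma zero_mem [simp, intro]: "0 \<in> K"
  using diff_mem[of 1 1] by simp

lemma divide_mem [intro]: "x \<in> K \<Longrightarrow> y \<in> K \<Longrightarrow> x / y \<in> K"
  by (simp add: divide_inverse mult_mem inverse_mem)

lemma power_mem [intro]: "x \<in> K \<Longrightarrow> x ^ n \<in> K"
  by (induction n) auto

lemma of_nat_mem [simp, intro]: "of_nat k \<in> K"
  by (induction k) auto

lemma of_int_mem [simp, intro]: "of_int k \<in> K"
  by (cases k rule: int_cases2) auto

lemma OI: "x \<in> K \<Longrightarrow> algebraic_int x \<Longrightarrow> x \<in> \<O>"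
  and O_mem: "x \<in> \<O> \<Longrightarrow> x \<in> K"
  and O_algebraic_int: "x \<in> \<O> \<Longrightarrow> algebraic_int x"
  by (auto simp: ring_of_integers_def)

lemma O_zero [simp, intro]: "0 \<in> \<O>"
  and O_one [simp, intro]: "1 \<in> \<O>"
  and O_add [intro]: "x \<in> \<O> \<Longrightarrow> y \<in> \<O> \<Longrightarrow> x + y \<in> \<O>"
  and O_diff [intro]: "x \<in> \<O> \<Longrightarrow> y \<in> \<O> \<Longrightarrow> x - y \<in> \<O>"
  and O_mult [intro]: "x \<in> \<O> \<Longrightarrow> y \<in> \<O> \<Longrightarrow> x * y \<in> \<O>"
  and O_uminus [intro]: "x \<in> \<O> \<Longrightarrow> - x \<in> \<O>"
  and O_power [intro]: "x \<in> \<O> \<Longrightarrow> x ^ n \<in> \<O>"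
  and O_of_int [simp, intro]: "of_int k \<in> \<O>"
  and O_of_nat [simp, intro]: "of_nat m \<in> \<O>"
  by (auto simp: ring_of_integers_def intro: algebraic_int_intros)

lemma O_sum [intro]: "(\<And>i. i \<in> A \<Longrightarrow> f i \<in> \<O>) \<Longrightarrow> sum f A \<in> \<O>"
  by (induction A rule: infinite_finite_induct) auto

lemma O_poly: "x \<in> \<O> \<Longrightarrow> poly (of_int_poly p) x \<in> \<O>"
  unfolding poly_altdef by (intro O_sum O_mult O_power) (auto simp: coeff_map_poly)

lemma O_dvd_int:
  assumes "x \<in> \<O>" "x \<noteq> 0"
  obtains N y where "N \<noteq> (0 :: int)" "y \<in> \<O>" "x * y = of_int N"
  using algebraic_int_dvd_int[OF O_algebraic_int[OF assms(1)] assms(2)] O_poly[OF assms(1)] by metis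

lemma common_denominator:
  assumes "finite A" "A \<subseteq> K"
  shows "\<exists>N. N \<noteq> (0::int) \<and> (\<forall>x\<in>A. of_int N * x \<in> \<O>)"
  using assms
proof (induction A rule: finite_induct)
    case (insert x A)
    then obtain N where N: "N \<noteq> (0::int)" "\<forall>x\<in>A. of_int N * x \<in> \<O>" by auto
    obtain M where M: "M \<noteq> (0::int)" "algebraic_int (of_int M * x)"
      using algebraic_mem[of x] insert.prems by (meson insert_subset)
    then have Mx: "of_int M * x \<in> \<O>" using insert.prems by (intro OI) auto
    have "of_int (M * N) * y \<in> \<O>" if "y \<in> insert x A" for y
    proof (cases "y = x")
      case True
      then show ?thesis using O_mult[OF O_of_int[of N] Mx] by (simp add: mult_ac)
    next
      case False
      then have "of_int N * y \<in> \<O>" using that N by blast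
      then show ?thesis using O_mult[OF O_of_int[of M], of "of_int N * y"] by (simp add: mult_ac)
    qed
    moreover have "M * N \<noteq> 0" using M N by simp
    ultimately show ?case by blast
qed (intro exI[of _ 1], simp)

section \<open>Fractional ideals and their products\<close>

lemma fractional_idealD:
  assumes "fractional_ideal K I"
  shows "I \<subseteq> K" "0 \<in> I" "u \<in> I \<Longrightarrow> v \<in> I \<Longrightarrow> u + v \<in> I"
    "r \<in> \<O> \<Longrightarrow> u \<in> I \<Longrightarrow> r * u \<in> I" "u \<in> I \<Longrightarrow> - u \<in> I"
proof -
  show "r * u \<in> I" if "r \<in> \<O>" "u \<in> I" for r u
    using assms that by (auto simp: fractional_ideal_def)
  from this[of "-1" u] show "u \<in> I \<Longrightarrow> - u \<in> I" using O_uminus[OF O_one] by simp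
qed (use assms in \<open>auto simp: fractional_ideal_def\<close>)

lemma frac_ideal_mult_base: "x \<in> I \<Longrightarrow> y \<in> J \<Longrightarrow> x * y \<in> frac_ideal_mult I J"
  unfolding frac_ideal_mult_def
  by (intro CollectI exI[of _ 1] exI[of _ "\<lambda>_. x"] exI[of _ "\<lambda>_. y"]) simp

lemma frac_ideal_mult_zero: "0 \<in> frac_ideal_mult I J"
  unfolding frac_ideal_mult_def
  by (intro CollectI exI[of _ 0]) simp

lemma frac_ideal_mult_add:
  assumes "u \<in> frac_ideal_mult I J" "v \<in> frac_ideal_mult I J"
  shows "u + v \<in> frac_ideal_mult I J"
proof -
  obtain m x y where 1: "u = (\<Sum>i<m. x i * y i)" "\<forall>i<(m::nat). x i \<in> I \<and> y i \<in> J"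
    using assms(1) unfolding frac_ideal_mult_def by blast
  obtain n z w where 2: "v = (\<Sum>i<n. z i * w i)" "\<forall>i<(n::nat). z i \<in> I \<and> w i \<in> J"
    using assms(2) unfolding frac_ideal_mult_def by blast
  define f where "f i = (if i < m then x i else z (i - m))" for i
  define g where "g i = (if i < m then y i else w (i - m))" for i
  have "(\<Sum>i<m + n. f i * g i) = u + v"
  proof -
    have "(\<Sum>i<m + n. f i * g i) = (\<Sum>i<m. f i * g i) + (\<Sum>i<n. f (m + i) * g (m + i))"
      by (induction n) (simp_all add: add.assoc)
    then show ?thesis by (simp add: f_def g_def 1 2)
  qed
  moreover have "\<forall>i<m + n. f i \<in> I \<and> g i \<in> J" using 1 2 by (auto simp: f_def g_def)
  ultimately show ?thesis unfolding frac_ideal_mult_def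
    by (intro CollectI exI[of _ "m + n"] exI[of _ f] exI[of _ g]) simp
qed

lemma frac_ideal_mult_least:
  assumes "0 \<in> S" "\<And>u v. u \<in> S \<Longrightarrow> v \<in> S \<Longrightarrow> u + v \<in> S"
    and "\<And>x y. x \<in> I \<Longrightarrow> y \<in> J \<Longrightarrow> x * y \<in> S"
  shows "frac_ideal_mult I J \<subseteq> S"
proof
  fix u assume "u \<in> frac_ideal_mult I J"
  then obtain m x y where "u = (\<Sum>i<m. x i * y i)" "\<forall>i<(m::nat). x i \<in> I \<and> y i \<in> J"
    unfolding frac_ideal_mult_def by blast
  then show "u \<in> S"
  proof (induction m arbitrary: u)
    case (Suc m)
    then show ?case using assms by simp
  qed (use assms in simp)
qed

text \<open>The Steinitz class of \<open>I \<oplus> I\<close> is that of \<open>I\<^sup>2\<close>: the \<open>2 \<times> 2\<close> determinants with columns in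
  \<open>I \<times> I\<close> generate \<open>I\<^sup>2\<close>.\<close>

lemma square_principal_if_free:
  assumes K: "a \<in> K" "b \<in> K" "c \<in> K" "d \<in> K" and det: "a * d - b * c \<noteq> 0"
    and eq: "{(a * s + b * t, c * s + d * t) | s t. s \<in> \<O> \<and> t \<in> \<O>} = I \<times> I"
  shows "fractional_ideal K I" "frac_ideal_mult I I = (\<lambda>r. (a * d - b * c) * r) ` \<O>"
proof -
  let ?D = "a * d - b * c"
  have mem: "\<exists>s\<in>\<O>. \<exists>t\<in>\<O>. x = a * s + b * t \<and> y = c * s + d * t" if "x \<in> I" "y \<in> I" for x y
    using eq that by blast
  have col: "a * s + b * t \<in> I" "c * s + d * t \<in> I" if "s \<in> \<O>" "t \<in> \<O>" for s t
    using eq that by blast+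
  have I: "a \<in> I" "b \<in> I" "c \<in> I" "d \<in> I"
    using col[of 1 0] col[of 0 1] by auto
  have IK: "I \<subseteq> K"
  proof
    fix x assume "x \<in> I"
    then show "x \<in> K" using mem[of x x] K O_mem by blast
  qed
  have Iadd: "x + y \<in> I" if xy: "x \<in> I" "y \<in> I" for x y
  proof -
    obtain s t where st: "s \<in> \<O>" "t \<in> \<O>" "x = a * s + b * t" using mem[of x x] xy by blast
    obtain s' t' where st': "s' \<in> \<O>" "t' \<in> \<O>" "y = a * s' + b * t'" using mem[of y y] xy by blast
    have "x + y = a * (s + s') + b * (t + t')" by (simp add: st st' algebra_simps)
    then show ?thesis using col(1)[of "s + s'" "t + t'"] st st' by auto
  qed
  have Imult: "r * x \<in> I" if rx: "r \<in> \<O>" "x \<in> I" for r x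
  proof -
    obtain s t where st: "s \<in> \<O>" "t \<in> \<O>" "x = a * s + b * t" using mem[of x x] rx by blast
    have "r * x = a * (r * s) + b * (r * t)" by (simp add: st algebra_simps)
    then show ?thesis using col(1)[of "r * s" "r * t"] st rx by auto
  qed
  have I0: "0 \<in> I" using col[of 0 0] by simp
  obtain N where N: "N \<noteq> (0::int)" "\<forall>x\<in>{a, b, c, d}. of_int N * x \<in> \<O>"
    using common_denominator[of "{a, b, c, d}"] K by blast
  have den: "of_int N * x \<in> \<O>" if xI: "x \<in> I" for x
  proof -
    obtain s t where st: "s \<in> \<O>" "t \<in> \<O>" "x = a * s + b * t" using mem[of x x] xI by blast
    have "of_int N * x = (of_int N * a) * s + (of_int N * b) * t" by (simp add: st algebra_simps)
    then show ?thesis using st N(2) by auto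
  qed
  have "I \<noteq> {0}" using det I by auto
  then show "fractional_ideal K I"
    unfolding fractional_ideal_def using IK I0 Iadd Imult den N(1)
    by (auto intro!: bexI[of _ "of_int N"])
  show "frac_ideal_mult I I = (\<lambda>r. ?D * r) ` \<O>"
  proof
    show "frac_ideal_mult I I \<subseteq> (\<lambda>r. ?D * r) ` \<O>"
    proof (rule frac_ideal_mult_least)
      show "0 \<in> (\<lambda>r. ?D * r) ` \<O>" by (auto intro: image_eqI[of _ _ 0])
      show "u + v \<in> (\<lambda>r. ?D * r) ` \<O>" if "u \<in> (\<lambda>r. ?D * r) ` \<O>" "v \<in> (\<lambda>r. ?D * r) ` \<O>" for u v
        using that by (auto simp: image_iff simp flip: distrib_left)
      \<comment> \<open>The product is the determinant with columns (x, 0) and (0, y). Both are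
        combinations of the basis columns, so by multiplicativity it is \<open>?D\<close> times a
        determinant over \<open>\<O>\<close>.\<close>
      fix x y assume xy: "x \<in> I" "y \<in> I"
      obtain s t where st: "s \<in> \<O>" "t \<in> \<O>" "x = a * s + b * t" "0 = c * s + d * t"
        using mem[OF xy(1) I0] by blast
      obtain s' t' where st': "s' \<in> \<O>" "t' \<in> \<O>" "0 = a * s' + b * t'" "y = c * s' + d * t'"
        using mem[OF I0 xy(2)] by blast
      have "x * y = (a * s + b * t) * (c * s' + d * t') - (a * s' + b * t') * (c * s + d * t)"
        using st st' by (metis diff_zero mult_zero_left)
      also have "\<dots> = ?D * (s * t' - t * s')" by (simp add: algebra_simps)
      finally show "x * y \<in> (\<lambda>r. ?D * r) ` \<O>" using st st' by blast
    qed
    show "(\<lambda>r. ?D * r) ` \<O> \<subseteq> frac_ideal_mult I I"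
    proof clarify
      fix r assume r: "r \<in> \<O>"
      have "a * (r * d) + b * (- r * c) \<in> frac_ideal_mult I I"
        using I r by (intro frac_ideal_mult_add frac_ideal_mult_base Imult) auto
      then show "?D * r \<in> frac_ideal_mult I I" by (simp add: algebra_simps)
    qed
  qed
qed


text \<open>The ideal (x, y) I. If I^2 = (c) and x, y lie in I, it contains c exactly when it is all
  of I^2, that is, when x and y generate I.\<close>

definition gen2 :: "complex set \<Rightarrow> complex \<Rightarrow> complex \<Rightarrow> complex set" where
  "gen2 I x y = {x * u + y * v | u v. u \<in> I \<and> v \<in> I}"

text \<open>An invertible ideal needs two generators, one of which is an arbitrary nonzero element \<open>x\<close>.
  Given \<open>c = \<Sum>\<^sub>i x\<^sub>i y\<^sub>i\<close>, the other one is built up by adding one summand at a time: modulo \<open>x I\<close>,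
  the element \<open>s = x\<^sub>m y\<^sub>m / c\<close> has an idempotent power \<open>e\<close>, and \<open>e x\<^sub>m + (1 - e) y\<close> does where \<open>e = 1\<close> what
  \<open>x\<^sub>m\<close> does and elsewhere what the previous \<open>y\<close> does.\<close>

lemma two_generators:
  assumes I: "fractional_ideal K I" and sq: "frac_ideal_mult I I = (\<lambda>r. c * r) ` \<O>" and c: "c \<noteq> 0"
  obtains x y where "x \<in> I" "y \<in> I" "c \<in> gen2 I x y"
proof -
  note Iadd = fractional_idealD(3)[OF I] and Imult = fractional_idealD(4)[OF I]
  note I0 = fractional_idealD(2)[OF I]
  obtain x where x: "x \<in> I" "x \<noteq> 0" using I unfolding fractional_ideal_def by blast
  have quot: "u * v / c \<in> \<O>" if "u \<in> I" "v \<in> I" for u v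
    using frac_ideal_mult_base[OF that] c unfolding sq by auto
  have "x * x / c \<in> \<O>" "x * x / c \<noteq> 0" using quot x c by auto
  \<comment> \<open>An integer multiple of x^2 / c, so that c N lies in x I: the first generator
    takes care of everything divisible by \<open>N\<close>, and the rest of the argument can be made
    modulo \<open>N\<close>.\<close>
  then obtain N z where N: "N \<noteq> (0::int)" "z \<in> \<O>" "x * x / c * z = of_int N" by (rule O_dvd_int)
  \<comment> \<open>The ideal of multipliers that bring c into (x, y) I; the aim is a
    \<open>y\<close> for which it contains 1.\<close>
  define \<c> where "\<c> y = {r \<in> \<O>. c * r \<in> gen2 I x y}" for y
  have gen_add: "u + v \<in> gen2 I x y" if uv: "u \<in> gen2 I x y" "v \<in> gen2 I x y" for u v y
  proof -
    obtain p q p' q' where "u = x * p + y * q" "v = x * p' + y * q'" "p \<in> I" "q \<in> I" "p' \<in> I" "q' \<in> I"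
      using uv unfolding gen2_def by blast
    then have "u + v = x * (p + p') + y * (q + q')" "p + p' \<in> I" "q + q' \<in> I"
      using Iadd by (auto simp: algebra_simps)
    then show ?thesis unfolding gen2_def by blast
  qed
  have gen_mult: "r * u \<in> gen2 I x y" if ru: "r \<in> \<O>" "u \<in> gen2 I x y" for r u y
  proof -
    obtain p q where pq: "u = x * p + y * q" "p \<in> I" "q \<in> I"
      using ru unfolding gen2_def by blast
    have "r * u = x * (r * p) + y * (r * q)" by (simp add: pq algebra_simps)
    moreover have "r * p \<in> I" "r * q \<in> I" using Imult ru pq by auto
    ultimately show ?thesis unfolding gen2_def by blast
  qed
  have c_add: "u + v \<in> \<c> y" if "u \<in> \<c> y" "v \<in> \<c> y" for u v y
    using that gen_add[of "c * u" y "c * v"] by (auto simp: \<c>_def distrib_left)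
  have c_mult: "r * u \<in> \<c> y" if "r \<in> \<O>" "u \<in> \<c> y" for r u y
    using that gen_mult[of r "c * u" y] by (auto simp: \<c>_def mult_ac)
  have c_sum: "sum f A \<in> \<c> y" if "\<And>i. i \<in> A \<Longrightarrow> f i \<in> \<c> y" for f y and A :: "nat set"
    using that
  proof (induction A rule: infinite_finite_induct)
    case (insert i A) then show ?case by (simp add: c_add)
  qed (use gen_mult[of 0 x] in \<open>auto simp: \<c>_def gen2_def intro!: exI[of _ 0] I0\<close>)
  have c_N: "of_int N * r \<in> \<c> y" if "r \<in> \<O>" for r y
  proof -
    have "c * (of_int N * r) = x * ((r * z) * x) + y * 0"
      using c by (simp add: N(3)[symmetric])
    moreover have "(r * z) * x \<in> I" using Imult that N x by blast
    ultimately have "c * (of_int N * r) \<in> gen2 I x y" unfolding gen2_def using I0 by blast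
    then show ?thesis using that by (auto simp: \<c>_def)
  qed
  \<comment> \<open>The radical of \<open>\<c> y\<close> is closed under addition: each term of the
    binomial expansion of (u + v)^(j + k) contains u^j or v^k.\<close>
  have rad_add: "\<exists>k. (u + v) ^ k \<in> \<c> y"
    if "u \<in> \<O>" "v \<in> \<O>" "u ^ j \<in> \<c> y" "v ^ k \<in> \<c> y" for u v j k y
  proof
    have "of_nat ((j + k) choose i) * u ^ i * v ^ (j + k - i) \<in> \<c> y" if "i \<le> j + k" for i
    proof (cases "j \<le> i")
      case True
      then have "u ^ i = u ^ (i - j) * u ^ j" by (simp flip: power_add)
      then have "of_nat ((j + k) choose i) * u ^ i * v ^ (j + k - i) =
        (of_nat ((j + k) choose i) * v ^ (j + k - i) * u ^ (i - j)) * u ^ j" by simp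
      then show ?thesis using c_mult \<open>u ^ j \<in> \<c> y\<close> \<open>u \<in> \<O>\<close> \<open>v \<in> \<O>\<close>
        by (metis O_mult O_of_nat O_power)
    next
      case False
      then have "v ^ (j + k - i) = v ^ (j - i) * v ^ k" by (simp flip: power_add)
      then have "of_nat ((j + k) choose i) * u ^ i * v ^ (j + k - i) =
        (of_nat ((j + k) choose i) * u ^ i * v ^ (j - i)) * v ^ k" by simp
      then show ?thesis using c_mult \<open>v ^ k \<in> \<c> y\<close> \<open>u \<in> \<O>\<close> \<open>v \<in> \<O>\<close>
        by (metis O_mult O_of_nat O_power)
    qed
    then show "(u + v) ^ (j + k) \<in> \<c> y"
      unfolding binomial_ring by (intro c_sum) auto
  qed
  have "c \<in> frac_ideal_mult I I" unfolding sq by (auto intro: image_eqI[of _ _ 1])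
  then obtain m f g where fg: "c = (\<Sum>i<m. f i * g i)" "\<forall>i<(m::nat). f i \<in> I \<and> g i \<in> I"
    unfolding frac_ideal_mult_def by blast
  \<comment> \<open>The invariant: the partial sum divided by c lies in the radical of
    \<open>\<c> y\<close>. For the full sum this quotient is 1, so 1 itself lies in
    \<open>\<c> y\<close>.\<close>
  have "\<exists>y\<in>I. \<exists>k. ((\<Sum>i<m. f i * g i) / c) ^ k \<in> \<c> y" if "\<forall>i<m. f i \<in> I \<and> g i \<in> I" for m
    using that
  proof (induction m)
    case 0
    have "(0::complex) \<in> \<c> 0" using c_N[of 0 0] by simp
    then show ?case by (intro bexI[OF _ I0] exI[of _ 1]) simp
  next
    case (Suc m)
    then obtain y k where y: "y \<in> I" and k: "((\<Sum>i<m. f i * g i) / c) ^ k \<in> \<c> y" by auto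
    define t where "t = (\<Sum>i<m. f i * g i) / c"
    have tO: "t \<in> \<O>" unfolding t_def sum_divide_distrib using Suc.prems quot by (intro O_sum) auto
    define s where "s = f m * g m / c"
    have fm: "f m \<in> I" "g m \<in> I" using Suc.prems by auto
    have sO: "s \<in> \<O>" unfolding s_def using fm quot by blast
    obtain M p where M: "M > 0" "s ^ M * (1 - s ^ M) = of_int N * poly (of_int_poly p) s"
      using algebraic_int_eventually_idempotent_mod[OF O_algebraic_int[OF sO] N(1)] by metis
    define e where "e = s ^ M"
    have eO: "e \<in> \<O>" using sO by (auto simp: e_def)
    define y' where "y' = e * f m + (1 - e) * y"
    have y'I: "y' \<in> I" unfolding y'_def by (intro Iadd Imult O_diff eO fm y O_one)
    have ee: "e * (1 - e) * r \<in> \<c> y'" if "r \<in> \<O>" for r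
    proof -
      have "e * (1 - e) * r = of_int N * (poly (of_int_poly p) s * r)" using M by (simp add: e_def)
      then show ?thesis using c_N[OF O_mult[OF O_poly[OF sO] that]] by metis
    qed
    have y'c: "y' * v / c \<in> \<c> y'" if "v \<in> I" for v
    proof -
      have "c * (y' * v / c) = x * 0 + y' * v" using c by simp
      then have "c * (y' * v / c) \<in> gen2 I x y'" unfolding gen2_def using I0 that by blast
      then show ?thesis using quot[OF y'I that] by (auto simp: \<c>_def)
    qed
    have c_diff: "u - v \<in> \<c> y'" if "u \<in> \<c> y'" "v \<in> \<c> y'" for u v
      using c_add[OF that(1) c_mult[OF _ that(2), of "-1"]] by (auto intro: O_uminus)
    \<comment> \<open>Multiplying \<open>y'\<close> by e gives e^2 \<open>f m\<close> plus e (1 - e)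
      y, and the second term only contributes multiples of \<open>N\<close>; what remains is e^2
      s.\<close>
    have "e * (y' * g m / c) - e * (1 - e) * (y * g m / c) \<in> \<c> y'"
      using fm y y'c quot eO by (intro c_diff c_mult ee) auto
    also have "e * (y' * g m / c) - e * (1 - e) * (y * g m / c) = s ^ (Suc (M + M))"
    proof -
      have "s ^ Suc (M + M) = f m * g m / c * e * e" by (simp add: e_def s_def power_add)
      then show ?thesis using c by (simp add: y'_def field_simps)
    qed
    finally have s_rad: "s ^ (Suc (M + M)) \<in> \<c> y'" .
    obtain p q where pq: "p \<in> I" "q \<in> I" "c * t ^ k = x * p + y * q"
      using k unfolding t_def[symmetric] \<c>_def gen2_def by blast
    have "x * ((1 - e) ^ 2 * p) + y' * 0 \<in> gen2 I x y'"
      unfolding gen2_def using Imult pq eO I0 by (blast intro: O_diff)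
    then have "x * ((1 - e) ^ 2 * p) / c \<in> \<c> y'"
      using quot[OF x(1) pq(1)] c eO O_mult[of "(1-e)^2" "x * p / c"]
      by (auto simp: \<c>_def mult_ac intro: O_diff)
    \<comment> \<open>Symmetrically, (1 - e) \<open>y'\<close> is (1 - e)^2 y up to a term that
      contributes multiples of \<open>N\<close>; the part with x is scaled by the same factor (1 -
      e)^2.\<close>
    then have "x * ((1 - e) ^ 2 * p) / c + (1 - e) * (y' * q / c) - e * (1 - e) * (f m * q / c) \<in> \<c> y'"
      using pq y'c quot fm eO by (intro c_diff c_add c_mult ee) auto
    also have "x * ((1 - e) ^ 2 * p) / c + (1 - e) * (y' * q / c) - e * (1 - e) * (f m * q / c) =
        (1 - e) ^ 2 * ((x * p + y * q) / c)"
      using c by (simp add: y'_def field_simps power2_eq_square)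
    also have "\<dots> = (1 - e) ^ 2 * t ^ k" using c by (simp flip: pq(3))
    finally have t1: "(1 - e) ^ 2 * t ^ k \<in> \<c> y'" .
    have e3: "e ^ 3 \<in> \<c> y'"
    proof -
      have "e ^ 3 = s ^ (M + M + M)" by (simp add: e_def power_mult[symmetric] mult_ac numeral_3_eq_3 power_add)
      also have "M + M + M = (M - 1) + Suc (M + M)" using M by simp
      finally have "e ^ 3 = s ^ (M - 1) * s ^ Suc (M + M)" by (simp only: power_add)
      then show ?thesis using c_mult[OF _ s_rad] sO by auto
    qed
    \<comment> \<open>A Bezout identity: 1 + 2 e + 3 e^2 inverts (1 - e)^2 modulo e^3, and 4 - 3 e
      is the other cofactor. Thus t^k lies in \<open>\<c> y'\<close>.\<close>
    have "(1 + 2 * e + 3 * e\<^sup>2) * ((1 - e) ^ 2 * t ^ k) + ((4 - 3 * e) * t ^ k) * e ^ 3 \<in> \<c> y'"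
      using eO tO O_of_int[of 2] O_of_int[of 3] O_of_int[of 4]
      by (intro c_add c_mult[OF _ t1] c_mult[OF _ e3] O_add O_diff O_mult O_power) simp_all
    also have "(1 + 2 * e + 3 * e\<^sup>2) * ((1 - e) ^ 2 * t ^ k) + ((4 - 3 * e) * t ^ k) * e ^ 3 = t ^ k"
      by (simp add: algebra_simps power2_eq_square power3_eq_cube)
    finally have "\<exists>k. (t + s) ^ k \<in> \<c> y'"
      using rad_add[OF tO sO _ s_rad] by blast
    then show ?case using y'I by (auto simp: t_def s_def add_divide_distrib)
  qed
  from this[OF fg(2)] obtain y k where y: "y \<in> I" "(1::complex) ^ k \<in> \<c> y" using fg(1) c by auto
  then have "c \<in> gen2 I x y" by (simp add: \<c>_def)
  then show ?thesis using that x y by blast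
qed

lemma free_if_square_principal:
  assumes I: "fractional_ideal K I" and sq: "frac_ideal_mult I I = (\<lambda>r. D * r) ` \<O>" and D: "D \<noteq> 0"
  obtains a b c d where "a \<in> K" "b \<in> K" "c \<in> K" "d \<in> K" "a * d - b * c = D"
    "{(a * s + b * t, c * s + d * t) | s t. s \<in> \<O> \<and> t \<in> \<O>} = I \<times> I"
proof -
  note Iadd = fractional_idealD(3)[OF I] and Imult = fractional_idealD(4)[OF I]
  note IK = fractional_idealD(1)[OF I]
  obtain x y where xy: "x \<in> I" "y \<in> I" "D \<in> gen2 I x y" by (rule two_generators[OF assms])
  then obtain u v where uv: "u \<in> I" "v \<in> I" "D = x * u + y * v" unfolding gen2_def by blast
  have quot: "p * q / D \<in> \<O>" if "p \<in> I" "q \<in> I" for p q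
    using frac_ideal_mult_base[OF that] D unfolding sq by auto
  have "{(x * s + (- v) * t, y * s + u * t) | s t. s \<in> \<O> \<and> t \<in> \<O>} = I \<times> I"
  proof (intro equalityI subsetI)
    fix w assume "w \<in> {(x * s + (- v) * t, y * s + u * t) | s t. s \<in> \<O> \<and> t \<in> \<O>}"
    then obtain s t where w: "w = (s * x + (- t) * v, s * y + t * u)" "s \<in> \<O>" "t \<in> \<O>"
      by (auto simp: mult_ac)
    show "w \<in> I \<times> I" unfolding w(1)
      by (intro SigmaI Iadd Imult O_uminus w(2,3) xy(1,2) uv(1,2))
  next
    fix w assume "w \<in> I \<times> I"
    then obtain p q where w: "w = (p, q)" "p \<in> I" "q \<in> I" by auto
    \<comment> \<open>Cramer's rule for the matrix of determinant D = x u + y v; the quotients are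
      integral because I^2 = (D).\<close>
    define s where "s = p * u / D + v * q / D"
    define t where "t = x * q / D - y * p / D"
    have st: "s \<in> \<O>" "t \<in> \<O>" using quot w xy uv by (auto simp: s_def t_def)
    have "D * (x * s + (- v) * t) = D * p" "D * (y * s + u * t) = D * q"
      unfolding s_def t_def using D by (simp_all add: field_simps) (simp_all add: uv(3) algebra_simps)
    then have "p = x * s + (- v) * t" "q = y * s + u * t" using D by (metis mult_cancel_left)+
    then show "w \<in> {(x * s + (- v) * t, y * s + u * t) | s t. s \<in> \<O> \<and> t \<in> \<O>}"
      using w st by blast
  qed
  then show ?thesis
    using that[of x "- v" y u] xy uv IK by (auto simp: algebra_simps)
qed

end

section \<open>Lattices stable under rotation and conjugation\<close>

text \<open>Describing \<zeta> as a nonreal algebraic integer on the unit circle with trace in K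
  makes the setting invariant under \<zeta> \<mapsto> -\<zeta>, which is used when n is twice an odd
  prime power.\<close>

locale rotation_field = number_field +
  fixes \<zeta> :: complex
  assumes cnj_mem: "x \<in> K \<Longrightarrow> cnj x = x"
    and z_nonreal: "cnj \<zeta> \<noteq> \<zeta>"
    and z_cnj: "\<zeta> * cnj \<zeta> = 1"
    and z_algebraic_int: "algebraic_int \<zeta>"
    and trace_mem: "\<zeta> + cnj \<zeta> \<in> K"
begin

definition \<tau> where "\<tau> = \<zeta> + cnj \<zeta>"

definition lam where "lam = 1 - \<zeta>"

definition \<pi> where "\<pi> = 2 - \<tau>"

lemma pi_eq: "\<pi> = lam * cnj lam"
  unfolding \<pi>_def lam_def \<tau>_def using z_cnj by (simp add: algebra_simps)

lemma tau_sq_ne: "\<tau>\<^sup>2 \<noteq> 4"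
proof
  assume "\<tau>\<^sup>2 = 4"
  then have "(\<zeta> - cnj \<zeta>)\<^sup>2 = 0"
    using z_cnj by (simp add: \<tau>_def power2_eq_square algebra_simps)
  then show False using z_nonreal by simp
qed

lemma tau_O: "\<tau> \<in> \<O>"
  unfolding \<tau>_def using trace_mem z_algebraic_int by (intro OI algebraic_int_add) auto

lemma cnj_z: "cnj \<zeta> = \<tau> - \<zeta>"
  by (simp add: \<tau>_def)

lemma z_sq: "\<zeta> * \<zeta> = \<tau> * \<zeta> - 1"
  using z_cnj by (simp add: cnj_z algebra_simps)

text \<open>Subtracting the conjugated equation leaves (y - y') (\<zeta> -
  \<open>cnj \<zeta>\<close>) = 0. Real coordinates are allowed because \<open>frame_unique\<close>
  applies this to a scalar that is not yet known to lie in K.\<close>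

lemma real_coords_unique:
  assumes "cnj x = x" "cnj y = y" "cnj x' = x'" "cnj y' = y'" "x + y * \<zeta> = x' + y' * \<zeta>"
  shows "x = x'" "y = y'"
proof -
  have "x + y * cnj \<zeta> = cnj (x + y * \<zeta>)" using assms(1,2) by simp
  also have "\<dots> = x' + y' * cnj \<zeta>" unfolding assms(5) using assms(3,4) by simp
  finally have e: "x + y * cnj \<zeta> = x' + y' * cnj \<zeta>" .
  have "(y - y') * (\<zeta> - cnj \<zeta>) =
      (x + y * \<zeta> - (x' + y' * \<zeta>)) - (x + y * cnj \<zeta> - (x' + y' * cnj \<zeta>))"
    by (simp add: algebra_simps)
  also have "\<dots> = 0" unfolding e assms(5) by simp
  finally have "(y - y') * (\<zeta> - cnj \<zeta>) = 0" .
  then show "y = y'" using z_nonreal by auto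
  then show "x = x'" using assms(5) by simp
qed

lemma coords_unique:
  assumes "x \<in> K" "y \<in> K" "x' \<in> K" "y' \<in> K" "x + y * \<zeta> = x' + y' * \<zeta>"
  shows "x = x'" "y = y'"
  using real_coords_unique[of x y x' y'] assms by (simp_all add: cnj_mem)

definition ext :: "complex set \<Rightarrow> complex set" where
  "ext I = {x + y * \<zeta> | x y. x \<in> I \<and> y \<in> I}"

lemma extI: "x \<in> I \<Longrightarrow> y \<in> I \<Longrightarrow> x + y * \<zeta> \<in> ext I"
  unfolding ext_def by blast

text \<open>Neither rank nor a common denominator is prescribed, and even the empty set qualifies.
  The classifications below therefore yield subsets I of K; that I is a fractional ideal is deduced
  from freeness in \<open>lattice_square_principal\<close>.\<close>

definition stable_lattice :: "complex set \<Rightarrow> bool" where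
  "stable_lattice M \<longleftrightarrow> M \<subseteq> ext K \<and> (\<forall>u\<in>M. \<forall>v\<in>M. u + v \<in> M) \<and>
     (\<forall>r\<in>\<O>. \<forall>u\<in>M. r * u \<in> M) \<and> (\<forall>u\<in>M. \<zeta> * u \<in> M) \<and> (\<forall>u\<in>M. cnj u \<in> M)"

context
  fixes M assumes M: "stable_lattice M"
begin

lemma M_add: "u \<in> M \<Longrightarrow> v \<in> M \<Longrightarrow> u + v \<in> M"
  and M_mult: "r \<in> \<O> \<Longrightarrow> u \<in> M \<Longrightarrow> r * u \<in> M"
  and M_z: "u \<in> M \<Longrightarrow> \<zeta> * u \<in> M"
  and M_cnj: "u \<in> M \<Longrightarrow> cnj u \<in> M"
  using M by (auto simp: stable_lattice_def)

lemma M_coords: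
  assumes "u \<in> M"
  obtains x y where "x \<in> K" "y \<in> K" "u = x + y * \<zeta>"
  using M assms unfolding stable_lattice_def ext_def by blast

lemma M_diff: "u \<in> M \<Longrightarrow> v \<in> M \<Longrightarrow> u - v \<in> M"
  using M_add[of u "-1 * v"] M_mult[of "-1" v] O_uminus[OF O_one] by simp

lemma M_ring: "r \<in> \<O> \<Longrightarrow> s \<in> \<O> \<Longrightarrow> u \<in> M \<Longrightarrow> (r + s * \<zeta>) * u \<in> M"
  using M_add[of "r * u" "s * (\<zeta> * u)"] M_mult M_z by (simp add: algebra_simps)

lemma M_cz: "u \<in> M \<Longrightarrow> cnj \<zeta> * u \<in> M"
  using M_diff[of "\<tau> * u" "\<zeta> * u"] M_mult[OF tau_O] M_z by (simp add: cnj_z left_diff_distrib)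

text \<open>Both u - \<open>cnj u\<close> and multiplication by \<zeta> - \<open>cnj \<zeta>\<close>
  stay in M. Together they isolate the \<zeta>-coordinate up to (\<zeta> -
  \<open>cnj \<zeta>\<close>)^2 = \<tau>^2 - 4.\<close>

lemma M_disc:
  assumes "x + y * \<zeta> \<in> M" "x \<in> K" "y \<in> K"
  shows "(\<tau>\<^sup>2 - 4) * x \<in> M" "(\<tau>\<^sup>2 - 4) * y \<in> M"
proof -
  define u where "u = x + y * \<zeta>"
  have cu: "cnj u = x + y * (\<tau> - \<zeta>)" using assms by (simp add: u_def cnj_mem cnj_z)
  have u: "u \<in> M" using assms by (simp add: u_def)
  have d: "(\<zeta> - cnj \<zeta>)\<^sup>2 = \<tau>\<^sup>2 - 4"
    using z_cnj by (simp add: \<tau>_def power2_eq_square algebra_simps)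
  have sub: "(\<zeta> - cnj \<zeta>) * v \<in> M" if "v \<in> M" for v
    using M_diff[OF M_z[OF that] M_cz[OF that]] by (simp add: left_diff_distrib)
  have "(\<zeta> - cnj \<zeta>) * (u - cnj u) \<in> M" by (intro sub M_diff u M_cnj)
  also have "(\<zeta> - cnj \<zeta>) * (u - cnj u) = y * (\<zeta> - cnj \<zeta>)\<^sup>2"
    unfolding cu by (simp add: u_def cnj_z power2_eq_square algebra_simps)
  finally show y: "(\<tau>\<^sup>2 - 4) * y \<in> M" by (simp add: d mult.commute)
  have "\<tau>\<^sup>2 - 4 \<in> \<O>" using tau_O O_of_int[of 4] by auto
  then have "(\<tau>\<^sup>2 - 4) * u - \<zeta> * ((\<tau>\<^sup>2 - 4) * y) \<in> M"
    using M_diff[OF M_mult[OF _ u] M_z[OF y]] by blast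
  then show "(\<tau>\<^sup>2 - 4) * x \<in> M" by (simp add: u_def algebra_simps)
qed

lemma unramified_lattice:
  assumes unit: "inverse (\<tau>\<^sup>2 - 4) \<in> \<O>"
  shows "M = ext (M \<inter> K)"
proof (intro equalityI subsetI)
  fix u assume u: "u \<in> M"
  obtain x y where xy: "x \<in> K" "y \<in> K" "u = x + y * \<zeta>" using M_coords[OF u] by blast
  have "inverse (\<tau>\<^sup>2 - 4) * ((\<tau>\<^sup>2 - 4) * x) \<in> M" "inverse (\<tau>\<^sup>2 - 4) * ((\<tau>\<^sup>2 - 4) * y) \<in> M"
    using M_mult[OF unit] M_disc[of x y] xy u by blast+
  moreover have "inverse (\<tau>\<^sup>2 - 4) * ((\<tau>\<^sup>2 - 4) * w) = w" for w
    using tau_sq_ne by (simp add: mult.assoc[symmetric])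
  ultimately show "u \<in> ext (M \<inter> K)" unfolding xy(3) using xy by (intro extI) auto
next
  fix u assume "u \<in> ext (M \<inter> K)"
  then obtain x y where "u = x + \<zeta> * y" "x \<in> M" "y \<in> M" by (auto simp: ext_def mult.commute)
  then show "u \<in> M" using M_add M_z by blast
qed

end

lemma ext_Int: "I \<subseteq> K \<Longrightarrow> ext I \<inter> K = I" if "0 \<in> I"
proof (intro equalityI subsetI)
  fix u assume I: "I \<subseteq> K" and "u \<in> ext I \<inter> K"
  then obtain x y where "u = x + y * \<zeta>" "x \<in> I" "y \<in> I" "u \<in> K" by (auto simp: ext_def)
  moreover from this have "u = x" using coords_unique(1)[of u 0 x y] I by auto
  ultimately show "u \<in> I" by simp
qed (use that extI[of _ I 0] in auto)

end

text \<open>What the lattice argument uses about prime power order: the residue ring at \<pi> is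
  F_p, the powers of \<pi> have intersection zero (\<open>separated\<close>), and \<tau>^2 - 4
  divides a power of \<pi> (\<open>disc\<close>), so that \<pi> is the only place where coordinates
  can fail to split.\<close>

locale ramified_rotation_field = rotation_field +
  fixes p :: nat and N :: nat
  assumes p: "prime p"
    and pi_nonunit: "inverse \<pi> \<notin> \<O>"
    and pi_p: "of_nat p / \<pi> \<in> \<O>"
    and residue: "x \<in> \<O> \<Longrightarrow> \<exists>k. (x - of_int k) / \<pi> \<in> \<O>"
    and separated: "x \<in> \<O> \<Longrightarrow> x \<noteq> 0 \<Longrightarrow> \<exists>k. x / \<pi> ^ k \<notin> \<O>"
    and disc: "\<pi> ^ N / (\<tau>\<^sup>2 - 4) \<in> \<O>"
begin

lemma pi_O: "\<pi> \<in> \<O>"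
  unfolding \<pi>_def using tau_O O_of_int[of 2] by auto

lemma pi_nz: "\<pi> \<noteq> 0"
  using pi_nonunit by auto

lemma lambda_nz: "lam \<noteq> 0"
  using pi_nz pi_eq by auto

definition dvdpi where "dvdpi x \<longleftrightarrow> x / \<pi> \<in> \<O>"

lemma dvdpi_add: "dvdpi x \<Longrightarrow> dvdpi y \<Longrightarrow> dvdpi (x + y)"
  and dvdpi_diff: "dvdpi x \<Longrightarrow> dvdpi y \<Longrightarrow> dvdpi (x - y)"
  and dvdpi_mult: "r \<in> \<O> \<Longrightarrow> dvdpi x \<Longrightarrow> dvdpi (r * x)"
  and dvdpi_mult': "r \<in> \<O> \<Longrightarrow> dvdpi x \<Longrightarrow> dvdpi (x * r)"
  and dvdpi_pi: "dvdpi \<pi>"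
  using O_mult[of r "x / \<pi>"] O_mult[of r "x / \<pi>"] pi_nz
  by (auto simp: dvdpi_def add_divide_distrib diff_divide_distrib mult.commute)

text \<open>Modulo \<pi>, c is an integer k. If p divided k, then \<pi> would divide c; so Bezout
  inverts k modulo p.\<close>

lemma inverse_mod_pi:
  assumes "c \<in> \<O>" "\<not> dvdpi c"
  obtains c' where "c' \<in> \<O>" "dvdpi (1 - c * c')"
proof -
  obtain k where k: "dvdpi (c - of_int k)" using residue[OF assms(1)] by (auto simp: dvdpi_def)
  have dp: "dvdpi (of_nat p)" using pi_p by (simp add: dvdpi_def)
  have "\<not> int p dvd k"
  proof
    assume "int p dvd k"
    then obtain j where "k = j * int p" by (auto simp: dvd_def mult.commute)
    then have "dvdpi (of_int k)" using dvdpi_mult[OF O_of_int[of j] dp] by simp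
    then have "dvdpi ((c - of_int k) + of_int k)" using k dvdpi_add by blast
    then show False using assms by simp
  qed
  then have "coprime (int p) k" using p by (simp add: prime_imp_coprime)
  then obtain a b where "a * int p + b * k = 1" using bezout_int[of "int p" k] by auto
  then have ab: "of_int a * of_nat p + of_int b * of_int k = (1 :: complex)"
    by (metis of_int_1 of_int_add of_int_mult of_int_of_nat_eq)
  have "1 - c * of_int b = of_int a * of_nat p - of_int b * (c - of_int k)"
    using ab by (simp add: algebra_simps)
  then have "dvdpi (1 - c * of_int b)"
    using dvdpi_diff[OF dvdpi_mult[OF O_of_int dp] dvdpi_mult[OF O_of_int k]] by metis
  then show ?thesis using that by auto
qed

lemma dvdpi_prime:
  assumes "x \<in> \<O>" "y \<in> \<O>" "dvdpi (x * y)" "\<not> dvdpi x"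
  shows "dvdpi y"
proof -
  obtain x' where x': "x' \<in> \<O>" "dvdpi (1 - x * x')" using inverse_mod_pi assms by blast
  have "dvdpi ((1 - x * x') * y + x' * (x * y))"
    by (rule dvdpi_add[OF dvdpi_mult'[OF assms(2) x'(2)] dvdpi_mult[OF x'(1) assms(3)]])
  then show ?thesis by (simp add: algebra_simps)
qed

text \<open>Since \<zeta> is 1 modulo \<open>lam\<close>, the norm of r + s \<zeta> is (r + s)^2
  modulo \<pi>; the exact difference is r s \<pi>.\<close>

lemma not_dvdpi_norm:
  assumes "r \<in> \<O>" "s \<in> \<O>" "\<not> dvdpi (r + s)"
  shows "(r + s * \<zeta>) * (r + s * cnj \<zeta>) \<in> \<O>" "\<not> dvdpi ((r + s * \<zeta>) * (r + s * cnj \<zeta>))"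
proof -
  have eq: "(r + s * \<zeta>) * (r + s * cnj \<zeta>) = (r + s) * (r + s) - (r * s) * \<pi>"
    using z_cnj unfolding \<pi>_def \<tau>_def by (simp add: algebra_simps)
  show "(r + s * \<zeta>) * (r + s * cnj \<zeta>) \<in> \<O>"
    unfolding eq using assms pi_O by auto
  show "\<not> dvdpi ((r + s * \<zeta>) * (r + s * cnj \<zeta>))"
  proof
    assume "dvdpi ((r + s * \<zeta>) * (r + s * cnj \<zeta>))"
    then have "dvdpi ((r + s * \<zeta>) * (r + s * cnj \<zeta>) + (r * s) * \<pi>)"
      using dvdpi_add dvdpi_mult[OF O_mult[OF assms(1,2)] dvdpi_pi] by blast
    then have "dvdpi ((r + s) * (r + s))" by (simp add: eq)
    then show False using dvdpi_prime assms by blast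
  qed
qed

lemma valuation:
  assumes "u \<in> \<O>" "u \<noteq> 0"
  obtains a u' where "u = \<pi> ^ a * u'" "u' \<in> \<O>" "\<not> dvdpi u'"
proof -
  define k where "k = (LEAST k. u / \<pi> ^ k \<notin> \<O>)"
  have k: "u / \<pi> ^ k \<notin> \<O>" unfolding k_def using separated[OF assms] by (rule LeastI_ex)
  then have "k \<noteq> 0" using assms by (intro notI) simp
  then obtain a where a: "k = Suc a" using not0_implies_Suc by blast
  have "u / \<pi> ^ a \<in> \<O>" using not_less_Least[of a "\<lambda>k. u / \<pi> ^ k \<notin> \<O>"] a by (simp add: k_def)
  moreover have "\<not> dvdpi (u / \<pi> ^ a)" using k a by (simp add: dvdpi_def mult.commute)
  ultimately show ?thesis using that[of a "u / \<pi> ^ a"] pi_nz by simp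
qed

text \<open>The valuation ring property at \<pi> with denominators cleared: \<open>c\<close> is a
  local unit, and r / c is the locally integral quotient of x and y in one order or the
  other.\<close>

lemma valuation_ring:
  assumes "x \<in> K" "y \<in> K"
  obtains c r where "c \<in> \<O>" "r \<in> \<O>" "\<not> dvdpi c" "c * x = r * y \<or> c * y = r * x"
proof -
  have d1: "\<not> dvdpi 1" using pi_nonunit by (simp add: dvdpi_def inverse_eq_divide)
  show ?thesis
  proof (cases "x = 0 \<or> y = 0")
    case True
    then show ?thesis using that[of 1 0] d1 by auto
  next
    case False
    obtain m where m: "m \<noteq> (0::int)" "\<forall>w\<in>{x, y}. of_int m * w \<in> \<O>"
      using common_denominator[of "{x, y}"] assms by blast
    obtain a u where u: "of_int m * x = \<pi> ^ a * u" "u \<in> \<O>" "\<not> dvdpi u"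
      using valuation[of "of_int m * x"] m False by auto
    obtain b v where v: "of_int m * y = \<pi> ^ b * v" "v \<in> \<O>" "\<not> dvdpi v"
      using valuation[of "of_int m * y"] m False by auto
    have m': "(of_int m :: complex) \<noteq> 0" using m by simp
    show ?thesis
    proof (cases "b \<le> a")
      case True
      then have "\<pi> ^ a = \<pi> ^ (a - b) * \<pi> ^ b" by (simp flip: power_add)
      then have "v * (of_int m * x) = \<pi> ^ (a - b) * u * (of_int m * y)"
        unfolding u(1) v(1) by simp
      then have "of_int m * (v * x) = of_int m * (\<pi> ^ (a - b) * u * y)" by (simp add: mult_ac)
      then have "v * x = \<pi> ^ (a - b) * u * y" using m' by (metis mult_left_cancel)
      then show ?thesis using that[of v "\<pi> ^ (a - b) * u"] u v pi_O by auto
    next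
      case False
      then have "\<pi> ^ b = \<pi> ^ (b - a) * \<pi> ^ a" by (simp flip: power_add)
      then have "u * (of_int m * y) = \<pi> ^ (b - a) * v * (of_int m * x)"
        unfolding u(1) v(1) by simp
      then have "of_int m * (u * y) = of_int m * (\<pi> ^ (b - a) * v * x)" by (simp add: mult_ac)
      then have "u * y = \<pi> ^ (b - a) * v * x" using m' by (metis mult_left_cancel)
      then show ?thesis using that[of u "\<pi> ^ (b - a) * v"] u v pi_O by auto
    qed
  qed
qed

text \<open>As \<open>c\<close> is invertible modulo \<pi>, the two generate the unit ideal; a
  combination of the two memberships removes one power of \<pi> at a time.\<close>

lemma coprime_pi_cancel:
  assumes add: "\<And>u v. u \<in> A \<Longrightarrow> v \<in> A \<Longrightarrow> u + v \<in> A"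
    and mult: "\<And>r u. r \<in> \<O> \<Longrightarrow> u \<in> A \<Longrightarrow> r * u \<in> A"
    and c: "c \<in> \<O>" "\<not> dvdpi c" "c * w \<in> A" and pik: "\<pi> ^ k * w \<in> A"
  shows "w \<in> A"
  using pik
proof (induction k)
  case (Suc k)
  obtain c' where c': "c' \<in> \<O>" "dvdpi (1 - c * c')" using inverse_mod_pi c by blast
  have "(1 - c * c') / \<pi> * (\<pi> ^ Suc k * w) + (c' * \<pi> ^ k) * (c * w) \<in> A"
    using c'(2) by (intro add mult[OF _ Suc.prems] mult[OF _ c(3)] O_mult[OF c'(1)] O_power pi_O)
      (auto simp: dvdpi_def)
  also have "(1 - c * c') / \<pi> * (\<pi> ^ Suc k * w) + (c' * \<pi> ^ k) * (c * w) = \<pi> ^ k * w"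
    using pi_nz by (simp add: field_simps)
  finally show ?case by (rule Suc.IH)
qed simp

text \<open>Let \<open>J\<close> be the set of \<open>\<zeta>\<close>-coordinates of elements of \<open>M\<close>.  The key point is that \<open>lam J \<subseteq> M\<close>:
  for \<open>x + y \<zeta> \<in> M\<close>, the \<open>c \<in> \<O>\<close> with \<open>c lam y \<in> M\<close> form an ideal that contains a power of \<open>\<pi>\<close>, and also
  the norm of some \<open>r + c \<zeta>\<close>, which is \<open>(r + c)\<^sup>2\<close> modulo \<open>\<pi>\<close>.  Hence \<open>\<pi> J \<subseteq> M \<inter> K \<subseteq> J\<close>, and one of the
  inclusions is an equality because \<open>\<O>\<close> is a valuation ring at \<open>\<pi>\<close>.\<close>

lemma ramified_lattice:
  assumes M: "stable_lattice M"
  obtains I where "I \<subseteq> K" "\<forall>x\<in>I. - x \<in> I" "M = ext I"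
    | I where "I \<subseteq> K" "\<forall>x\<in>I. - x \<in> I" "M = (\<lambda>u. lam * u) ` ext I"
proof -
  note M_add = M_add[OF M] and M_mult = M_mult[OF M] and M_z = M_z[OF M] and M_cz = M_cz[OF M]
    and M_diff = M_diff[OF M] and M_ring = M_ring[OF M]
  have M_lam: "lam * u \<in> M" if "u \<in> M" for u
    using M_diff[OF that M_z[OF that]] by (simp add: lam_def left_diff_distrib)
  have M_clam: "cnj lam * u \<in> M" if "u \<in> M" for u
    using M_diff[OF that M_cz[OF that]] by (simp add: lam_def left_diff_distrib)
  have M_cring: "(r + s * cnj \<zeta>) * u \<in> M" if "r \<in> \<O>" "s \<in> \<O>" "u \<in> M" for r s u
    using M_add[of "r * u" "s * (cnj \<zeta> * u)"] M_mult M_cz that by (simp add: algebra_simps)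
  have lam_y: "lam * y \<in> M" if xy: "x + y * \<zeta> \<in> M" "x \<in> K" "y \<in> K" for x y
  proof -
    have "\<pi> ^ N / (\<tau>\<^sup>2 - 4) * ((\<tau>\<^sup>2 - 4) * y) \<in> M"
      using M_disc(2)[OF M xy] disc M_mult by blast
    then have "lam * (\<pi> ^ N * y) \<in> M" using M_lam tau_sq_ne by simp
    then have piN: "\<pi> ^ N * (lam * y) \<in> M" by (simp add: mult_ac)
    \<comment> \<open>Locally x is the multiple r / c of y. Then c (x + y \<zeta>) = (r + c \<zeta>)
      y, and the first factor has to be turned into \<open>lam\<close> times a multiplier prime to
      \<pi>.\<close>
    have caseA: "\<exists>d\<in>\<O>. \<not> dvdpi d \<and> d * (lam * y) \<in> M"
      if c: "c \<in> \<O>" "r \<in> \<O>" "\<not> dvdpi c" "c * x = r * y" for c r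
    proof -
      have cm: "c * (x + y * \<zeta>) = (r + c * \<zeta>) * y" using c by (simp add: algebra_simps)
      have cmM: "(r + c * \<zeta>) * y \<in> M" using M_mult[OF c(1) xy(1)] cm by simp
      show ?thesis
      proof (cases "dvdpi (r + c)")
        case False
        have "lam * ((r + c * cnj \<zeta>) * ((r + c * \<zeta>) * y)) \<in> M"
          using cmM c by (intro M_lam M_cring)
        then have "((r + c * \<zeta>) * (r + c * cnj \<zeta>)) * (lam * y) \<in> M" by (simp add: mult_ac)
        then show ?thesis using not_dvdpi_norm[OF c(2,1) False] by blast
      next
        case True
        \<comment> \<open>Here r + c \<zeta> is divisible by \<open>lam\<close>. The quotient has
          coordinates s - c and -s in 1 and \<open>cnj \<zeta>\<close>, with sum -c, so its norm is
          prime to \<pi>; the factor \<open>lam\<close> split off is the one wanted in front of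
          y.\<close>
        define s where "s = (r + c) / \<pi>"
        have s: "s \<in> \<O>" "r + c = s * \<pi>" using True pi_nz by (auto simp: s_def dvdpi_def)
        have "r + c * \<zeta> = s * \<pi> - c * lam" using s(2) by (simp add: lam_def algebra_simps)
        also have "\<dots> = lam * ((s - c) + (- s) * cnj \<zeta>)"
          unfolding pi_eq by (simp add: lam_def algebra_simps)
        finally have "((s - c) + (- s) * cnj \<zeta>) * (lam * y) \<in> M" using cmM by (simp add: mult_ac)
        then have "((s - c) + (- s) * \<zeta>) * (((s - c) + (- s) * cnj \<zeta>) * (lam * y)) \<in> M"
          using s c by (intro M_ring) auto
        then have dM: "(((s - c) + (- s) * \<zeta>) * ((s - c) + (- s) * cnj \<zeta>)) * (lam * y) \<in> M"
          by (simp only: mult.assoc)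
        have "\<not> dvdpi ((s - c) + (- s))"
        proof
          assume "dvdpi ((s - c) + (- s))"
          then have "dvdpi (-1 * ((s - c) + (- s)))" using O_of_int[of "-1"] dvdpi_mult by fastforce
          then show False using c by simp
        qed
        then show ?thesis using dM not_dvdpi_norm[of "s - c" "- s"] s c by blast
      qed
    qed
    obtain c r where cr: "c \<in> \<O>" "r \<in> \<O>" "\<not> dvdpi c" "c * x = r * y \<or> c * y = r * x"
      using valuation_ring[OF xy(2,3)] by blast
    have "\<exists>d\<in>\<O>. \<not> dvdpi d \<and> d * (lam * y) \<in> M"
    proof (cases "c * x = r * y \<or> \<not> dvdpi r")
      case True
      then show ?thesis using caseA cr by metis
    next
      case False
      then have cy: "c * y = r * x" and dr: "dvdpi r" using cr by auto
      \<comment> \<open>Now y is locally a multiple of x by a factor divisible by \<pi>. Hence c + r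
        is c modulo \<pi>, the norm of c + r \<zeta> is prime to \<pi>, and the extra factor r turns
        x into c y.\<close>
      have ncr: "\<not> dvdpi (c + r)" using dvdpi_diff[of "c + r" r] dr cr by auto
      define n where "n = (c + r * \<zeta>) * (c + r * cnj \<zeta>)"
      have n: "n \<in> \<O>" "\<not> dvdpi n" using not_dvdpi_norm[OF cr(1,2) ncr] by (auto simp: n_def)
      have "c * (x + y * \<zeta>) = (c + r * \<zeta>) * x" using cy by (simp add: algebra_simps)
      then have "(c + r * \<zeta>) * x \<in> M" using M_mult[OF cr(1) xy(1)] by simp
      then have "lam * (r * ((c + r * cnj \<zeta>) * ((c + r * \<zeta>) * x))) \<in> M"
        by (intro M_lam M_mult[OF cr(2)] M_cring[OF cr(1,2)])
      also have "lam * (r * ((c + r * cnj \<zeta>) * ((c + r * \<zeta>) * x))) = lam * (n * (c * y))"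
        unfolding cy n_def by (simp add: mult_ac)
      finally have "(c * n) * (lam * y) \<in> M" by (simp add: mult_ac)
      moreover have "\<not> dvdpi (c * n)" using dvdpi_prime cr n by blast
      ultimately show ?thesis using cr n by blast
    qed
    then show ?thesis using coprime_pi_cancel[of M, OF M_add M_mult _ _ _ piN] by blast
  qed
  define I where "I = M \<inter> K"
  define J where "J = {y \<in> K. \<exists>x\<in>K. x + y * \<zeta> \<in> M}"
  have I_add: "u + v \<in> I" if "u \<in> I" "v \<in> I" for u v using that M_add by (auto simp: I_def)
  have I_mult: "r * u \<in> I" if "r \<in> \<O>" "u \<in> I" for r u using that M_mult O_mem by (auto simp: I_def)
  have J_add: "u + v \<in> J" if uv: "u \<in> J" "v \<in> J" for u v
  proof -
    obtain x x' where x: "x \<in> K" "x + u * \<zeta> \<in> M" "x' \<in> K" "x' + v * \<zeta> \<in> M" using uv by (auto simp: J_def)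
    then have "(x + x') + (u + v) * \<zeta> \<in> M" using M_add[OF x(2,4)] by (simp add: algebra_simps)
    then show ?thesis using uv x unfolding J_def by blast
  qed
  have J_mult: "r * u \<in> J" if ru: "r \<in> \<O>" "u \<in> J" for r u
  proof -
    obtain x where x: "x \<in> K" "x + u * \<zeta> \<in> M" using ru by (auto simp: J_def)
    then have "r * x + (r * u) * \<zeta> \<in> M" using M_mult[OF ru(1) x(2)] by (simp add: algebra_simps)
    then show ?thesis using ru x O_mem unfolding J_def by blast
  qed
  have IJ: "I \<subseteq> J"
  proof
    fix i assume "i \<in> I"
    then have "0 + i * \<zeta> \<in> M" "i \<in> K" using M_z[of i] by (auto simp: I_def mult.commute)
    then show "i \<in> J" unfolding J_def by blast
  qed
  have lamJ: "lam * y \<in> M" if "y \<in> J" for y using that lam_y by (auto simp: J_def)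
  have piJ: "\<pi> * y \<in> I" if "y \<in> J" for y
  proof -
    have "cnj lam * (lam * y) = \<pi> * y" by (simp add: pi_eq)
    then have "\<pi> * y \<in> M" using M_clam[OF lamJ[OF that]] by metis
    moreover have "\<pi> * y \<in> K" using mult_mem[OF O_mem[OF pi_O]] that unfolding J_def by blast
    ultimately show ?thesis unfolding I_def by blast
  qed
  \<comment> \<open>x + y \<zeta> = (x + y) - \<open>lam\<close> y, and \<open>lam\<close> y is
    already known to lie in M.\<close>
  have sumI: "x + y \<in> I" if "x + y * \<zeta> \<in> M" "x \<in> K" "y \<in> K" for x y
    using M_add[OF that(1) lam_y[OF that]] that by (auto simp: I_def lam_def algebra_simps)
  \<comment> \<open>Witnesses against the two inclusions are compared at \<pi>: if y is locally a
    multiple of i, it falls into I; otherwise i is locally a multiple of \<pi> y and falls into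
    \<pi> J.\<close>
  have dich: "J \<subseteq> I \<or> I \<subseteq> (\<lambda>y. \<pi> * y) ` J"
  proof (rule ccontr)
    assume "\<not> ?thesis"
    then obtain y i where yi: "y \<in> J" "y \<notin> I" "i \<in> I" "i \<notin> (\<lambda>y. \<pi> * y) ` J" by blast
    have "y \<in> K" "i \<in> K" using yi by (auto simp: I_def J_def)
    then obtain c r where cr: "c \<in> \<O>" "r \<in> \<O>" "\<not> dvdpi c" "c * y = r * i \<or> c * i = r * y"
      using valuation_ring by metis
    have A: "y \<in> I" if "c \<in> \<O>" "r \<in> \<O>" "\<not> dvdpi c" "c * y = r * i" for c r
      using coprime_pi_cancel[of I c y 1, OF I_add I_mult] that I_mult[OF that(2) yi(3)] piJ[OF yi(1)] by simp
    show False
    proof (cases "c * y = r * i \<or> \<not> dvdpi r")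
      case True
      then show False using A cr yi by metis
    next
      case False
      then have ci: "c * i = r * y" "r / \<pi> \<in> \<O>" using cr by (auto simp: dvdpi_def)
      have "c * (i / \<pi>) = (r / \<pi>) * y" using ci by simp
      then have "c * (i / \<pi>) \<in> J" using J_mult ci yi by metis
      moreover have "\<pi> ^ 1 * (i / \<pi>) \<in> J" using yi IJ pi_nz by auto
      ultimately have "i / \<pi> \<in> J"
        using coprime_pi_cancel[of J c "i / \<pi>" 1, OF J_add J_mult] cr by simp
      then have "i \<in> (\<lambda>y. \<pi> * y) ` J" using pi_nz by (intro image_eqI[of _ _ "i / \<pi>"]) auto
      then show False using yi by blast
    qed
  qed
  show ?thesis
  proof (cases "J \<subseteq> I")
    case True
    have "M = ext I"
    proof (intro equalityI subsetI)
      fix u assume u: "u \<in> M"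
      obtain x y where xy: "x \<in> K" "y \<in> K" "u = x + y * \<zeta>" using M_coords[OF M u] by blast
      then have "y \<in> J" using u unfolding J_def by blast
      then have y: "y \<in> I" using True by blast
      have "x + y \<in> I" using sumI u xy by blast
      then have "(x + y) + (-1) * y \<in> I"
        by (rule I_add[OF _ I_mult[OF _ y]]) (simp add: O_uminus)
      moreover have "(x + y) + (-1) * y = x" by simp
      ultimately have "x \<in> I" by metis
      then show "u \<in> ext I" using y xy by (auto intro: extI)
    next
      fix u assume "u \<in> ext I"
      then obtain x y where "u = x + \<zeta> * y" "x \<in> M" "y \<in> M" by (auto simp: ext_def I_def mult.commute)
      then show "u \<in> M" using M_add M_z by blast
    qed
    moreover have "I \<subseteq> K" unfolding I_def by blast
    moreover have "\<forall>x\<in>I. - x \<in> I" using I_mult[OF O_uminus[OF O_one]] by simp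
    ultimately show ?thesis by (intro that(1))
  next
    case False
    then have Ipi: "I \<subseteq> (\<lambda>y. \<pi> * y) ` J" using dich by blast
    have "M = (\<lambda>u. lam * u) ` ext J"
    proof (intro equalityI subsetI)
      fix u assume u: "u \<in> M"
      obtain x y where xy: "x \<in> K" "y \<in> K" "u = x + y * \<zeta>" using M_coords[OF M u] by blast
      then have y: "y \<in> J" using u unfolding J_def by blast
      have "x + y \<in> I" using sumI u xy by blast
      then obtain j where j: "j \<in> J" "x + y = \<pi> * j" using Ipi by blast
      \<comment> \<open>As x + y = \<pi> j with \<pi> = \<open>lam * cnj lam\<close>, the factor
        \<open>lam\<close> can be taken out of both terms.\<close>
      have "u = (x + y) - y * lam" by (simp add: xy lam_def algebra_simps)
      also have "\<dots> = lam * ((j + (- \<tau>) * j + (-1) * y) + j * \<zeta>)"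
        unfolding j pi_eq by (simp add: lam_def cnj_z algebra_simps)
      finally have "u = lam * ((j + (- \<tau>) * j + (-1) * y) + j * \<zeta>)" .
      moreover have "j + (- \<tau>) * j + (-1) * y \<in> J" using j y tau_O by (intro J_add J_mult) auto
      ultimately show "u \<in> (\<lambda>u. lam * u) ` ext J" using j extI by blast
    next
      fix u assume "u \<in> (\<lambda>u. lam * u) ` ext J"
      then obtain x y where u: "u = lam * (x + y * \<zeta>)" and xy: "x \<in> J" "y \<in> J"
        unfolding ext_def by blast
      from u have "u = lam * x + \<zeta> * (lam * y)" by (simp add: algebra_simps)
      with xy show "u \<in> M" using M_add M_z lamJ by blast
    qed
    moreover have "J \<subseteq> K" unfolding J_def by blast
    moreover have "\<forall>x\<in>J. - x \<in> J" using J_mult[OF O_uminus[OF O_one]] by simp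
    ultimately show ?thesis by (intro that(2))
  qed
qed

text \<open>An equality would make I closed under division by \<pi>: comparing coordinates, an
  element of I is c \<pi> y with y in I', and c y is again in I. Dividing repeatedly contradicts
  \<open>separated\<close>.\<close>

lemma ext_ne_lambda_ext:
  assumes I: "fractional_ideal K I" "fractional_ideal K I'" and c: "c \<in> K" "c \<noteq> 0"
  shows "ext I \<noteq> (\<lambda>u. c * (lam * u)) ` ext I'"
proof
  assume eq: "ext I = (\<lambda>u. c * (lam * u)) ` ext I'"
  note IK = I[THEN fractional_idealD(1)] and I0 = I[THEN fractional_idealD(2)]
  have div: "i / \<pi> \<in> I" if i: "i \<in> I" for i
  proof -
    have "i \<in> ext I" using extI[OF i I0(1)] by simp
    then have "i \<in> (\<lambda>u. c * (lam * u)) ` ext I'" using eq by simp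
    then obtain x y where xy: "x \<in> I'" "y \<in> I'" "i = c * (lam * (x + y * \<zeta>))" unfolding ext_def by blast
    have "lam * (x + y * \<zeta>) = x + (y - x) * \<zeta> - y * (\<zeta> * \<zeta>)" by (simp add: lam_def algebra_simps)
    also have "\<dots> = (x + y) + (y - x - \<tau> * y) * \<zeta>" unfolding z_sq by (simp add: algebra_simps)
    finally have "i = c * ((x + y) + (y - x - \<tau> * y) * \<zeta>)" using xy(3) by simp
    then have "i + 0 * \<zeta> = c * (x + y) + (c * (y - x - \<tau> * y)) * \<zeta>" by (simp add: algebra_simps)
    then have e: "i = c * (x + y)" "0 = c * (y - x - \<tau> * y)"
      using coords_unique[of i 0 "c * (x + y)" "c * (y - x - \<tau> * y)"] c xy IK i tau_O O_mem by blast+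
    from e(2) have "y - x = \<tau> * y" using c by simp
    then have "x = y - \<tau> * y" by (metis add_diff_cancel_right' diff_add_cancel diff_diff_eq2 add.commute)
    then have "x + y = \<pi> * y" by (simp only: \<pi>_def) (simp add: algebra_simps)
    then have "i = c * \<pi> * y" using e(1) by simp
    then have ip: "i / \<pi> = c * y" using pi_nz by simp
    \<comment> \<open>Feeding -y back in gives -c y + c y \<zeta>, whose \<zeta>-coordinate is i /
      \<pi>.\<close>
    have "- y \<in> I'" using fractional_idealD(5)[OF I(2)] xy by blast
    then have "c * (lam * (- y + 0 * \<zeta>)) \<in> ext I" unfolding eq using extI[OF _ I0(2)] by blast
    then obtain x' y' where xy': "x' \<in> I" "y' \<in> I" "c * (lam * (- y + 0 * \<zeta>)) = x' + y' * \<zeta>" unfolding ext_def by blast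
    then have "- (c * y) + (c * y) * \<zeta> = x' + y' * \<zeta>" by (simp add: lam_def algebra_simps)
    then have "c * y = y'" using coords_unique(2)[of "- (c * y)" "c * y" x' y'] c xy xy' IK by blast
    then show ?thesis using ip xy' by simp
  qed
  have divk: "i / \<pi> ^ k \<in> I" if "i \<in> I" for i k
    using that
  proof (induction k)
    case (Suc k)
    then show ?case using div[of "i / \<pi> ^ k"] by (simp add: mult.commute)
  qed simp
  obtain i where i: "i \<in> I" "i \<noteq> 0" using I(1) unfolding fractional_ideal_def by blast
  obtain d where d: "d \<in> \<O>" "d \<noteq> 0" "\<forall>x\<in>I. d * x \<in> \<O>" using I(1) unfolding fractional_ideal_def by blast
  obtain k where "d * i / \<pi> ^ k \<notin> \<O>" using separated[of "d * i"] d i by auto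
  then show False using d(3) divk[OF i(1), of k] by auto
qed

end

section \<open>Roots of unity\<close>

lemma algebraic_int_geometric:
  fixes x :: complex
  assumes "algebraic_int x"
  shows "algebraic_int ((1 - x ^ j) / (1 - x))"
proof (cases "x = 1")
  case False
  then have "(1 - x ^ j) / (1 - x) = (\<Sum>i<j. x ^ i)" by (simp add: sum_gp_strict)
  then show ?thesis using assms by (simp add: algebraic_int_sum algebraic_int_power)
qed simp

lemma algebraic_int_root_of_unity: "x ^ n = 1 \<Longrightarrow> n > 0 \<Longrightarrow> algebraic_int (x :: complex)"
proof -
  assume x: "x ^ n = 1" "n > 0"
  show ?thesis
    by (rule algebraic_int_root[of 1 "monom 1 n" x]) (use x in \<open>auto simp: poly_monom degree_monom_eq coeff_monom\<close>)
qed

text \<open>The powers of x sum to 0, so m is the sum of the 1 - x^i, each a multiple of 1 -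
  x.\<close>

lemma algebraic_int_order_div:
  fixes x :: complex
  assumes "x ^ m = 1" "x \<noteq> 1" "m > 0"
  shows "algebraic_int (of_nat m / (1 - x))"
proof -
  have x: "algebraic_int x" using algebraic_int_root_of_unity assms by blast
  have "(\<Sum>i<m. x ^ i) = 0" using assms by (simp add: sum_gp_strict)
  then have "of_nat m / (1 - x) = (\<Sum>i<m. (1 - x ^ i) / (1 - x))"
    by (simp add: sum_subtractf flip: sum_divide_distrib)
  then show ?thesis using x by (simp add: algebraic_int_sum algebraic_int_geometric)
qed

lemma primitive_root_power_eq_1_iff:
  assumes "primitive_root_of_unity n x" "n > 0"
  shows "x ^ k = 1 \<longleftrightarrow> n dvd k"
proof
  have x: "x ^ n = 1" using assms by (simp add: primitive_root_of_unity_def)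
  have "x ^ k = x ^ (n * (k div n) + k mod n)" by simp
  also have "\<dots> = x ^ (k mod n)" unfolding power_add power_mult x by simp
  finally have k: "x ^ k = x ^ (k mod n)" .
  show "n dvd k" if "x ^ k = 1"
  proof (rule ccontr)
    assume "\<not> n dvd k"
    then have "0 < k mod n" "k mod n < n" using assms by (auto simp: dvd_eq_mod_eq_0)
    then show False using assms(1) k that by (auto simp: primitive_root_of_unity_def)
  qed
  show "x ^ k = 1" if "n dvd k" using k that by simp
qed

lemma primitive_root_powers_inj:
  assumes "primitive_root_of_unity n x" "n > 0"
  shows "inj_on (\<lambda>j. x ^ j) {..<n}"
proof (rule linorder_inj_onI)
  fix i j assume ij: "i < j" "i \<in> {..<n}" "j \<in> {..<n}"
  show "x ^ i \<noteq> x ^ j"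
  proof
    assume eq: "x ^ i = x ^ j"
    have "x \<noteq> 0" using assms by (auto simp: primitive_root_of_unity_def power_0_left)
    moreover have "x ^ j = x ^ i * x ^ (j - i)" using ij by (simp flip: power_add)
    ultimately have "n dvd j - i" using eq primitive_root_power_eq_1_iff[OF assms] by simp
    then show False using ij by (auto dest: dvd_imp_le)
  qed
qed auto

lemma primitive_root_of_unityI:
  assumes "\<And>k. x ^ k = 1 \<longleftrightarrow> n dvd k"
  shows "primitive_root_of_unity n x"
  unfolding primitive_root_of_unity_def assms using nat_dvd_not_less by auto

text \<open>For a prime p dividing m, x^(m/p) has order p, so 1 - x divides p. If m is not a prime
  power, two distinct primes divide it, and 1 is a combination of them.\<close>

lemma one_minus_primitive_root_unit:
  assumes x: "primitive_root_of_unity m x" and m: "m \<ge> 2" "\<not> primepow m"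
  shows "algebraic_int (1 / (1 - x))"
proof -
  have x_alg: "algebraic_int x"
    using x m algebraic_int_root_of_unity[of x m] by (simp add: primitive_root_of_unity_def)
  have pow: "x ^ k = 1 \<longleftrightarrow> m dvd k" for k using primitive_root_power_eq_1_iff[OF x] m by simp
  have div: "algebraic_int (of_nat p / (1 - x))" if p: "prime p" "p dvd m" for p
  proof -
    obtain r where r: "m = p * r" using p by blast
    have "r > 0" using m r by (intro Nat.gr0I) simp
    moreover have "p \<ge> 2" using p prime_ge_2_nat by blast
    ultimately have "\<not> m dvd r" using r nat_dvd_not_less[of r m] by simp
    then have "x ^ r \<noteq> 1" using pow by simp
    moreover have "(x ^ r) ^ p = 1" using pow[of m] r by (simp add: power_mult[symmetric] mult.commute)
    ultimately have "algebraic_int (of_nat p / (1 - x ^ r))"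
      using algebraic_int_order_div p prime_gt_0_nat by blast
    then have "algebraic_int (of_nat p / (1 - x ^ r) * ((1 - x ^ r) / (1 - x)))"
      using algebraic_int_geometric[OF x_alg] algebraic_int_times by blast
    then show ?thesis using \<open>x ^ r \<noteq> 1\<close> by simp
  qed
  obtain p where p: "prime p" "p dvd m" using prime_factor_nat[of m] m by auto
  define k where "k = multiplicity p m"
  obtain r where r: "m = p ^ k * r" "\<not> p dvd r"
    using multiplicity_decompose'[of m p] p m unfolding k_def by (metis not_prime_unit not_numeral_le_zero)
  have "k > 0" using r p by (intro Nat.gr0I) auto
  then have "primepow (p ^ k)" unfolding primepow_def using p by blast
  then have "r \<noteq> 1" using r m by auto
  then obtain q where q: "prime q" "q dvd r" using prime_factor_nat by blast
  then have qm: "q dvd m" "p \<noteq> q" using r by auto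
  then have "coprime (int p) (int q)" using p q by (simp add: primes_coprime)
  then obtain a b where "a * int p + b * int q = 1" using bezout_int[of "int p" "int q"] by auto
  then have ab: "of_int a * of_nat p + of_int b * of_nat q = (1 :: complex)"
    by (metis of_int_1 of_int_add of_int_mult of_int_of_nat_eq)
  have "1 / (1 - x) = of_int a * (of_nat p / (1 - x)) + of_int b * (of_nat q / (1 - x))"
    using ab by (simp add: add_divide_distrib[symmetric])
  also have "algebraic_int \<dots>"
    by (intro algebraic_int_add algebraic_int_times algebraic_int_of_int div p q(1) qm(1))
  finally show ?thesis .
qed

text \<open>With j invertible modulo m, x is a power of x^j, so the geometric sum works in this
  direction too.\<close>

lemma one_minus_primitive_root_associated:
  assumes x: "primitive_root_of_unity m x" and m: "m \<ge> 2" and j: "coprime j m"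
  shows "algebraic_int ((1 - x) / (1 - x ^ j))"
proof -
  have pow: "x ^ k = 1 \<longleftrightarrow> m dvd k" for k using primitive_root_power_eq_1_iff[OF x] m by simp
  have x_alg: "algebraic_int x"
    using x m algebraic_int_root_of_unity[of x m] by (simp add: primitive_root_of_unity_def)
  have "j \<noteq> 0" using j m by (intro notI) simp
  then obtain i y where "j * i = m * y + 1" using bezout_nat[of j m] j by auto
  then have "(x ^ j) ^ i = x ^ (m * y + 1)" by (simp add: power_mult[symmetric])
  also have "\<dots> = x" using pow[of m] by (simp add: power_add power_mult)
  finally show ?thesis using algebraic_int_geometric[OF algebraic_int_power[OF x_alg, of j], of i] by simp
qed

lemma one_minus_power_primitive_root_associated:
  assumes x: "primitive_root_of_unity m x" and m: "m \<ge> 2"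
  shows "algebraic_int ((1 - x ^ j) / (1 - x))"
  using x m algebraic_int_root_of_unity[of x m] algebraic_int_geometric
  by (simp add: primitive_root_of_unity_def)

lemma primitive_root_basics:
  assumes x: "primitive_root_of_unity n x" and n: "n \<ge> 3"
  shows "algebraic_int x" "x * cnj x = 1" "cnj x = inverse x" "cnj x \<noteq> x" "x \<noteq> 0"
proof -
  have pow: "x ^ k = 1 \<longleftrightarrow> n dvd k" for k using primitive_root_power_eq_1_iff[OF x] n by simp
  have 1: "x ^ n = 1" using pow by simp
  show "algebraic_int x" using algebraic_int_root_of_unity 1 n by simp
  have "norm x = 1" using 1 n by (metis norm_one norm_power norm_ge_zero power_eq_1_iff not_numeral_le_zero)
  then show xc: "x * cnj x = 1" by (simp add: complex_norm_square[symmetric])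
  then show "cnj x = inverse x" "x \<noteq> 0" by (auto simp: inverse_unique)
  show "cnj x \<noteq> x"
  proof
    assume "cnj x = x"
    then have "x ^ 2 = 1" using xc by (simp add: power2_eq_square)
    then show False using pow n by (auto dest: dvd_imp_le)
  qed
qed

text \<open>Dickson polynomials with parameter 1, that is, 2 T_k(X/2) for the Chebyshev polynomial
  T_k. They write x^k + x^(-k) as an integer polynomial in x + 1/x.\<close>

fun dickson :: "nat \<Rightarrow> int poly" where
  "dickson 0 = [:2:]"
| "dickson (Suc 0) = [:0, 1:]"
| "dickson (Suc (Suc k)) = [:0, 1:] * dickson (Suc k) - dickson k"

lemma poly_dickson:
  fixes x :: complex
  assumes "x * y = 1"
  shows "poly (of_int_poly (dickson k)) (x + y) = x ^ k + y ^ k"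
proof (induction k rule: dickson.induct)
  case (3 k)
  have "(x + y) * (x ^ Suc k + y ^ Suc k) - (x ^ k + y ^ k) =
      x ^ Suc (Suc k) + y ^ Suc (Suc k) + (x * y - 1) * (x ^ k + y ^ k)"
    by (simp add: algebra_simps)
  then show ?case using 3 assms
    by (simp add: of_int_poly_hom.hom_minus of_int_poly_hom.hom_mult map_poly_pCons del: mult_pCons_left)
qed (auto simp: map_poly_pCons)

lemma degree_dickson: "k > 0 \<Longrightarrow> degree (dickson k) = k \<and> coeff (dickson k) k = 1"
  "degree (dickson k) \<le> k"
proof (induction k rule: dickson.induct)
  case (3 k)
  { case 1
    have a: "degree (dickson (Suc k)) = Suc k" "coeff (dickson (Suc k)) (Suc k) = 1" using 3 by auto
    have b: "degree (dickson k) \<le> k" using 3 by auto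
    then have c: "coeff (dickson k) (Suc (Suc k)) = 0" by (intro coeff_eq_0) simp
    have "coeff (dickson (Suc (Suc k))) (Suc (Suc k)) = 1" using a c by simp
    moreover have "degree (dickson (Suc (Suc k))) \<le> Suc (Suc k)"
      using a b by (auto intro!: degree_diff_le)
    ultimately show ?case by (metis le_degree le_antisym zero_neq_one) }
  then show "degree (dickson (Suc (Suc k))) \<le> Suc (Suc k)" by simp
qed auto


section \<open>Total ramification at prime powers\<close>

text \<open>The x^j with p not dividing j are the roots of (X^(p r) - 1) / (X^r - 1), the sum of the
  X^(r i) over i < p; the product is its value at 1. For r a power of p this is a cyclotomic
  polynomial.\<close>

lemma prod_one_minus_primitive_roots:
  fixes x :: complex
  assumes x: "primitive_root_of_unity (p * r) x" and p: "prime p" and r: "r > 0"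
  shows "(\<Prod>j\<in>{j. j < p * r \<and> \<not> p dvd j}. 1 - x ^ j) = of_nat p"
    and "card {j. j < p * r \<and> \<not> p dvd j} = r * (p - 1)"
    and "(\<Sum>i<p. x ^ (r * i)) = 0"
proof -
  define S where "S = {j. j < p * r \<and> \<not> p dvd j}"
  have p2: "p \<ge> 2" using p prime_ge_2_nat by blast
  have pow: "x ^ k = 1 \<longleftrightarrow> p * r dvd k" for k using primitive_root_power_eq_1_iff[OF x] p2 r by simp
  have finS: "finite S" by (simp add: S_def)
  have "{..<p * r} = S \<union> (\<lambda>i. p * i) ` {..<r}" using p2 by (auto simp: S_def)
  moreover have "S \<inter> (\<lambda>i. p * i) ` {..<r} = {}" by (auto simp: S_def)
  moreover have "card ((\<lambda>i. p * i) ` {..<r}) = r" using p2 by (subst card_image) (auto simp: inj_on_def)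
  ultimately have "p * r = card S + r" using finS by (metis card_Un_disjoint card_lessThan finite_imageI finite_lessThan)
  then have "card S = p * r - r" by simp
  then have cardS: "card S = r * (p - 1)" by (simp add: diff_mult_distrib2 mult.commute)
  then show "card {j. j < p * r \<and> \<not> p dvd j} = r * (p - 1)" by (simp add: S_def)
  have sum0: "(\<Sum>i<p. (x ^ j) ^ (r * i)) = 0" if "\<not> p dvd j" for j
  proof -
    have "x ^ (j * r) \<noteq> 1" using pow[of "j * r"] that r by simp
    moreover have "(x ^ (j * r)) ^ p = 1" using pow[of "j * r * p"] by (simp add: power_mult[symmetric] mult_ac)
    ultimately have "(\<Sum>i<p. (x ^ (j * r)) ^ i) = 0" by (simp add: sum_gp_strict)
    then show ?thesis by (simp add: power_mult[symmetric] mult.assoc)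
  qed
  show "(\<Sum>i<p. x ^ (r * i)) = 0" using sum0[of 1] p2 by simp
  define P where "P = (\<Sum>i<p. monom (1 :: complex) (r * i))"
  define Q where "Q = (\<Prod>j\<in>S. [:- (x ^ j), 1:])"
  have inj: "inj_on (\<lambda>j. x ^ j) S"
    by (rule inj_on_subset[OF primitive_root_powers_inj[OF x]]) (use p2 r in \<open>auto simp: S_def\<close>)
  have degQ: "degree Q = card S"
    unfolding Q_def by (subst degree_prod_eq_sum_degree) (auto simp: finS)
  have lcQ: "coeff Q (card S) = 1"
    using lead_coeff_prod[of "\<lambda>j. [:- (x ^ j), 1:]" S] degQ by (simp add: Q_def)
  have "P = Q"
  proof (rule poly_eqI_degree_lead_coeff)
    have "coeff P (card S) = (\<Sum>i<p. if i = p - 1 then 1 else 0)"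
      unfolding P_def coeff_sum cardS using r by (intro sum.cong) (auto simp: coeff_monom)
    also have "\<dots> = 1" using p2 by (simp add: sum.delta)
    finally show "coeff P (card S) = coeff Q (card S)" by (simp add: lcQ)
    show "card S \<le> card ((\<lambda>j. x ^ j) ` S)" by (simp add: card_image[OF inj])
    show "degree P \<le> card S" unfolding P_def cardS
      by (intro degree_sum_le) (auto intro!: order.trans[OF degree_monom_le] mult_le_mono)
    show "degree Q \<le> card S" by (simp add: degQ)
    fix z assume "z \<in> (\<lambda>j. x ^ j) ` S"
    then obtain j where j: "j \<in> S" "z = x ^ j" by blast
    have "poly P z = 0" using sum0[of j] j by (simp add: P_def poly_sum poly_monom S_def)
    moreover have "poly Q z = 0" unfolding Q_def poly_prod using j finS by (auto intro!: prod_zero)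
    ultimately show "poly P z = poly Q z" by simp
  qed
  then have "poly P 1 = poly Q 1" by simp
  then show "(\<Prod>j\<in>{j. j < p * r \<and> \<not> p dvd j}. 1 - x ^ j) = of_nat p"
    by (simp add: P_def Q_def poly_sum poly_monom poly_prod S_def)
qed

text \<open>All factors 1 - x^j in the product formula for p are associated with 1 - x, so p is a
  unit times a power of 1 - x; the two claims are the two divisibilities.\<close>

lemma one_minus_primitive_root_power_associated:
  fixes x :: complex
  assumes x: "primitive_root_of_unity (p ^ Suc k) x" and p: "prime p"
  shows "algebraic_int (of_nat p / (1 - x) ^ (p ^ k * (p - 1)))"
    and "algebraic_int ((1 - x) ^ (p ^ k * (p - 1)) / of_nat p)"
proof -
  define S where "S = {j. j < p * p ^ k \<and> \<not> p dvd j}"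
  have p2: "p \<ge> 2" using p prime_ge_2_nat by blast
  have x': "primitive_root_of_unity (p * p ^ k) x" using x by simp
  note P = prod_one_minus_primitive_roots[OF x' p, folded S_def]
  have m2: "p ^ Suc k \<ge> 2" using p2 by (metis le_trans one_le_power power_Suc mult_le_mono mult_1_right one_le_numeral order.trans)
  have cop: "coprime j (p ^ Suc k)" if "j \<in> S" for j
  proof -
    have "coprime j p" using that prime_imp_coprime[OF p, of j] by (simp add: S_def coprime_commute)
    then show ?thesis by (simp only: coprime_power_right_iff) simp
  qed
  have "of_nat p / (1 - x) ^ (p ^ k * (p - 1)) = (\<Prod>j\<in>S. (1 - x ^ j) / (1 - x))"
    using P(1,2) p2 by (simp add: prod_dividef)
  also have "algebraic_int \<dots>"
    using one_minus_power_primitive_root_associated[OF x m2] by (intro algebraic_int_prod) auto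
  finally show "algebraic_int (of_nat p / (1 - x) ^ (p ^ k * (p - 1)))" .
  have "(1 - x) ^ (p ^ k * (p - 1)) / of_nat p = (\<Prod>j\<in>S. (1 - x) / (1 - x ^ j))"
    using P(1,2) p2 by (simp add: prod_dividef)
  also have "algebraic_int \<dots>"
    using one_minus_primitive_root_associated[OF x m2] cop by (intro algebraic_int_prod) auto
  finally show "algebraic_int ((1 - x) ^ (p ^ k * (p - 1)) / of_nat p)" .
qed

text \<open>Division with remainder by h. The leading coefficient may be -1 because the h used later
  comes from a monic polynomial by the substitution 2 - X; it is then its own inverse.\<close>

lemma poly_reduce_monic:
  fixes x :: complex and h F :: "int poly"
  assumes h: "poly (of_int_poly h) x = 0" "degree h = d" "d > 0"
    and l: "\<bar>lead_coeff h\<bar> = 1"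
  shows "\<exists>r. degree r < d \<and> poly (of_int_poly F) x = poly (of_int_poly r) x"
proof (induction F)
  case 0
  then show ?case using h by (intro exI[of _ 0]) simp
next
  case (pCons a F)
  then obtain r where r: "degree r < d" "poly (of_int_poly F) x = poly (of_int_poly r) x" by blast
  define s where "s = pCons a r"
  define c where "c = coeff s d * lead_coeff h"
  have degs: "degree s \<le> d" using r by (simp add: s_def)
  have ll: "lead_coeff h * lead_coeff h = 1"
    using l by (metis abs_mult_self_eq mult_1)
  have "coeff (s - Polynomial.smult c h) d = 0"
    using ll h(2) by (simp add: c_def mult.assoc)
  moreover have "degree (s - Polynomial.smult c h) \<le> d"
    using degs h(2) by (intro degree_diff_le) (auto intro: order.trans[OF degree_smult_le])
  ultimately have "degree (s - Polynomial.smult c h) < d"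
    using \<open>d > 0\<close> by (metis le_neq_implies_less leading_coeff_0_iff degree_0)
  moreover have "poly (of_int_poly (s - Polynomial.smult c h)) x = poly (of_int_poly (pCons a F)) x"
    using h r by (simp add: s_def of_int_hom.map_poly_pCons_hom of_int_poly_hom.hom_minus of_int_hom.map_poly_hom_smult)
  ultimately show ?case by metis
qed

text \<open>The Eisenstein argument: the terms of \<open>F(\<pi>)\<close> have distinct valuations below that of \<open>p\<close>.\<close>

lemma eisenstein_coeffs:
  fixes \<pi> :: complex and F :: "int poly"
  assumes pi: "algebraic_int \<pi>" "\<not> algebraic_int (1 / \<pi>)" and p: "prime p"
    and pd: "algebraic_int (of_nat p / \<pi> ^ d)"
    and deg: "degree F < d" and F: "algebraic_int (poly (of_int_poly F) \<pi> / of_nat p)"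
  shows "int p dvd coeff F i"
proof (cases "i < d")
  case True
  have nz: "\<pi> \<noteq> 0" using pi by auto
  have p0: "(of_nat p :: complex) \<noteq> 0" using p by (simp add: prime_gt_0_nat)
  have psplit: "algebraic_int (of_nat p * w / \<pi> ^ j)" if "j \<le> d" "algebraic_int w" for j w
  proof -
    have "of_nat p * w / \<pi> ^ j = of_nat p / \<pi> ^ d * \<pi> ^ (d - j) * w"
      using nz that by (simp add: power_diff)
    also have "algebraic_int \<dots>" by (intro algebraic_int_times algebraic_int_power pd pi that)
    finally show ?thesis .
  qed
  show ?thesis using True
  proof (induction i rule: less_induct)
    case (less i)
    define a where "a j = (of_int (coeff F j) :: complex) * \<pi> ^ j" for j
    have "poly (of_int_poly F) \<pi> = (\<Sum>j\<le>degree F. a j)"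
      by (simp add: poly_altdef degree_map_poly coeff_map_poly a_def)
    also have "\<dots> = (\<Sum>j<d. a j)"
      using deg by (intro sum.mono_neutral_left) (auto simp: a_def coeff_eq_0)
    also have "\<dots> = a i + (\<Sum>j\<in>{..<d} - {i}. a j)" using less.prems by (simp add: sum.remove)
    \<comment> \<open>After division by \<pi>^(i + 1), the lower terms are integral because p
      divides their coefficients and \<pi>^d divides p; the higher terms contain the divisor. So
      \<pi> divides the coefficient of index i, and if p did not, Bezout would make 1 / \<pi>
      integral.\<close>
    finally have ai: "a i / \<pi> ^ Suc i = poly (of_int_poly F) \<pi> / \<pi> ^ Suc i - (\<Sum>j\<in>{..<d} - {i}. a j / \<pi> ^ Suc i)"
      by (simp add: add_divide_distrib flip: sum_divide_distrib)
    have "algebraic_int (poly (of_int_poly F) \<pi> / \<pi> ^ Suc i)"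
      using psplit[OF _ F, of "Suc i"] less.prems p0 by simp
    moreover have "algebraic_int (a j / \<pi> ^ Suc i)" if "j \<in> {..<d} - {i}" for j
    proof (cases "j < i")
      case True
      then obtain m where "coeff F j = int p * m" using less.IH[of j] less.prems by auto
      then have "a j / \<pi> ^ Suc i = of_nat p * (of_int m * \<pi> ^ j) / \<pi> ^ Suc i" by (simp add: a_def)
      also have "algebraic_int \<dots>" using less.prems pi by (intro psplit) (auto intro: algebraic_int_intros)
      finally show ?thesis .
    next
      case False
      then have "\<pi> ^ j = \<pi> ^ (j - Suc i) * \<pi> ^ Suc i" using that by (simp flip: power_add power_Suc)
      then have "a j / \<pi> ^ Suc i = of_int (coeff F j) * \<pi> ^ (j - Suc i)"
        using nz by (simp add: a_def)
      then show ?thesis using pi by (simp add: algebraic_int_intros)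
    qed
    ultimately have "algebraic_int (a i / \<pi> ^ Suc i)"
      unfolding ai by (intro algebraic_int_diff algebraic_int_sum)
    then have ai: "algebraic_int (of_int (coeff F i) * (1 / \<pi>))" using nz by (simp add: a_def)
    show ?case
    proof (rule ccontr)
      assume "\<not> int p dvd coeff F i"
      then have "coprime (int p) (coeff F i)" using p by (simp add: prime_imp_coprime)
      then obtain u v where "u * int p + v * coeff F i = 1"
        using bezout_int[of "int p" "coeff F i"] by auto
      then have uv: "of_int u * of_nat p + of_int v * of_int (coeff F i) = (1 :: complex)"
        by (metis of_int_1 of_int_add of_int_mult of_int_of_nat_eq)
      have "1 / \<pi> = (of_int u * of_nat p + of_int v * of_int (coeff F i)) / \<pi>" by (simp only: uv)
      also have "\<dots> = of_int u * (of_nat p * 1 / \<pi> ^ 1) + of_int v * (of_int (coeff F i) * (1 / \<pi>))"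
        by (simp add: add_divide_distrib)
      also have "algebraic_int \<dots>"
        using less.prems by (intro algebraic_int_add algebraic_int_times algebraic_int_of_int psplit ai) auto
      finally show False using pi by blast
    qed
  qed
next
  case False
  then show ?thesis using deg by (simp add: coeff_eq_0)
qed

text \<open>A fraction F(\<pi>) / m is simplified first: a factor p of m also divides F, by
  \<open>eisenstein_coeffs\<close>, and cancels. Once m is prime to p, x is modulo \<pi> the
  constant coefficient of F times an inverse of m modulo p.\<close>

lemma eisenstein_residue:
  fixes \<pi> x :: complex and F :: "int poly"
  assumes pi: "algebraic_int \<pi>" "\<not> algebraic_int (1 / \<pi>)" and p: "prime p"
    and d: "d > 0" and pd: "algebraic_int (of_nat p / \<pi> ^ d)"
    and deg: "degree F < d" and x: "algebraic_int x"
    and F: "of_int m * x = poly (of_int_poly F) \<pi>" "m \<noteq> 0"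
  shows "\<exists>k. algebraic_int ((x - of_int k) / \<pi>)"
  using deg F
proof (induction "nat \<bar>m\<bar>" arbitrary: m F rule: less_induct)
  case less
  have nz: "\<pi> \<noteq> 0" using pi by auto
  have p2: "p \<ge> 2" using p prime_ge_2_nat by blast
  show ?case
  proof (cases "int p dvd m")
    case True
    then obtain m' where m': "m = int p * m'" by blast
    then have "poly (of_int_poly F) \<pi> / of_nat p = of_int m' * x" using less.prems p2 by (simp flip: less.prems(2))
    then have "algebraic_int (poly (of_int_poly F) \<pi> / of_nat p)" using x by (simp add: algebraic_int_intros)
    then have dvd: "int p dvd coeff F i" for i
      using eisenstein_coeffs[OF pi p pd less.prems(1)] by blast
    then have "[:int p:] dvd F" by (simp add: const_poly_dvd_iff)
    then obtain F' where F': "F = Polynomial.smult (int p) F'" by (auto simp: dvd_def)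
    have "degree F' < d" using less.prems(1) p2 by (simp add: F')
    moreover have "of_int m' * x = poly (of_int_poly F') \<pi>"
      using less.prems(2) p2 by (simp add: F' m' of_int_hom.map_poly_hom_smult)
    moreover have "m' \<noteq> 0" using m' less.prems by auto
    moreover have "nat \<bar>m'\<bar> < nat \<bar>m\<bar>" using m' p2 \<open>m' \<noteq> 0\<close> by (simp add: abs_mult)
    ultimately show ?thesis using less.hyps by blast
  next
    case False
    then have "coprime (int p) m" using p by (simp add: prime_imp_coprime)
    then obtain u v where "u * int p + v * m = 1" using bezout_int[of "int p" m] by auto
    then have uv: "of_int u * of_nat p + of_int v * of_int m = (1 :: complex)"
      by (metis of_int_1 of_int_add of_int_mult of_int_of_nat_eq)
    obtain a G where F: "F = pCons a G" by (cases F)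
    have "x = (of_int u * of_nat p + of_int v * of_int m) * x" by (simp add: uv)
    also have "\<dots> = of_int u * of_nat p * x + of_int v * (of_int m * x)" by (simp add: algebra_simps)
    also have "of_int m * x = of_int a + \<pi> * poly (of_int_poly G) \<pi>"
      using less.prems by (simp add: F of_int_hom.map_poly_pCons_hom)
    finally have xa: "x - of_int (v * a) = of_nat p * (of_int u * x) + \<pi> * (of_int v * poly (of_int_poly G) \<pi>)"
      by (simp add: algebra_simps)
    have "(x - of_int (v * a)) / \<pi> = (of_nat p / \<pi> ^ d) * \<pi> ^ (d - 1) * (of_int u * x) + of_int v * poly (of_int_poly G) \<pi>"
    proof -
      have "\<pi> ^ d = \<pi> * \<pi> ^ (d - 1)" using d by (cases d) auto
      then have "of_nat p / \<pi> = of_nat p / \<pi> ^ d * \<pi> ^ (d - 1)" using nz by simp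
      moreover have "(x - of_int (v * a)) / \<pi> = of_nat p / \<pi> * (of_int u * x) + of_int v * poly (of_int_poly G) \<pi>"
        unfolding xa using nz by (simp add: add_divide_distrib)
      ultimately show ?thesis by simp
    qed
    also have "algebraic_int \<dots>"
      using pd pi x by (intro algebraic_int_add algebraic_int_times algebraic_int_power algebraic_int_of_int algebraic_int_poly)
    finally show ?thesis by blast
  qed
qed


section \<open>The maximal real subfield of a cyclotomic field\<close>

text \<open>This is \<open>\<rat>(\<alpha>)\<close> if \<open>\<alpha>\<close> is algebraic.\<close>

definition int_fractions :: "complex \<Rightarrow> complex set" where
  "int_fractions \<alpha> = {x. \<exists>N F. N \<noteq> (0 :: int) \<and> of_int N * x = poly (of_int_poly F) \<alpha>}"

lemma int_fractionsI: "N \<noteq> 0 \<Longrightarrow> of_int N * x = poly (of_int_poly F) \<alpha> \<Longrightarrow> x \<in> int_fractions \<alpha>"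
  unfolding int_fractions_def by blast

lemma ring_of_type_algebra_complex:
  "\<zero>\<^bsub>ring_of_type_algebra\<^esub> = (0 :: complex)" "\<one>\<^bsub>ring_of_type_algebra\<^esub> = (1 :: complex)"
  "x \<oplus>\<^bsub>ring_of_type_algebra\<^esub> y = x + (y :: complex)" "x \<otimes>\<^bsub>ring_of_type_algebra\<^esub> y = x * (y :: complex)"
  "\<ominus>\<^bsub>ring_of_type_algebra\<^esub> x = - (x :: complex)"
  "x \<noteq> 0 \<Longrightarrow> inv\<^bsub>ring_of_type_algebra\<^esub> x = inverse (x :: complex)"
proof -
  let ?R = "ring_of_type_algebra :: complex ring"
  interpret field ?R by (rule field_from_type_algebra)
  show 0: "\<zero>\<^bsub>?R\<^esub> = (0 :: complex)" "\<one>\<^bsub>?R\<^esub> = (1 :: complex)"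
    and ops: "x \<oplus>\<^bsub>?R\<^esub> y = x + y" "x \<otimes>\<^bsub>?R\<^esub> y = x * y" for x y :: complex
    by (simp_all add: ring_of_type_algebra_def)
  have c: "x \<in> carrier ?R" for x by (simp add: ring_of_type_algebra_def)
  show "\<ominus>\<^bsub>?R\<^esub> x = - x" using minus_equality[OF _ c c, of "- x" x] by (simp add: ops 0)
  show "inv\<^bsub>?R\<^esub> x = inverse x" if "x \<noteq> 0"
    using comm_inv_char[OF c c, of x "inverse x"] that by (simp add: ops 0)
qed

lemma rat_adjoin_field_closed:
  shows rat_adjoin_base: "\<alpha> \<in> rat_adjoin \<alpha>"
    and rat_adjoin_one: "1 \<in> rat_adjoin \<alpha>"
    and rat_adjoin_add: "x \<in> rat_adjoin \<alpha> \<Longrightarrow> y \<in> rat_adjoin \<alpha> \<Longrightarrow> x + y \<in> rat_adjoin \<alpha>"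
    and rat_adjoin_mult: "x \<in> rat_adjoin \<alpha> \<Longrightarrow> y \<in> rat_adjoin \<alpha> \<Longrightarrow> x * y \<in> rat_adjoin \<alpha>"
    and rat_adjoin_uminus: "x \<in> rat_adjoin \<alpha> \<Longrightarrow> - x \<in> rat_adjoin \<alpha>"
    and rat_adjoin_inverse: "x \<in> rat_adjoin \<alpha> \<Longrightarrow> inverse x \<in> rat_adjoin \<alpha>"
proof -
  let ?R = "ring_of_type_algebra :: complex ring"
  note ops = ring_of_type_algebra_complex
  show "\<alpha> \<in> rat_adjoin \<alpha>" unfolding rat_adjoin_def by (rule generate_field.incl) simp
  show "1 \<in> rat_adjoin \<alpha>" using generate_field.one[of ?R "{\<alpha>}"] by (simp add: rat_adjoin_def ops)
  show "x + y \<in> rat_adjoin \<alpha>" if "x \<in> rat_adjoin \<alpha>" "y \<in> rat_adjoin \<alpha>" for x y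
    using generate_field.eng_add[of x ?R "{\<alpha>}" y] that by (simp add: rat_adjoin_def ops)
  show "x * y \<in> rat_adjoin \<alpha>" if "x \<in> rat_adjoin \<alpha>" "y \<in> rat_adjoin \<alpha>" for x y
    using generate_field.eng_mult[of x ?R "{\<alpha>}" y] that by (simp add: rat_adjoin_def ops)
  show "- x \<in> rat_adjoin \<alpha>" if "x \<in> rat_adjoin \<alpha>" for x
    using generate_field.a_inv[of x ?R "{\<alpha>}"] that by (simp add: rat_adjoin_def ops)
  show "inverse x \<in> rat_adjoin \<alpha>" if "x \<in> rat_adjoin \<alpha>" for x
    using generate_field.m_inv[of x ?R "{\<alpha>}"] that by (cases "x = 0") (simp_all add: rat_adjoin_def ops)
qed

text \<open>\<beta> is kept apart from \<alpha> so that a field given by one root of unity can be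
  described through another. Inverses stay inside because a nonzero polynomial value divides a
  nonzero integer with a polynomial cofactor.\<close>

lemma rat_adjoin_subset_int_fractions:
  assumes a: "algebraic_int \<alpha>" and b: "\<beta> \<in> int_fractions \<alpha>"
  shows "rat_adjoin \<beta> \<subseteq> int_fractions \<alpha>"
proof
  fix x assume "x \<in> rat_adjoin \<beta>"
  then show "x \<in> int_fractions \<alpha>" unfolding rat_adjoin_def
  proof (induction rule: generate_field.induct)
    case one
    then show ?case by (auto simp: ring_of_type_algebra_complex intro: int_fractionsI[of 1 _ 1])
  next
    case (incl h)
    then show ?case using b by simp
  next
    case (a_inv h)
    then obtain N F where "N \<noteq> 0" "of_int N * h = poly (of_int_poly F) \<alpha>" by (auto simp: int_fractions_def)
    then show ?case unfolding ring_of_type_algebra_complex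
      by (intro int_fractionsI[of "- N" _ F]) auto
  next
    case (m_inv h)
    then obtain N F where N: "N \<noteq> 0" "of_int N * h = poly (of_int_poly F) \<alpha>" by (auto simp: int_fractions_def)
    have h: "h \<noteq> 0" using m_inv by (simp add: ring_of_type_algebra_complex)
    define u where "u = poly (of_int_poly F) \<alpha>"
    have u: "u \<noteq> 0" "algebraic_int u"
      using N h algebraic_int_poly[OF a, of F] by (simp_all add: u_def flip: N(2))
    obtain M r where M: "M \<noteq> 0" "u * poly (of_int_poly r) u = of_int M"
      using algebraic_int_dvd_int[OF u(2,1)] by blast
    have "poly (of_int_poly (pcompose r F)) \<alpha> = poly (of_int_poly r) u"
      by (simp add: u_def of_int_hom.map_poly_pcompose poly_pcompose)
    then have "of_int M * inverse h = poly (of_int_poly (Polynomial.smult N (pcompose r F))) \<alpha>"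
      using M(2) N(2) h by (simp add: u_def[symmetric] of_int_hom.map_poly_hom_smult field_simps flip: M(2))
    then show ?case unfolding ring_of_type_algebra_complex(6)[OF h] using M(1) int_fractionsI by blast
  next
    case (eng_add h1 h2)
    then obtain N F M G where NM: "N \<noteq> 0" "of_int N * h1 = poly (of_int_poly F) \<alpha>"
      "M \<noteq> 0" "of_int M * h2 = poly (of_int_poly G) \<alpha>" by (auto simp: int_fractions_def)
    then show ?case unfolding ring_of_type_algebra_complex
      using NM(1,3) by (intro int_fractionsI[of "N * M" _ "Polynomial.smult M F + Polynomial.smult N G"])
        (simp_all add: of_int_poly_hom.hom_add of_int_hom.map_poly_hom_smult algebra_simps
          flip: NM(2,4))
  next
    case (eng_mult h1 h2)
    then obtain N F M G where NM: "N \<noteq> 0" "of_int N * h1 = poly (of_int_poly F) \<alpha>"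
      "M \<noteq> 0" "of_int M * h2 = poly (of_int_poly G) \<alpha>" by (auto simp: int_fractions_def)
    then show ?case unfolding ring_of_type_algebra_complex
      using NM(1,3) by (intro int_fractionsI[of "N * M" _ "F * G"])
        (simp_all add: of_int_poly_hom.hom_mult algebra_simps flip: NM(2,4))
  qed
qed

lemma primitive_root_is_power:
  assumes z: "primitive_root_of_unity n z" and x: "x ^ n = 1" and n: "n > 0"
  obtains j where "x = z ^ j"
proof -
  have pow: "z ^ k = 1 \<longleftrightarrow> n dvd k" for k using primitive_root_power_eq_1_iff[OF z n] .
  note inj = primitive_root_powers_inj[OF z n]
  have "(\<lambda>j. z ^ j) ` {..<n} = {w. w ^ n = 1}"
  proof (rule card_subset_eq)
    show "finite {w::complex. w ^ n = 1}" using finite_roots_unity[of n] n by simp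
    show "(\<lambda>j. z ^ j) ` {..<n} \<subseteq> {w. w ^ n = 1}" using pow by (auto simp flip: power_mult)
    show "card ((\<lambda>j. z ^ j) ` {..<n}) = card {w::complex. w ^ n = 1}"
      using n by (simp add: card_image[OF inj] card_roots_unity_eq)
  qed
  then show ?thesis using x that by blast
qed

text \<open>x is a power of z, and a Dickson polynomial expresses its trace through that of z. Later
  x is the given root and z the eigenvalue found in the representation.\<close>

lemma real_subfield_subset:
  assumes z: "primitive_root_of_unity n z" and x: "primitive_root_of_unity n x" and n: "n \<ge> 3"
  shows "rat_adjoin (x + inverse x) \<subseteq> int_fractions (z + cnj z)"
proof (rule rat_adjoin_subset_int_fractions)
  note zb = primitive_root_basics[OF z n]
  show "algebraic_int (z + cnj z)" by (intro algebraic_int_add algebraic_int_cnj zb(1))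
  have "x ^ n = 1" using x by (simp add: primitive_root_of_unity_def)
  then obtain j where j: "x = z ^ j" using primitive_root_is_power[OF z _ ] n by auto
  have "x + inverse x = z ^ j + cnj z ^ j" unfolding zb(3) by (simp add: j power_inverse)
  also have "\<dots> = poly (of_int_poly (dickson j)) (z + cnj z)" by (rule poly_dickson[OF zb(2), symmetric])
  finally show "x + inverse x \<in> int_fractions (z + cnj z)" by (intro int_fractionsI[of 1]) auto
qed

lemma rotation_field_real_subfield:
  assumes z: "primitive_root_of_unity n z" and x: "primitive_root_of_unity n x" and n: "n \<ge> 3"
    and tr: "z + cnj z \<in> rat_adjoin (x + inverse x)"
  shows "rotation_field (rat_adjoin (x + inverse x)) z"
proof
  note zb = primitive_root_basics[OF z n]
  let ?K = "rat_adjoin (x + inverse x)"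
  note sub = real_subfield_subset[OF z x n]
  show "1 \<in> ?K" by (rule rat_adjoin_one)
  show "\<exists>N. N \<noteq> (0 :: int) \<and> algebraic_int (of_int N * w)" if "w \<in> ?K" for w
  proof -
    obtain N F where "N \<noteq> 0" "of_int N * w = poly (of_int_poly F) (z + cnj z)"
      using sub \<open>w \<in> ?K\<close> by (auto simp: int_fractions_def)
    moreover have "algebraic_int (poly (of_int_poly F) (z + cnj z))"
      by (intro algebraic_int_poly algebraic_int_add algebraic_int_cnj zb(1))
    ultimately show ?thesis by metis
  qed
  show "cnj w = w" if "w \<in> ?K" for w
  proof -
    obtain N F where N: "N \<noteq> 0" "of_int N * w = poly (of_int_poly F) (z + cnj z)"
      using sub \<open>w \<in> ?K\<close> by (auto simp: int_fractions_def)
    have "cnj (poly (of_int_poly F) u) = poly (of_int_poly F) (cnj u)" for u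
      by (induction F) (auto simp: of_int_hom.map_poly_pCons_hom)
    then have "cnj (of_int N * w) = of_int N * w" unfolding N(2) by (simp add: add.commute)
    then show ?thesis using N(1) by simp
  qed
  show "cnj z \<noteq> z" "z * cnj z = 1" "algebraic_int z" using zb by auto
qed (use tr in \<open>auto intro: rat_adjoin_add rat_adjoin_mult rat_adjoin_uminus rat_adjoin_inverse\<close>)

section \<open>Discriminant and ramification of K(\<zeta>) over K\<close>

context rotation_field
begin

lemma disc_eq: "\<tau>\<^sup>2 - 4 = (cnj \<zeta> * (1 - \<zeta>\<^sup>2))\<^sup>2"
proof -
  have "cnj \<zeta> * (1 - \<zeta>\<^sup>2) = cnj \<zeta> - (\<zeta> * cnj \<zeta>) * \<zeta>" by (simp add: power2_eq_square algebra_simps)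
  also have "\<dots> = cnj \<zeta> - \<zeta>" by (simp add: z_cnj)
  finally have e: "cnj \<zeta> * (1 - \<zeta>\<^sup>2) = cnj \<zeta> - \<zeta>" .
  show ?thesis unfolding e using z_cnj by (simp add: \<tau>_def power2_eq_square algebra_simps)
qed

lemma z_sq_ne_one: "\<zeta>\<^sup>2 \<noteq> 1"
  using tau_sq_ne disc_eq by auto

text \<open>The discriminant is a unit times (1 - \<zeta>^2)^2. The order of \<zeta>^2 is n for odd
  n and n / 2 for even n, and the hypothesis prevents it from being a prime power.\<close>

lemma disc_unit:
  assumes z: "primitive_root_of_unity n \<zeta>" and n: "n \<ge> 3"
    and np: "\<not> (primepow n \<or> (\<exists>q. primepow q \<and> n = 2 * q))"
  shows "inverse (\<tau>\<^sup>2 - 4) \<in> \<O>"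
proof (rule OI)
  have pow: "\<zeta> ^ k = 1 \<longleftrightarrow> n dvd k" for k using primitive_root_power_eq_1_iff[OF z] n by simp
  have "algebraic_int (1 / (1 - \<zeta>\<^sup>2))"
  proof (cases "even n")
    case True
    then obtain m where m: "n = 2 * m" by blast
    have "primitive_root_of_unity m (\<zeta>\<^sup>2)"
      by (rule primitive_root_of_unityI) (simp add: pow m flip: power_mult)
    then show ?thesis using one_minus_primitive_root_unit np m n by auto
  next
    case False
    have "primitive_root_of_unity n (\<zeta>\<^sup>2)"
    proof (rule primitive_root_of_unityI)
      fix k
      have "(\<zeta>\<^sup>2) ^ k = 1 \<longleftrightarrow> n dvd 2 * k" by (simp add: pow flip: power_mult)
      also have "\<dots> \<longleftrightarrow> n dvd k" using False by (simp add: coprime_dvd_mult_right_iff)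
      finally show "(\<zeta>\<^sup>2) ^ k = 1 \<longleftrightarrow> n dvd k" .
    qed
    then show ?thesis using one_minus_primitive_root_unit np n by auto
  qed
  then have "algebraic_int ((\<zeta> * (1 / (1 - \<zeta>\<^sup>2)))\<^sup>2)"
    using z_algebraic_int by (intro algebraic_int_power algebraic_int_times)
  also have "(\<zeta> * (1 / (1 - \<zeta>\<^sup>2)))\<^sup>2 = inverse (\<tau>\<^sup>2 - 4)"
  proof -
    have "\<zeta> = inverse (cnj \<zeta>)" using z_cnj by (metis inverse_unique mult.commute)
    then have "(\<zeta> * (1 / (1 - \<zeta>\<^sup>2)))\<^sup>2 = inverse (cnj \<zeta> * (1 - \<zeta>\<^sup>2)) ^ 2"
      by (metis inverse_eq_divide inverse_mult_distrib)
    then show ?thesis unfolding disc_eq power_inverse .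
  qed
  finally show "algebraic_int (inverse (\<tau>\<^sup>2 - 4))" .
  show "inverse (\<tau>\<^sup>2 - 4) \<in> K" using tau_O O_mem by (intro inverse_mem diff_mem power_mem) (auto intro: of_int_mem[of 4, simplified])
qed


text \<open>The sum of the X^(r i) over i < p is palindromic of degree 2 d and vanishes at \<zeta>.
  Divided by X^d, it becomes an integer polynomial g in X + 1/X by means of Dickson polynomials, and
  h(X) = g(2 - X).\<close>

lemma pi_annihilator:
  assumes z: "primitive_root_of_unity (p * r) \<zeta>" and p: "prime p" and r: "r > 0"
    and d: "r * (p - 1) = 2 * d" and d0: "d > 0"
  obtains h :: "int poly" where "degree h = d" "\<bar>lead_coeff h\<bar> = 1" "poly (of_int_poly h) \<pi> = 0"
proof -
  have p2: "p \<ge> 2" using p prime_ge_2_nat by blast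
  have z0: "\<zeta> \<noteq> 0" using z_cnj by auto
  note prim = prod_one_minus_primitive_roots[OF z p r]
  define c :: "nat \<Rightarrow> int" where "c j = (if r dvd j then 1 else 0)" for j
  define g where "g = [:c d:] + (\<Sum>i\<in>{1..d}. Polynomial.smult (c (d + i)) (dickson i))"
  have g_root: "poly (of_int_poly g) \<tau> = 0"
  proof -
    have c_sym: "c (d - i) = c (d + i)" if "i \<le> d" for i
    proof -
      have "r dvd (d - i) + (d + i)" using d that by (metis add.commute add_diff_cancel_left' dvd_triv_left le_add_diff_inverse mult_2 add.assoc)
      then show ?thesis unfolding c_def by (metis dvd_add_right_iff dvd_add_left_iff)
    qed
    have sum0: "(\<Sum>j\<le>2 * d. of_int (c j) * \<zeta> ^ j) = 0"
    proof -
      have "(\<Sum>j\<le>2 * d. of_int (c j) * \<zeta> ^ j) = (\<Sum>j\<in>{j. j \<le> 2 * d \<and> r dvd j}. \<zeta> ^ j)"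
        by (rule sum.mono_neutral_cong_right) (auto simp: c_def)
      also have "\<dots> = (\<Sum>i<p. \<zeta> ^ (r * i))"
      proof (rule sum.reindex_bij_betw[symmetric, of "\<lambda>i. r * i"])
        show "bij_betw (\<lambda>i. r * i) {..<p} {j. j \<le> 2 * d \<and> r dvd j}"
        proof (rule bij_betwI')
          fix i assume "i \<in> {..<p}"
          then show "r * i \<in> {j. j \<le> 2 * d \<and> r dvd j}" using d by (auto simp flip: d)
        next
          fix j assume "j \<in> {j. j \<le> 2 * d \<and> r dvd j}"
          then have "j \<le> r * (p - 1)" "r dvd j" using d by simp_all
          then obtain i where i: "j = r * i" "r * i \<le> r * (p - 1)" by (metis dvdE)
          then have "i \<le> p - 1" using r by simp
          then show "\<exists>i\<in>{..<p}. j = r * i" using i p2 by (intro bexI[of _ i]) auto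
        qed (use r in auto)
      qed
      finally show ?thesis using prim(3) by simp
    qed
    have split: "(\<Sum>j\<le>2 * d. f j) = f d + (\<Sum>i\<in>{1..d}. f (d + i) + f (d - i))" for f :: "nat \<Rightarrow> complex"
    proof -
      have "(\<Sum>j\<le>2 * d. f j) = (\<Sum>j\<in>{d} \<union> ((\<lambda>i. d + i) ` {1..d} \<union> (\<lambda>i. d - i) ` {1..d}). f j)"
      proof (rule sum.cong[OF _ refl])
        have "j \<in> {d} \<union> ((\<lambda>i. d + i) ` {1..d} \<union> (\<lambda>i. d - i) ` {1..d})" if "j \<le> 2 * d" for j
        proof -
          consider "j = d" | "j > d" "j = d + (j - d)" | "j < d" "j = d - (d - j)" by linarith
          then show ?thesis
          proof cases
            case 2 then show ?thesis using that by (intro UnI2 UnI1 image_eqI[of _ _ "j - d"]) auto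
          next
            case 3 then show ?thesis by (intro UnI2 image_eqI[of _ _ "d - j"]) auto
          qed auto
        qed
        moreover have "j \<le> 2 * d" if "j \<in> {d} \<union> ((\<lambda>i. d + i) ` {1..d} \<union> (\<lambda>i. d - i) ` {1..d})" for j
          using that by auto
        ultimately show "{..2 * d} = {d} \<union> ((\<lambda>i. d + i) ` {1..d} \<union> (\<lambda>i. d - i) ` {1..d})"
          by (intro equalityI subsetI) simp_all
      qed
      also have "\<dots> = f d + ((\<Sum>j\<in>(\<lambda>i. d + i) ` {1..d}. f j) + (\<Sum>j\<in>(\<lambda>i. d - i) ` {1..d}. f j))"
        by (subst sum.union_disjoint, simp, simp, force, subst sum.union_disjoint) auto
      also have "(\<Sum>j\<in>(\<lambda>i. d + i) ` {1..d}. f j) = (\<Sum>i\<in>{1..d}. f (d + i))"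
        by (subst sum.reindex) auto
      also have "(\<Sum>j\<in>(\<lambda>i. d - i) ` {1..d}. f j) = (\<Sum>i\<in>{1..d}. f (d - i))"
        by (subst sum.reindex) (auto simp: inj_on_def)
      finally show ?thesis by (simp add: sum.distrib)
    qed
    have hom_sum: "poly (of_int_poly (sum G A)) w = (\<Sum>i\<in>A. poly (of_int_poly (G i)) w)"
      for G :: "nat \<Rightarrow> int poly" and A and w :: complex
      by (induction A rule: infinite_finite_induct) (simp_all add: of_int_poly_hom.hom_add)
    have "poly (of_int_poly g) \<tau> = of_int (c d) + (\<Sum>i\<in>{1..d}. of_int (c (d + i)) * (\<zeta> ^ i + cnj \<zeta> ^ i))"
      unfolding g_def of_int_poly_hom.hom_add poly_add hom_sum of_int_hom.map_poly_hom_smult poly_smult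
      unfolding \<tau>_def poly_dickson[OF z_cnj] by (simp add: of_int_hom.map_poly_pCons_hom)
    also have "\<zeta> ^ d * \<dots> = (\<Sum>j\<le>2 * d. of_int (c j) * \<zeta> ^ j)"
    proof -
      have "\<zeta> ^ d * (of_int (c (d + i)) * (\<zeta> ^ i + cnj \<zeta> ^ i)) =
          of_int (c (d + i)) * \<zeta> ^ (d + i) + of_int (c (d - i)) * \<zeta> ^ (d - i)" if "i \<in> {1..d}" for i
      proof -
        have "\<zeta> ^ d = \<zeta> ^ (d - i) * \<zeta> ^ i" using that by (simp flip: power_add)
        then have "\<zeta> ^ d * cnj \<zeta> ^ i = \<zeta> ^ (d - i)" using z_cnj by (simp add: mult.assoc flip: power_mult_distrib)
        then show ?thesis using c_sym[of i] that by (simp add: power_add algebra_simps)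
      qed
      then show ?thesis unfolding split distrib_left sum_distrib_left by (simp add: mult.commute)
    qed
    finally show ?thesis using z0 sum0 by simp
  qed
  have coeff_dickson: "coeff (dickson i) j = 0" if "i < j" for i j
    using degree_dickson(2)[of i] that by (intro coeff_eq_0) simp
  have c2d: "c (d + d) = 1" using d by (simp add: c_def) (metis dvd_triv_left mult_2)
  have coeff_g: "coeff g d = 1"
  proof -
    have "coeff g d = (\<Sum>i\<in>{1..d}. if i = d then 1 else 0)"
      unfolding g_def using d0 coeff_dickson degree_dickson(1)[of d] c2d
      by (auto simp: coeff_sum coeff_pCons split: nat.splits intro!: sum.cong)
    then show ?thesis using d0 by simp
  qed
  have deg_g: "degree g = d"
  proof (rule antisym)
    show "degree g \<le> d" unfolding g_def
      by (intro degree_add_le degree_sum_le order.trans[OF degree_smult_le]) 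
        (auto intro: order.trans[OF degree_dickson(2)])
    show "d \<le> degree g" using coeff_g by (intro le_degree) simp
  qed
  define h where "h = pcompose g [:2, -1:]"
  have h_root: "poly (of_int_poly h) \<pi> = 0"
    using g_root by (simp add: h_def of_int_hom.map_poly_pcompose poly_pcompose \<pi>_def of_int_hom.map_poly_pCons_hom)
  have deg_h: "degree h = d" by (simp add: h_def deg_g)
  have lc_h: "\<bar>lead_coeff h\<bar> = 1"
    unfolding h_def by (subst lead_coeff_comp) (simp_all add: deg_g coeff_g abs_mult power_abs)
  show ?thesis by (rule that[OF deg_h lc_h h_root])
qed

text \<open>Total ramification: \<pi> is a unit times \<open>lam\<close>^2, so \<pi>^d is a unit
  times p, where 2 d = p^k (p - 1). That K lies in \<open>int_fractions \<tau>\<close> supplies the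
  polynomial expressions from which the residue ring is computed.\<close>

lemma ramified:
  assumes z: "primitive_root_of_unity (p ^ Suc k) \<zeta>" and p: "prime p" and q3: "p ^ Suc k \<ge> 3"
    and K: "K \<subseteq> int_fractions \<tau>"
  shows "\<exists>N. ramified_rotation_field K \<zeta> p N"
proof -
  have p2: "p \<ge> 2" using p prime_ge_2_nat by blast
  define r where "r = p ^ k"
  have r: "r > 0" using p2 by (simp add: r_def)
  have "even (r * (p - 1))"
  proof (cases "p = 2")
    case True
    then have "k > 0" using q3 by (cases k) auto
    then show ?thesis using True by (simp add: r_def)
  qed (use p prime_odd_nat[of p] p2 in auto)
  then obtain d where d: "r * (p - 1) = 2 * d" by blast
  have d0: "d > 0" using d r p2 by (intro Nat.gr0I) auto
  have pr: "p ^ Suc k = p * r" by (simp add: r_def)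
  have pow: "\<zeta> ^ j = 1 \<longleftrightarrow> p * r dvd j" for j
    using primitive_root_power_eq_1_iff[OF z[unfolded pr]] p2 r by simp
  have z0: "\<zeta> \<noteq> 0" using z_cnj by auto
  have pnz: "(of_nat p :: complex) \<noteq> 0" using p2 by simp
  have "cnj lam = - cnj \<zeta> * lam" using z_cnj by (simp add: lam_def algebra_simps)
  then have pi_lam: "\<pi> = - cnj \<zeta> * lam\<^sup>2" by (simp add: pi_eq power2_eq_square)
  have pi_d: "\<pi> ^ d = (- cnj \<zeta>) ^ d * lam ^ (p ^ k * (p - 1))"
    unfolding pi_lam power_mult_distrib using d by (simp add: r_def flip: power_mult)
  have lam_d: "lam ^ (p ^ k * (p - 1)) = (- \<zeta>) ^ d * \<pi> ^ d"
  proof -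
    have "(- \<zeta>) ^ d * (- cnj \<zeta>) ^ d = 1" using z_cnj by (simp flip: power_mult_distrib)
    then show ?thesis unfolding pi_d by (simp flip: mult.assoc)
  qed
  have lam0: "lam \<noteq> 0" using pow[of 1] q3 pr by (auto simp: lam_def)
  have pi0: "\<pi> \<noteq> 0" using pi_lam lam0 z_cnj by auto
  note assoc = one_minus_primitive_root_power_associated[OF z p, folded lam_def]
  have p_div: "algebraic_int (of_nat p / \<pi> ^ d)"
  proof -
    have "of_nat p / \<pi> ^ d = (- \<zeta>) ^ d * (of_nat p / lam ^ (p ^ k * (p - 1)))"
      unfolding lam_d using z0 pi0 by simp
    then show ?thesis using assoc(1) z_algebraic_int by (simp only: algebraic_int_intros)
  qed
  have pi_div: "algebraic_int (\<pi> ^ d / of_nat p)"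
  proof -
    have "\<pi> ^ d / of_nat p = (- cnj \<zeta>) ^ d * (lam ^ (p ^ k * (p - 1)) / of_nat p)" by (simp add: pi_d)
    also have "algebraic_int \<dots>"
      by (intro algebraic_int_times algebraic_int_power algebraic_int_minus algebraic_int_cnj assoc(2) z_algebraic_int)
    finally show ?thesis .
  qed
  have piO: "\<pi> \<in> \<O>" unfolding \<pi>_def using tau_O O_of_int[of 2] by auto
  then have pi_alg: "algebraic_int \<pi>" by (rule O_algebraic_int)
  \<comment> \<open>A unit \<pi> would make 1 / p an algebraic integer, since \<pi>^d is associated
    with p.\<close>
  have nonunit: "\<not> algebraic_int (1 / \<pi>)"
  proof
    assume "algebraic_int (1 / \<pi>)"
    then have "algebraic_int (\<pi> ^ d / of_nat p * (1 / \<pi>) ^ d)"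
      by (intro algebraic_int_times algebraic_int_power pi_div)
    then have "algebraic_int (1 / of_nat p :: complex)" using pi0 by (simp add: power_divide)
    then have "(1 / of_nat p :: complex) \<in> \<int>" by (rule rational_algebraic_int_is_int) simp
    then obtain m where "1 / of_nat p = (of_int m :: complex)" by (auto elim: Ints_cases)
    then have "(1 :: complex) = of_int (m * int p)" using pnz by (simp add: field_simps)
    then have "m * int p = 1" by (metis of_int_1 of_int_eq_iff)
    then show False using p2 by (auto simp: zmult_eq_1_iff)
  qed
  obtain h :: "int poly" where deg_h: "degree h = d" and lc_h: "\<bar>lead_coeff h\<bar> = 1"
    and h_root: "poly (of_int_poly h) \<pi> = 0"
    using pi_annihilator[OF z[unfolded pr] p r d d0] by blast
  have residue: "\<exists>j. (x - of_int j) / \<pi> \<in> \<O>" if xO: "x \<in> \<O>" for x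
  proof -
    obtain m F where F: "m \<noteq> 0" "of_int m * x = poly (of_int_poly F) \<tau>"
      using K O_mem[OF xO] unfolding int_fractions_def by blast
    have "poly (of_int_poly F) \<tau> = poly (of_int_poly (pcompose F [:2, -1:])) \<pi>"
      by (simp add: of_int_hom.map_poly_pcompose poly_pcompose \<pi>_def of_int_hom.map_poly_pCons_hom)
    moreover obtain R where "degree R < d"
      "poly (of_int_poly (pcompose F [:2, -1:])) \<pi> = poly (of_int_poly R) \<pi>"
      using poly_reduce_monic[OF h_root deg_h d0 lc_h] by blast
    ultimately have "degree R < d" "of_int m * x = poly (of_int_poly R) \<pi>" using F by auto
    then obtain j where "algebraic_int ((x - of_int j) / \<pi>)"
      using eisenstein_residue[OF pi_alg nonunit p d0 p_div _ O_algebraic_int[OF xO] _ F(1)] by blast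
    moreover have "(x - of_int j) / \<pi> \<in> K" for j using xO piO O_mem by blast
    ultimately show ?thesis by (blast intro: OI)
  qed
  have sep: "\<exists>j. x / \<pi> ^ j \<notin> \<O>" if x: "x \<in> \<O>" "x \<noteq> 0" for x
  proof (rule ccontr)
    assume "\<not> ?thesis"
    then have all: "x / \<pi> ^ j \<in> \<O>" for j by blast
    obtain M y where M: "M \<noteq> (0::int)" "y \<in> \<O>" "x * y = of_int M" by (rule O_dvd_int[OF x])
    \<comment> \<open>x divides the integer M, so p^j would divide M for every j; this j already
      makes p^j exceed the absolute value of M.\<close>
    define j where "j = nat \<bar>M\<bar>"
    have "of_int M / of_nat p ^ j = (x / \<pi> ^ (d * j)) * y * (\<pi> ^ d / of_nat p) ^ j"
      using pi0 by (simp add: power_divide power_mult flip: M(3))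
    also have "algebraic_int \<dots>"
      by (intro algebraic_int_times algebraic_int_power pi_div O_algebraic_int all M(2))
    finally have "algebraic_int (of_int M / of_nat p ^ j :: complex)" .
    then have "(of_int M / of_nat p ^ j :: complex) \<in> \<int>" by (rule rational_algebraic_int_is_int) simp
    then obtain m where "of_int M / of_nat p ^ j = (of_int m :: complex)" by (auto elim: Ints_cases)
    then have "(of_int M :: complex) = of_int (m * int p ^ j)" using pnz by (simp add: field_simps)
    then have Mm: "M = m * int p ^ j" by (metis of_int_eq_iff)
    then have "\<bar>M\<bar> \<ge> int p ^ j" using M(1) by (auto simp: abs_mult mult_le_cancel_right1)
    moreover have "int p ^ j \<ge> 2 ^ j" using p2 by (intro power_mono) auto
    moreover have "(2::int) ^ j > int j" by (metis of_nat_less_two_power)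
    ultimately show False using j_def by simp
  qed
  \<comment> \<open>\<zeta>^2 is a q-th root of unity other than 1, so 1 - \<zeta>^2 divides q =
    p^(k + 1) and the discriminant divides q^2. As p divides \<pi>^d, the exponent 2 d (k + 1) is
    enough.\<close>
  define q where "q = p * r"
  have "algebraic_int (of_nat q / (1 - \<zeta>\<^sup>2))"
  proof (rule algebraic_int_order_div)
    show "(\<zeta>\<^sup>2) ^ q = 1" using pow[of "2 * q"] by (simp add: q_def flip: power_mult)
    show "\<zeta>\<^sup>2 \<noteq> 1" by (rule z_sq_ne_one)
    show "q > 0" using p2 r by (simp add: q_def)
  qed
  then have "algebraic_int ((\<zeta> * (of_nat q / (1 - \<zeta>\<^sup>2)))\<^sup>2)"
    using z_algebraic_int by (intro algebraic_int_power algebraic_int_times)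
  also have "(\<zeta> * (of_nat q / (1 - \<zeta>\<^sup>2)))\<^sup>2 = of_nat q ^ 2 / (\<tau>\<^sup>2 - 4)"
  proof -
    have "\<zeta> = inverse (cnj \<zeta>)" using z_cnj by (metis inverse_unique mult.commute)
    then have "\<zeta> * (of_nat q / (1 - \<zeta>\<^sup>2)) = of_nat q / (cnj \<zeta> * (1 - \<zeta>\<^sup>2))"
      by (metis divide_divide_eq_left divide_inverse mult.commute)
    then show ?thesis by (simp add: disc_eq power_divide)
  qed
  finally have "algebraic_int (of_nat q ^ 2 / (\<tau>\<^sup>2 - 4))" .
  then have "algebraic_int ((\<pi> ^ d / of_nat p) ^ (2 * Suc k) * (of_nat q ^ 2 / (\<tau>\<^sup>2 - 4)))"
    by (intro algebraic_int_times algebraic_int_power pi_div)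
  also have "(\<pi> ^ d / of_nat p) ^ (2 * Suc k) * (of_nat q ^ 2 / (\<tau>\<^sup>2 - 4)) = \<pi> ^ (d * (2 * Suc k)) / (\<tau>\<^sup>2 - 4)"
  proof -
    have "(of_nat q ^ 2 :: complex) = of_nat p ^ (2 * Suc k)"
      by (simp add: q_def r_def power_mult mult.commute[of 2] flip: of_nat_power power_mult power_Suc)
    then show ?thesis using pnz by (simp add: power_divide del: power_Suc flip: power_mult)
  qed
  finally have "algebraic_int (\<pi> ^ (d * (2 * Suc k)) / (\<tau>\<^sup>2 - 4))" .
  then have disc: "\<pi> ^ (d * (2 * Suc k)) / (\<tau>\<^sup>2 - 4) \<in> \<O>"
    using piO tau_O O_mem of_int_mem[of 4] by (intro OI divide_mem power_mem diff_mem) auto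
  have pdiv1: "of_nat p / \<pi> \<in> \<O>"
  proof (rule OI)
    have "\<pi> ^ d = \<pi> * \<pi> ^ (d - 1)" using d0 by (cases d) auto
    then have "of_nat p / \<pi> = of_nat p / \<pi> ^ d * \<pi> ^ (d - 1)" using pi0 by simp
    also have "algebraic_int \<dots>" by (intro algebraic_int_times algebraic_int_power p_div pi_alg)
    finally show "algebraic_int (of_nat p / \<pi>)" .
  qed (use piO O_mem in auto)
  have "ramified_rotation_field K \<zeta> p (d * (2 * Suc k))"
  proof
    show "prime p" by (rule p)
    show "inverse \<pi> \<notin> \<O>" using nonunit O_algebraic_int by (auto simp: inverse_eq_divide)
  qed (use pdiv1 residue sep disc in auto)
  then show ?thesis by blast
qed

end


section \<open>Representations of the dihedral group\<close>

text \<open>What makes the 2 x 2 matrices over R a monoid, stated so that K and its ring of integers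
  can be handled alike.\<close>

definition semiring_set :: "complex set \<Rightarrow> bool" where
  "semiring_set R \<longleftrightarrow> 0 \<in> R \<and> 1 \<in> R \<and> (\<forall>x\<in>R. \<forall>y\<in>R. x + y \<in> R \<and> x * y \<in> R)"

lemma GL2_simps:
  "mult (GL2 R) = (**)" "one (GL2 R) = mat 1"
  by (simp_all add: GL2_def units_of_def)

lemma GL2_carrier:
  "A \<in> carrier (GL2 R) \<longleftrightarrow> (\<forall>i j. A $ i $ j \<in> R) \<and> (\<exists>B. (\<forall>i j. B $ i $ j \<in> R) \<and> A ** B = mat 1)"
  unfolding GL2_def units_of_def Units_def by (auto simp: matrix_left_right_inverse)

lemma GL2_entry: "A \<in> carrier (GL2 R) \<Longrightarrow> A $ i $ j \<in> R"
  by (simp add: GL2_carrier)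

lemma group_GL2:
  assumes "semiring_set R"
  shows "group (GL2 R)"
proof -
  define M :: "(complex^2^2) monoid" where
    "M = \<lparr>carrier = {A. \<forall>i j. A $ i $ j \<in> R}, mult = (**), one = mat 1\<rparr>"
  have "monoid M"
  proof (rule monoidI)
    show "A \<otimes>\<^bsub>M\<^esub> B \<in> carrier M" if "A \<in> carrier M" "B \<in> carrier M" for A B
      using assms that by (auto simp: M_def matrix_matrix_mult_def sum_2 semiring_set_def)
    show "\<one>\<^bsub>M\<^esub> \<in> carrier M" using assms by (simp add: M_def mat_def semiring_set_def)
  qed (auto simp: M_def matrix_mul_assoc)
  then show ?thesis unfolding GL2_def M_def by (rule monoid.units_group)
qed

lemma GL2_mono: "R \<subseteq> S \<Longrightarrow> A \<in> carrier (GL2 R) \<Longrightarrow> A \<in> carrier (GL2 S)"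
  unfolding GL2_carrier by blast

lemma hom_GL2_mono:
  assumes "R \<subseteq> S" "\<phi> \<in> hom G (GL2 R)"
  shows "\<phi> \<in> hom G (GL2 S)"
  using assms GL2_mono[OF assms(1)] unfolding hom_def by (auto simp: GL2_simps Pi_iff)

lemma vector_matrix_2:
  fixes v :: "complex^2"
  shows "(v v* A) $ j = v $ 1 * A $ 1 $ j + v $ 2 * A $ 2 $ j"
  by (simp add: vector_matrix_mult_def sum_2)

text \<open>The intertwining relation passes to products, so checking the generators
  suffices.\<close>

lemma hom_dihedral_intertwine:
  assumes n: "n > 0" and gH: "group H" and \<phi>: "\<phi> \<in> hom (dihedral n) H" and \<psi>: "\<psi> \<in> hom (dihedral n) H"
    and P: "P \<in> carrier H"
    and a: "\<psi> (dih_a n) \<otimes>\<^bsub>H\<^esub> P = P \<otimes>\<^bsub>H\<^esub> \<phi> (dih_a n)"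
    and b: "\<psi> dih_b \<otimes>\<^bsub>H\<^esub> P = P \<otimes>\<^bsub>H\<^esub> \<phi> dih_b"
    and g: "g \<in> carrier (dihedral n)"
  shows "\<psi> g = P \<otimes>\<^bsub>H\<^esub> \<phi> g \<otimes>\<^bsub>H\<^esub> inv\<^bsub>H\<^esub> P"
proof -
  let ?G = "dihedral n"
  interpret G: group ?G by (rule group_dihedral[OF n])
  interpret H: group H by (rule gH)
  interpret \<phi>: group_hom ?G H \<phi> by (unfold_locales) (rule \<phi>)
  interpret \<psi>: group_hom ?G H \<psi> by (unfold_locales) (rule \<psi>)
  have car: "dih_a n \<in> carrier ?G" "dih_b \<in> carrier ?G" using dihedral_relations[OF n] by auto
  have mult: "\<psi> (x \<otimes>\<^bsub>?G\<^esub> y) \<otimes>\<^bsub>H\<^esub> P = P \<otimes>\<^bsub>H\<^esub> \<phi> (x \<otimes>\<^bsub>?G\<^esub> y)"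
    if "x \<in> carrier ?G" "y \<in> carrier ?G" "\<psi> x \<otimes>\<^bsub>H\<^esub> P = P \<otimes>\<^bsub>H\<^esub> \<phi> x" "\<psi> y \<otimes>\<^bsub>H\<^esub> P = P \<otimes>\<^bsub>H\<^esub> \<phi> y" for x y
  proof -
    have "\<psi> (x \<otimes>\<^bsub>?G\<^esub> y) \<otimes>\<^bsub>H\<^esub> P = \<psi> x \<otimes>\<^bsub>H\<^esub> (P \<otimes>\<^bsub>H\<^esub> \<phi> y)" using that P by (simp add: H.m_assoc)
    also have "\<dots> = P \<otimes>\<^bsub>H\<^esub> \<phi> (x \<otimes>\<^bsub>?G\<^esub> y)" using that P by (simp flip: H.m_assoc)
    finally show ?thesis .
  qed
  have one: "\<psi> \<one>\<^bsub>?G\<^esub> \<otimes>\<^bsub>H\<^esub> P = P \<otimes>\<^bsub>H\<^esub> \<phi> \<one>\<^bsub>?G\<^esub>" using P by simp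
  have pow: "\<psi> (dih_a n [^]\<^bsub>?G\<^esub> k) \<otimes>\<^bsub>H\<^esub> P = P \<otimes>\<^bsub>H\<^esub> \<phi> (dih_a n [^]\<^bsub>?G\<^esub> k)" for k :: nat
  proof (induction k)
    case 0 then show ?case using one by simp
  next
    case (Suc k)
    then show ?case using mult[of "dih_a n [^]\<^bsub>?G\<^esub> k" "dih_a n"] car a by simp
  qed
  obtain i s where gis: "g = (i, s)" by (cases g)
  have "\<psi> g \<otimes>\<^bsub>H\<^esub> P = P \<otimes>\<^bsub>H\<^esub> \<phi> g"
    unfolding gis dihedral_normal_form[OF g[unfolded gis]]
    by (rule mult) (use car b one pow in auto)
  then have "\<psi> g \<otimes>\<^bsub>H\<^esub> P \<otimes>\<^bsub>H\<^esub> inv\<^bsub>H\<^esub> P = P \<otimes>\<^bsub>H\<^esub> \<phi> g \<otimes>\<^bsub>H\<^esub> inv\<^bsub>H\<^esub> P" by simp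
  then show ?thesis using P g by (simp add: H.m_assoc)
qed

lemma conjugate_homs_equiv:
  assumes H: "group H"
  shows conjugate_homs_refl: "\<phi> \<in> hom G H \<Longrightarrow> conjugate_homs G H \<phi> \<phi>"
    and conjugate_homs_sym: "\<phi> \<in> hom G H \<Longrightarrow> conjugate_homs G H \<phi> \<psi> \<Longrightarrow> conjugate_homs G H \<psi> \<phi>"
    and conjugate_homs_trans: "\<phi> \<in> hom G H \<Longrightarrow> conjugate_homs G H \<phi> \<psi> \<Longrightarrow> conjugate_homs G H \<psi> \<theta> \<Longrightarrow>
      conjugate_homs G H \<phi> \<theta>"
proof -
  interpret H: group H by fact
  show "conjugate_homs G H \<phi> \<phi>" if "\<phi> \<in> hom G H"
    unfolding conjugate_homs_def using that
    by (intro bexI[of _ "\<one>\<^bsub>H\<^esub>"]) (auto simp: hom_def Pi_iff)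
  show "conjugate_homs G H \<psi> \<phi>" if \<phi>: "\<phi> \<in> hom G H" and c: "conjugate_homs G H \<phi> \<psi>"
  proof -
    obtain P where P: "P \<in> carrier H" "\<And>g. g \<in> carrier G \<Longrightarrow> \<psi> g = P \<otimes>\<^bsub>H\<^esub> \<phi> g \<otimes>\<^bsub>H\<^esub> inv\<^bsub>H\<^esub> P"
      using c unfolding conjugate_homs_def by blast
    have "\<phi> g = inv\<^bsub>H\<^esub> P \<otimes>\<^bsub>H\<^esub> \<psi> g \<otimes>\<^bsub>H\<^esub> inv\<^bsub>H\<^esub> (inv\<^bsub>H\<^esub> P)" if g: "g \<in> carrier G" for g
    proof -
      have \<phi>g: "\<phi> g \<in> carrier H" using \<phi> g by (auto simp: hom_def)
      then have "inv\<^bsub>H\<^esub> P \<otimes>\<^bsub>H\<^esub> (P \<otimes>\<^bsub>H\<^esub> \<phi> g \<otimes>\<^bsub>H\<^esub> inv\<^bsub>H\<^esub> P) \<otimes>\<^bsub>H\<^esub> P =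
          (inv\<^bsub>H\<^esub> P \<otimes>\<^bsub>H\<^esub> P) \<otimes>\<^bsub>H\<^esub> \<phi> g \<otimes>\<^bsub>H\<^esub> (inv\<^bsub>H\<^esub> P \<otimes>\<^bsub>H\<^esub> P)"
        using P(1) by (simp only: H.m_assoc H.m_closed H.inv_closed)
      then show ?thesis using P \<phi>g g by simp
    qed
    then show ?thesis unfolding conjugate_homs_def using P(1) by blast
  qed
  show "conjugate_homs G H \<phi> \<theta>" if \<phi>: "\<phi> \<in> hom G H" and c: "conjugate_homs G H \<phi> \<psi>" "conjugate_homs G H \<psi> \<theta>"
  proof -
    obtain P where P: "P \<in> carrier H" "\<And>g. g \<in> carrier G \<Longrightarrow> \<psi> g = P \<otimes>\<^bsub>H\<^esub> \<phi> g \<otimes>\<^bsub>H\<^esub> inv\<^bsub>H\<^esub> P"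
      using c unfolding conjugate_homs_def by blast
    obtain Q where Q: "Q \<in> carrier H" "\<And>g. g \<in> carrier G \<Longrightarrow> \<theta> g = Q \<otimes>\<^bsub>H\<^esub> \<psi> g \<otimes>\<^bsub>H\<^esub> inv\<^bsub>H\<^esub> Q"
      using c unfolding conjugate_homs_def by blast
    have "\<theta> g = (Q \<otimes>\<^bsub>H\<^esub> P) \<otimes>\<^bsub>H\<^esub> \<phi> g \<otimes>\<^bsub>H\<^esub> inv\<^bsub>H\<^esub> (Q \<otimes>\<^bsub>H\<^esub> P)" if g: "g \<in> carrier G" for g
    proof -
      have \<phi>g: "\<phi> g \<in> carrier H" using \<phi> g by (auto simp: hom_def)
      then show ?thesis using P Q g by (simp add: H.inv_mult_group H.m_assoc)
    qed
    then show ?thesis unfolding conjugate_homs_def using P(1) Q(1) by blast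
  qed
qed

lemma (in number_field) semiring_sets: "semiring_set K" "semiring_set \<O>"
  by (auto simp: semiring_set_def)

section \<open>Frames and the lattices they span\<close>

context rotation_field
begin

text \<open>The entries of a frame form a \<open>K\<close>-basis of \<open>K(\<zeta>)\<close> in which \<open>\<phi> a\<close> is the matrix of multiplication by
  \<open>\<zeta>\<close> and \<open>\<phi> b\<close> that of complex conjugation.\<close>

definition frame :: "nat \<Rightarrow> (int \<times> bool \<Rightarrow> complex^2^2) \<Rightarrow> complex^2 \<Rightarrow> bool" where
  "frame n \<phi> f \<longleftrightarrow> (\<forall>j. f $ j \<in> ext K) \<and>
     (\<forall>s\<in>K. \<forall>t\<in>K. f $ 1 * s + f $ 2 * t = 0 \<longrightarrow> s = 0 \<and> t = 0) \<and>
     f v* \<phi> (dih_a n) = \<zeta> *s f \<and> f v* \<phi> dih_b = (\<chi> j. cnj (f $ j))"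

text \<open>For R = \<open>\<O>\<close> this is the lattice attached to an integral form; for R = K
  it is all of K(\<zeta>). The parameter lets conjugacy over K and over \<open>\<O>\<close> be
  treated together.\<close>

definition lat :: "complex set \<Rightarrow> complex^2 \<Rightarrow> complex set" where
  "lat R f = {f $ 1 * s + f $ 2 * t | s t. s \<in> R \<and> t \<in> R}"

lemma latticeI: "s \<in> R \<Longrightarrow> t \<in> R \<Longrightarrow> f $ 1 * s + f $ 2 * t \<in> lat R f"
  unfolding lat_def by blast

lemma lattice_base: "semiring_set R \<Longrightarrow> f $ j \<in> lat R f"
  using latticeI[of 1 R 0 f] latticeI[of 0 R 1 f] exhaust_2[of j]
  by (auto simp: semiring_set_def)

lemma independent_cancel:
  assumes indep: "\<forall>s\<in>K. \<forall>t\<in>K. f $ 1 * s + f $ 2 * t = 0 \<longrightarrow> s = 0 \<and> t = 0"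
    and A: "\<And>i j. A $ i $ j \<in> K" and B: "\<And>i j. B $ i $ j \<in> K"
    and eq: "f v* A = f v* (B :: complex^2^2)"
  shows "A = B"
proof -
  have "A $ 1 $ j = B $ 1 $ j \<and> A $ 2 $ j = B $ 2 $ j" for j
  proof -
    have "(f v* A) $ j = (f v* B) $ j" by (simp add: eq)
    then have "f $ 1 * (A $ 1 $ j - B $ 1 $ j) + f $ 2 * (A $ 2 $ j - B $ 2 $ j) = 0"
      by (simp add: vector_matrix_2 algebra_simps)
    then show ?thesis using indep diff_mem[OF A B] by (metis right_minus_eq)
  qed
  then show ?thesis by (simp add: vec_eq_iff forall_2)
qed

lemma lattice_ext:
  assumes f: "\<forall>j. f $ j \<in> ext K"
    and indep: "\<forall>s\<in>K. \<forall>t\<in>K. f $ 1 * s + f $ 2 * t = 0 \<longrightarrow> s = 0 \<and> t = 0"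
  shows "lat K f = ext K"
proof (intro equalityI subsetI)
  obtain a c where f1: "f $ 1 = a + c * \<zeta>" "a \<in> K" "c \<in> K" using f unfolding ext_def by blast
  obtain b d where f2: "f $ 2 = b + d * \<zeta>" "b \<in> K" "d \<in> K" using f unfolding ext_def by blast
  define D where "D = a * d - b * c"
  have D: "D \<noteq> 0"
  proof
    assume 0: "D = 0"
    then have z: "f $ 1 * d + f $ 2 * (- c) = 0" "f $ 1 * b + f $ 2 * (- a) = 0"
      by (simp_all add: f1 f2 D_def algebra_simps)
    have "d = 0" "- c = 0" using indep[rule_format, OF _ _ z(1)] f1 f2 by auto
    moreover have "b = 0" "- a = 0" using indep[rule_format, OF _ _ z(2)] f1 f2 by auto
    ultimately show False using indep[rule_format, of 1 0] f1 by auto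
  qed
  fix u
  show "u \<in> ext K" if u: "u \<in> lat K f"
  proof -
    obtain s t where st: "u = f $ 1 * s + f $ 2 * t" "s \<in> K" "t \<in> K" using u unfolding lat_def by blast
    have "u = (a * s + b * t) + (c * s + d * t) * \<zeta>" by (simp add: st f1 f2 algebra_simps)
    then show ?thesis using st f1 f2 by (auto intro: extI)
  qed
  show "u \<in> lat K f" if u: "u \<in> ext K"
  proof -
    obtain x y where xy: "u = x + y * \<zeta>" "x \<in> K" "y \<in> K" using u unfolding ext_def by blast
    define s where "s = (x * d - b * y) / D"
    define t where "t = (a * y - c * x) / D"
    have st: "s \<in> K" "t \<in> K" using xy f1 f2 unfolding s_def t_def D_def by auto
    have "D * (f $ 1 * s + f $ 2 * t) = D * u"
      using D by (simp add: s_def t_def f1 f2 xy distrib_left) (simp add: D_def algebra_simps)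
    then have "u = f $ 1 * s + f $ 2 * t" using D by simp
    then show ?thesis using st latticeI by metis
  qed
qed

lemma lattice_matrix:
  assumes "\<And>j. h' $ j \<in> lat R h"
  obtains U :: "complex^2^2" where "\<forall>i j. U $ i $ j \<in> R" "h' = h v* U"
proof -
  have "\<exists>s t. h' $ j = h $ 1 * s + h $ 2 * t \<and> s \<in> R \<and> t \<in> R" for j
    using assms[of j] unfolding lat_def by blast
  then obtain s t where st: "\<And>j. h' $ j = h $ 1 * s j + h $ 2 * t j" "\<And>j. s j \<in> R" "\<And>j. t j \<in> R" by metis
  define U :: "complex^2^2" where "U = (\<chi> i j. if i = 1 then s j else t j)"
  have "h' = h v* U" by (simp add: vec_eq_iff vector_matrix_2 U_def st(1))
  moreover have "\<forall>i j. U $ i $ j \<in> R" by (simp add: U_def st)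
  ultimately show ?thesis using that by blast
qed

lemma change_of_frame:
  assumes R: "semiring_set R" "R \<subseteq> K"
    and f: "\<forall>s\<in>K. \<forall>t\<in>K. f $ 1 * s + f $ 2 * t = 0 \<longrightarrow> s = 0 \<and> t = 0"
    and sub: "\<And>j. f' $ j \<in> lat R f" "\<And>j. f $ j \<in> lat R f'"
  obtains U where "U \<in> carrier (GL2 R)" "f' = f v* U"
proof -
  obtain U :: "complex^2^2" where U: "\<forall>i j. U $ i $ j \<in> R" "f' = f v* U" using lattice_matrix[OF sub(1)] .
  obtain V :: "complex^2^2" where V: "\<forall>i j. V $ i $ j \<in> R" "f = f' v* V" using lattice_matrix[OF sub(2)] .
  have UVR: "(U ** V) $ i $ j \<in> R" for i j
    using U V R by (simp add: matrix_matrix_mult_def sum_2 semiring_set_def)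
  have "U ** V = mat 1"
  proof (rule independent_cancel[OF f])
    show "f v* (U ** V) = f v* mat 1" using U(2) V(2) by (simp flip: vector_matrix_mul_assoc)
    show "(U ** V) $ i $ j \<in> K" for i j using UVR R by blast
    show "(mat 1 :: complex^2^2) $ i $ j \<in> K" for i j by (simp add: mat_def)
  qed
  then have "U \<in> carrier (GL2 R)" using U V unfolding GL2_carrier by blast
  then show ?thesis using that U by blast
qed

text \<open>Equal spans give a change of basis in \<open>GL2 R\<close>. It intertwines the two
  actions because both products agree after applying f, and f can be cancelled by
  K-independence.\<close>

lemma frames_conjugate:
  assumes n: "n > 0" and R: "semiring_set R" "R \<subseteq> K"
    and \<phi>: "\<phi> \<in> hom (dihedral n) (GL2 R)" "frame n \<phi> f"
    and \<phi>': "\<phi>' \<in> hom (dihedral n) (GL2 R)" "frame n \<phi>' f'"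
    and sub: "\<And>j. f' $ j \<in> lat R f" "\<And>j. f $ j \<in> lat R f'"
  shows "conjugate_homs (dihedral n) (GL2 R) \<phi> \<phi>'"
proof -
  interpret H: group "GL2 R" by (rule group_GL2[OF R(1)])
  have indep: "\<forall>s\<in>K. \<forall>t\<in>K. f $ 1 * s + f $ 2 * t = 0 \<longrightarrow> s = 0 \<and> t = 0"
    using \<phi>(2) by (simp add: frame_def)
  obtain U where U: "U \<in> carrier (GL2 R)" "f' = f v* U"
    using change_of_frame[OF R indep sub] by blast
  have ab: "dih_a n \<in> carrier (dihedral n)" "dih_b \<in> carrier (dihedral n)"
    using dihedral_relations[OF n] by auto
  have car: "\<phi> g \<in> carrier (GL2 R)" "\<phi>' g \<in> carrier (GL2 R)" if "g \<in> carrier (dihedral n)" for g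
    using \<phi>(1) \<phi>'(1) that by (auto simp: hom_def)
  have cancel: "A = B" if "A \<in> carrier (GL2 R)" "B \<in> carrier (GL2 R)" "f v* A = f v* B" for A B
    using independent_cancel[OF indep _ _ that(3)] GL2_entry that R by blast
  have 1: "\<phi> (dih_a n) ** U = U ** \<phi>' (dih_a n)"
  proof (rule cancel)
    show "\<phi> (dih_a n) ** U \<in> carrier (GL2 R)" "U ** \<phi>' (dih_a n) \<in> carrier (GL2 R)"
      using H.m_closed[OF _ U(1)] H.m_closed[OF U(1)] car ab by (simp_all add: GL2_simps)
    have "f v* (\<phi> (dih_a n) ** U) = \<zeta> *s f'"
      using \<phi>(2) by (simp add: frame_def U(2) scalar_vector_matrix_assoc flip: vector_matrix_mul_assoc)
    also have "\<dots> = f v* (U ** \<phi>' (dih_a n))"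
      using \<phi>'(2) by (simp add: frame_def flip: vector_matrix_mul_assoc U(2))
    finally show "f v* (\<phi> (dih_a n) ** U) = f v* (U ** \<phi>' (dih_a n))" .
  qed
  have 2: "\<phi> dih_b ** U = U ** \<phi>' dih_b"
  proof (rule cancel)
    show "\<phi> dih_b ** U \<in> carrier (GL2 R)" "U ** \<phi>' dih_b \<in> carrier (GL2 R)"
      using H.m_closed[OF _ U(1)] H.m_closed[OF U(1)] car ab by (simp_all add: GL2_simps)
    have "cnj (U $ i $ j) = U $ i $ j" for i j using GL2_entry[OF U(1)] R cnj_mem by blast
    then have "f v* (\<phi> dih_b ** U) = (\<chi> j. cnj (f' $ j))"
      using \<phi>(2) by (simp add: frame_def U(2) vec_eq_iff vector_matrix_2 flip: vector_matrix_mul_assoc)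
    also have "\<dots> = f v* (U ** \<phi>' dih_b)"
      using \<phi>'(2) by (simp add: frame_def flip: vector_matrix_mul_assoc U(2))
    finally show "f v* (\<phi> dih_b ** U) = f v* (U ** \<phi>' dih_b)" .
  qed
  have "\<phi> g = U ** \<phi>' g ** inv\<^bsub>GL2 R\<^esub> U" if "g \<in> carrier (dihedral n)" for g
    using hom_dihedral_intertwine[OF n H.is_group \<phi>'(1) \<phi>(1) U(1) _ _ that] 1 2 by (simp add: GL2_simps)
  then have "conjugate_homs (dihedral n) (GL2 R) \<phi>' \<phi>"
    unfolding conjugate_homs_def GL2_simps using U(1) by blast
  then show ?thesis using conjugate_homs_sym[OF H.is_group \<phi>'(1)] by blast
qed

text \<open>If P conjugates \<phi> to \<phi>', the frame is multiplied by the inverse of P, which is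
  invertible over R and so preserves the span.\<close>

lemma frame_conjugate:
  assumes R: "semiring_set R" "R \<subseteq> K" and n: "n > 0"
    and \<phi>: "\<phi> \<in> hom (dihedral n) (GL2 R)" "frame n \<phi> f"
    and c: "conjugate_homs (dihedral n) (GL2 R) \<phi> \<phi>'"
  obtains f' where "frame n \<phi>' f'" "lat R f' = lat R f"
proof -
  interpret H: group "GL2 R" by (rule group_GL2[OF R(1)])
  obtain P where P: "P \<in> carrier (GL2 R)" "\<forall>g\<in>carrier (dihedral n). \<phi>' g = P ** \<phi> g ** inv\<^bsub>GL2 R\<^esub> P"
    using c unfolding conjugate_homs_def GL2_simps by blast
  define Q where "Q = inv\<^bsub>GL2 R\<^esub> P"
  have Q: "Q \<in> carrier (GL2 R)" "Q ** P = mat 1" "P ** Q = mat 1"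
    using P(1) H.l_inv[OF P(1)] H.r_inv[OF P(1)] by (auto simp: Q_def GL2_simps)
  have PR: "P $ i $ j \<in> R" "Q $ i $ j \<in> R" for i j using GL2_entry P(1) Q(1) by auto
  define f' where "f' = f v* Q"
  have ff: "f = f' v* P" by (simp add: f'_def vector_matrix_mul_assoc Q)
  have sub: "lat R (h v* V) \<subseteq> lat R h" if "\<And>i j. V $ i $ j \<in> R" for h and V :: "complex^2^2"
  proof
    fix u assume "u \<in> lat R (h v* V)"
    then obtain s t where st: "u = (h v* V) $ 1 * s + (h v* V) $ 2 * t" "s \<in> R" "t \<in> R"
      unfolding lat_def by blast
    have "u = h $ 1 * (V $ 1 $ 1 * s + V $ 1 $ 2 * t) + h $ 2 * (V $ 2 $ 1 * s + V $ 2 $ 2 * t)"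
      by (simp add: st vector_matrix_2 algebra_simps)
    moreover have "V $ 1 $ 1 * s + V $ 1 $ 2 * t \<in> R" "V $ 2 $ 1 * s + V $ 2 $ 2 * t \<in> R"
      using R(1) st that by (simp_all add: semiring_set_def)
    ultimately show "u \<in> lat R h" using latticeI by metis
  qed
  have lat: "lat R f' = lat R f"
  proof
    show "lat R f' \<subseteq> lat R f" unfolding f'_def by (rule sub[OF PR(2)])
    show "lat R f \<subseteq> lat R f'" by (subst ff) (rule sub[OF PR(1)])
  qed
  have indep: "\<forall>s\<in>K. \<forall>t\<in>K. f $ 1 * s + f $ 2 * t = 0 \<longrightarrow> s = 0 \<and> t = 0" and fK: "\<forall>j. f $ j \<in> ext K"
    using \<phi>(2) by (simp_all add: frame_def)
  have "f' $ j \<in> ext K" for j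
  proof -
    have "f' $ j = f $ 1 * Q $ 1 $ j + f $ 2 * Q $ 2 $ j" by (simp add: f'_def vector_matrix_2)
    moreover have "Q $ i $ j \<in> K" for i j using PR R by blast
    ultimately show ?thesis
      using latticeI[of "Q $ 1 $ j" K "Q $ 2 $ j" f] lattice_ext[OF fK indep] by simp
  qed
  moreover have "s = 0 \<and> t = 0" if st: "s \<in> K" "t \<in> K" "f' $ 1 * s + f' $ 2 * t = 0" for s t
  proof -
    have "f $ 1 * (Q $ 1 $ 1 * s + Q $ 1 $ 2 * t) + f $ 2 * (Q $ 2 $ 1 * s + Q $ 2 $ 2 * t) = 0"
      using st(3) by (simp add: f'_def vector_matrix_2 algebra_simps)
    moreover have "Q $ i $ j \<in> K" for i j using PR R by blast
    ultimately have q: "Q $ 1 $ 1 * s + Q $ 1 $ 2 * t = 0" "Q $ 2 $ 1 * s + Q $ 2 $ 2 * t = 0"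
      using indep st by (metis add_mem mult_mem)+
    have PQ: "P $ 1 $ 1 * Q $ 1 $ 1 + P $ 1 $ 2 * Q $ 2 $ 1 = 1" "P $ 1 $ 1 * Q $ 1 $ 2 + P $ 1 $ 2 * Q $ 2 $ 2 = 0"
      "P $ 2 $ 1 * Q $ 1 $ 1 + P $ 2 $ 2 * Q $ 2 $ 1 = 0" "P $ 2 $ 1 * Q $ 1 $ 2 + P $ 2 $ 2 * Q $ 2 $ 2 = 1"
      using Q(3) by (simp_all add: vec_eq_iff matrix_matrix_mult_def mat_def sum_2 forall_2)
    have "s = (P $ 1 $ 1 * Q $ 1 $ 1 + P $ 1 $ 2 * Q $ 2 $ 1) * s + (P $ 1 $ 1 * Q $ 1 $ 2 + P $ 1 $ 2 * Q $ 2 $ 2) * t"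
      by (simp add: PQ)
    also have "\<dots> = P $ 1 $ 1 * (Q $ 1 $ 1 * s + Q $ 1 $ 2 * t) + P $ 1 $ 2 * (Q $ 2 $ 1 * s + Q $ 2 $ 2 * t)"
      by (simp add: algebra_simps)
    finally have "s = 0" unfolding q by simp
    have "t = (P $ 2 $ 1 * Q $ 1 $ 1 + P $ 2 $ 2 * Q $ 2 $ 1) * s + (P $ 2 $ 1 * Q $ 1 $ 2 + P $ 2 $ 2 * Q $ 2 $ 2) * t"
      by (simp add: PQ)
    also have "\<dots> = P $ 2 $ 1 * (Q $ 1 $ 1 * s + Q $ 1 $ 2 * t) + P $ 2 $ 2 * (Q $ 2 $ 1 * s + Q $ 2 $ 2 * t)"
      by (simp add: algebra_simps)
    finally have "t = 0" unfolding q by simp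
    with \<open>s = 0\<close> show ?thesis by blast
  qed
  moreover have ab: "dih_a n \<in> carrier (dihedral n)" "dih_b \<in> carrier (dihedral n)"
    using dihedral_relations[OF n] by auto
  have "f' v* \<phi>' g = (f v* \<phi> g) v* Q" if "g \<in> carrier (dihedral n)" for g
    using P(2) that by (simp add: vector_matrix_mul_assoc matrix_mul_assoc Q f'_def flip: Q_def)
  then have act: "f' v* \<phi>' (dih_a n) = (f v* \<phi> (dih_a n)) v* Q" "f' v* \<phi>' dih_b = (f v* \<phi> dih_b) v* Q"
    using ab by auto
  have "f' v* \<phi>' (dih_a n) = \<zeta> *s f'"
    unfolding act using \<phi>(2) by (simp add: frame_def f'_def scalar_vector_matrix_assoc)
  moreover have "f' v* \<phi>' dih_b = (\<chi> j. cnj (f' $ j))"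
  proof -
    have "cnj (Q $ i $ j) = Q $ i $ j" for i j using PR R cnj_mem by blast
    then show ?thesis unfolding act using \<phi>(2)
      by (simp add: frame_def f'_def vec_eq_iff vector_matrix_2)
  qed
  ultimately have "frame n \<phi>' f'" unfolding frame_def by blast
  then show ?thesis using that lat by blast
qed


lemma frame_scale:
  assumes f: "frame n \<phi> f" and c: "c \<in> K" "c \<noteq> 0"
  shows "frame n \<phi> (c *s f)" "lat R (c *s f) = (\<lambda>u. c * u) ` lat R f"
proof -
  have "c * u \<in> ext K" if uK: "u \<in> ext K" for u
  proof -
    obtain x y where "u = x + y * \<zeta>" "x \<in> K" "y \<in> K" using uK unfolding ext_def by blast
    then have "c * u = c * x + (c * y) * \<zeta>" "c * x \<in> K" "c * y \<in> K" using c by (auto simp: algebra_simps)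
    then show ?thesis using extI by metis
  qed
  moreover have "s = 0 \<and> t = 0" if "s \<in> K" "t \<in> K" "c * f $ 1 * s + c * f $ 2 * t = 0" for s t
  proof -
    have "c * (f $ 1 * s + f $ 2 * t) = 0" using that by (simp add: algebra_simps)
    then show ?thesis using f c that by (auto simp: frame_def)
  qed
  moreover have "(c *s f) v* \<phi> dih_b = (\<chi> j. cnj (c * f $ j))"
    using f c(1) by (simp add: frame_def scalar_vector_matrix_assoc vec_eq_iff cnj_mem)
  ultimately show "frame n \<phi> (c *s f)"
    using f by (simp add: frame_def scalar_vector_matrix_assoc vec_eq_iff)
  show "lat R (c *s f) = (\<lambda>u. c * u) ` lat R f"
  proof (intro equalityI subsetI)
    fix u assume "u \<in> lat R (c *s f)"
    then obtain s t where "u = c * (f $ 1 * s + f $ 2 * t)" "s \<in> R" "t \<in> R"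
      unfolding lat_def by (auto simp: algebra_simps)
    then show "u \<in> (\<lambda>u. c * u) ` lat R f" using latticeI by blast
  next
    fix u assume "u \<in> (\<lambda>u. c * u) ` lat R f"
    then obtain s t where u: "u = c * (f $ 1 * s + f $ 2 * t)" and st: "s \<in> R" "t \<in> R"
      unfolding lat_def by blast
    from u have "u = (c *s f) $ 1 * s + (c *s f) $ 2 * t" by (simp add: algebra_simps)
    then show "u \<in> lat R (c *s f)" using latticeI st by metis
  qed
qed

text \<open>A form of Schur's lemma. Nonproportional f and f' would make the matrix of a the scalar
  \<zeta>, which is not in K. Compatibility with conjugation makes the factor real, and comparing
  coordinates puts it in K.\<close>

lemma frame_unique:
  assumes A: "\<And>i j. \<phi> (dih_a n) $ i $ j \<in> K" and f: "frame n \<phi> f" and f': "frame n \<phi> f'"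
  obtains c where "c \<in> K" "c \<noteq> 0" "f' = c *s f"
proof -
  define A where "A = \<phi> (dih_a n)"
  have eq: "f $ 1 * A $ 1 $ j + f $ 2 * A $ 2 $ j = \<zeta> * f $ j" "f' $ 1 * A $ 1 $ j + f' $ 2 * A $ 2 $ j = \<zeta> * f' $ j" for j
    using f f' by (auto simp: frame_def A_def vec_eq_iff vector_matrix_2)
  have nz: "f $ 1 \<noteq> 0" "f' $ 1 \<noteq> 0"
    using f f' unfolding frame_def by (metis add.right_neutral mult_zero_left mult_zero_right one_mem zero_mem zero_neq_one)+
  define D where "D = f $ 1 * f' $ 2 - f $ 2 * f' $ 1"
  have "D * A $ 1 $ 1 = f' $ 2 * (f $ 1 * A $ 1 $ 1 + f $ 2 * A $ 2 $ 1) - f $ 2 * (f' $ 1 * A $ 1 $ 1 + f' $ 2 * A $ 2 $ 1)"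
    by (simp add: D_def algebra_simps)
  also have "\<dots> = D * \<zeta>" unfolding eq by (simp add: D_def algebra_simps)
  finally have "D = 0 \<or> A $ 1 $ 1 = \<zeta>" by simp
  moreover have "A $ 1 $ 1 \<noteq> \<zeta>" using A z_nonreal cnj_mem unfolding A_def by metis
  ultimately have D0: "D = 0" by blast
  define c where "c = f' $ 1 / f $ 1"
  have c1: "f' $ 1 = c * f $ 1" using nz by (simp add: c_def)
  have "f $ 1 * f' $ 2 = f $ 1 * (c * f $ 2)" using D0 c1 by (simp add: D_def algebra_simps)
  then have c2: "f' $ 2 = c * f $ 2" using nz by simp
  have fc: "f' = c *s f" using c1 c2 by (simp add: vec_eq_iff forall_2)
  have c0: "c \<noteq> 0" using nz c1 by auto
  have "c * cnj (f $ 1) = (f' v* \<phi> dih_b) $ 1"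
    using f unfolding fc by (simp add: frame_def scalar_vector_matrix_assoc)
  also have "\<dots> = cnj (c * f $ 1)" using f' c1 by (simp add: frame_def)
  finally have creal: "cnj c = c" using nz by simp
  obtain x y where xy: "f $ 1 = x + y * \<zeta>" "x \<in> K" "y \<in> K" using f unfolding frame_def ext_def by blast
  obtain x' y' where xy': "f' $ 1 = x' + y' * \<zeta>" "x' \<in> K" "y' \<in> K" using f' unfolding frame_def ext_def by blast
  have "c * x + (c * y) * \<zeta> = x' + y' * \<zeta>" using c1 by (simp add: xy xy' algebra_simps)
  then have e: "c * x = x'" "c * y = y'"
    using real_coords_unique[of "c * x" "c * y" x' y'] xy xy' creal cnj_mem by auto
  have "x \<noteq> 0 \<or> y \<noteq> 0" using nz xy by auto
  then have "c = x' / x \<or> c = y' / y" using e by auto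
  then have "c \<in> K" using xy xy' by auto
  then show ?thesis using that c0 fc by blast
qed

lemma stable_lattice_frame:
  assumes n: "n > 0" and \<phi>: "\<phi> \<in> hom (dihedral n) (GL2 \<O>)" and f: "frame n \<phi> f"
  shows "stable_lattice (lat \<O> f)"
proof -
  have ab: "dih_a n \<in> carrier (dihedral n)" "dih_b \<in> carrier (dihedral n)"
    using dihedral_relations[OF n] by auto
  have ent: "\<phi> (dih_a n) $ i $ j \<in> \<O>" "\<phi> dih_b $ i $ j \<in> \<O>" for i j
    using \<phi> ab GL2_entry by (auto simp: hom_def Pi_iff)
  have fK: "\<forall>j. f $ j \<in> ext K" and indep: "\<forall>s\<in>K. \<forall>t\<in>K. f $ 1 * s + f $ 2 * t = 0 \<longrightarrow> s = 0 \<and> t = 0"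
    using f by (simp_all add: frame_def)
  have "lat \<O> f \<subseteq> lat K f" unfolding lat_def using O_mem by blast
  then have 1: "lat \<O> f \<subseteq> ext K" using lattice_ext[OF fK indep] by simp
  have 2: "u + v \<in> lat \<O> f" if uv: "u \<in> lat \<O> f" "v \<in> lat \<O> f" for u v
  proof -
    obtain s t s' t' where "u = f $ 1 * s + f $ 2 * t" "v = f $ 1 * s' + f $ 2 * t'" and o: "s \<in> \<O>" "t \<in> \<O>" "s' \<in> \<O>" "t' \<in> \<O>"
      using uv unfolding lat_def by blast
    then have "u + v = f $ 1 * (s + s') + f $ 2 * (t + t')" by (simp add: algebra_simps)
    then show ?thesis using latticeI[of "s + s'" \<O> "t + t'" f] o by auto
  qed
  have 3: "r * u \<in> lat \<O> f" if ru: "r \<in> \<O>" "u \<in> lat \<O> f" for r u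
  proof -
    obtain s t where "u = f $ 1 * s + f $ 2 * t" and o: "s \<in> \<O>" "t \<in> \<O>"
      using ru unfolding lat_def by blast
    then have "r * u = f $ 1 * (r * s) + f $ 2 * (r * t)" by (simp add: algebra_simps)
    then show ?thesis using latticeI[of "r * s" \<O> "r * t" f] o ru by auto
  qed
  have act: "(f v* B) $ 1 * s + (f v* B) $ 2 * t \<in> lat \<O> f"
    if B: "\<And>i j. B $ i $ j \<in> \<O>" and st: "s \<in> \<O>" "t \<in> \<O>" for B :: "complex^2^2" and s t
  proof -
    have "(f v* B) $ 1 * s + (f v* B) $ 2 * t =
        f $ 1 * (B $ 1 $ 1 * s + B $ 1 $ 2 * t) + f $ 2 * (B $ 2 $ 1 * s + B $ 2 $ 2 * t)"
      by (simp add: vector_matrix_2 algebra_simps)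
    then show ?thesis using latticeI[of _ \<O> _ f] B st by (metis O_add O_mult)
  qed
  have 4: "\<zeta> * u \<in> lat \<O> f" "cnj u \<in> lat \<O> f" if u: "u \<in> lat \<O> f" for u
  proof -
    obtain s t where u: "u = f $ 1 * s + f $ 2 * t" and st: "s \<in> \<O>" "t \<in> \<O>"
      using u unfolding lat_def by blast
    have "\<zeta> * u = (f v* \<phi> (dih_a n)) $ 1 * s + (f v* \<phi> (dih_a n)) $ 2 * t"
      using f by (simp add: frame_def u algebra_simps)
    then show "\<zeta> * u \<in> lat \<O> f" using act[of "\<phi> (dih_a n)" s t] ent st by simp
    have "cnj s = s" "cnj t = t" using st cnj_mem O_mem by auto
    then have "cnj u = (f v* \<phi> dih_b) $ 1 * s + (f v* \<phi> dih_b) $ 2 * t"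
      using f by (simp add: frame_def u)
    then show "cnj u \<in> lat \<O> f" using act[of "\<phi> dih_b" s t] ent st by simp
  qed
  show ?thesis unfolding stable_lattice_def
    by (intro conjI ballI 1 2 3 4)
qed

text \<open>Multiplication by \<zeta> and conjugation have matrices A and B over \<open>\<O>\<close>
  in the basis f. The dihedral relations need only be checked on f, where they say that conjugation
  is an involution, \<zeta>^n = 1 and \<zeta> * \<open>cnj \<zeta>\<close> = 1.\<close>

lemma hom_of_stable_lattice:
  assumes n: "n > 0" and zn: "\<zeta> ^ n = 1" and fK: "\<forall>j. f $ j \<in> ext K"
    and indep: "\<forall>s\<in>K. \<forall>t\<in>K. f $ 1 * s + f $ 2 * t = 0 \<longrightarrow> s = 0 \<and> t = 0"
    and st: "stable_lattice (lat \<O> f)"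
  obtains \<phi> where "\<phi> \<in> hom (dihedral n) (GL2 \<O>)" "frame n \<phi> f"
proof -
  interpret H: group "GL2 \<O>" by (rule group_GL2[OF semiring_sets(2)])
  note base = lattice_base[OF semiring_sets(2), of f]
  have "(\<zeta> *s f) $ j \<in> lat \<O> f" for j using st base[of j] by (simp add: stable_lattice_def)
  then obtain A :: "complex^2^2" where A: "\<forall>i j. A $ i $ j \<in> \<O>" "\<zeta> *s f = f v* A" by (rule lattice_matrix)
  define fc :: "complex^2" where "fc = (\<chi> j. cnj (f $ j))"
  have "fc $ j \<in> lat \<O> f" for j using st base[of j] by (simp add: stable_lattice_def fc_def)
  then obtain B :: "complex^2^2" where B: "\<forall>i j. B $ i $ j \<in> \<O>" "fc = f v* B" by (rule lattice_matrix)
  have cnjO: "cnj x = x" if "x \<in> \<O>" for x using that O_mem cnj_mem by blast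
  \<comment> \<open>Entries in \<open>\<O>\<close> are real, so conjugating f A = \<zeta> f gives
    the action of A on the conjugate frame.\<close>
  have fcA: "fc v* A = cnj \<zeta> *s fc"
  proof -
    have "(fc v* A) $ j = cnj ((f v* A) $ j)" for j using A(1) cnjO by (simp add: vector_matrix_2 fc_def)
    then show ?thesis unfolding A(2)[symmetric] by (simp add: vec_eq_iff fc_def)
  qed
  have fcB: "fc v* B = f"
  proof -
    have "(fc v* B) $ j = cnj ((f v* B) $ j)" for j using B(1) cnjO by (simp add: vector_matrix_2 fc_def)
    then show ?thesis unfolding B(2)[symmetric] by (simp add: vec_eq_iff fc_def)
  qed
  have entries: "\<forall>i j. (U ** V) $ i $ j \<in> \<O>" if UV: "\<forall>i j. U $ i $ j \<in> \<O>" "\<forall>i j. V $ i $ j \<in> \<O>"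
    for U V :: "complex^2^2"
  proof (intro allI)
    fix i j
    have "(U ** V) $ i $ j = U $ i $ 1 * V $ 1 $ j + U $ i $ 2 * V $ 2 $ j"
      by (simp add: matrix_matrix_mult_def sum_2)
    also have "\<dots> \<in> \<O>" by (intro O_add O_mult UV[rule_format])
    finally show "(U ** V) $ i $ j \<in> \<O>" .
  qed
  have eq1: "U = mat 1" if "\<forall>i j. U $ i $ j \<in> \<O>" "f v* U = f" for U
  proof (rule independent_cancel[OF indep])
    show "f v* U = f v* mat 1" using that by simp
    show "U $ i $ j \<in> K" for i j using that O_mem by blast
    show "(mat 1 :: complex^2^2) $ i $ j \<in> K" for i j by (simp add: mat_def)
  qed
  have BB: "B ** B = mat 1"
    by (intro eq1 entries B(1)) (auto simp: fcB simp flip: vector_matrix_mul_assoc B(2))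
  have BABA: "(B ** A ** B) ** A = mat 1"
  proof (rule eq1)
    show "\<forall>i j. ((B ** A ** B) ** A) $ i $ j \<in> \<O>" by (intro entries A(1) B(1))
    have "f v* ((B ** A ** B) ** A) = (cnj \<zeta> *s f) v* A"
      by (simp add: fcA fcB scalar_vector_matrix_assoc flip: vector_matrix_mul_assoc B(2))
    also have "\<dots> = f" using z_cnj by (simp add: scalar_vector_matrix_assoc vec_eq_iff mult.commute flip: A(2))
    finally show "f v* ((B ** A ** B) ** A) = f" .
  qed
  then have ABAB: "A ** (B ** A ** B) = mat 1" by (rule matrix_left_right_inverse1)
  have Acar: "A \<in> carrier (GL2 \<O>)" unfolding GL2_carrier
    by (intro conjI A(1) exI[of _ "B ** A ** B"] ABAB entries B(1))
  have Bcar: "B \<in> carrier (GL2 \<O>)" unfolding GL2_carrier using B(1) BB by blast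
  have "f v* (A [^]\<^bsub>GL2 \<O>\<^esub> k) = \<zeta> ^ k *s f" for k :: nat
  proof (induction k)
    case (Suc k)
    have "f v* (A [^]\<^bsub>GL2 \<O>\<^esub> Suc k) = (\<zeta> ^ k *s f) v* A"
      by (simp add: GL2_simps Suc flip: vector_matrix_mul_assoc)
    also have "\<dots> = \<zeta> ^ Suc k *s f" by (simp add: scalar_vector_matrix_assoc vec_eq_iff flip: A(2))
    finally show ?case .
  qed (simp add: GL2_simps)
  then have An: "A [^]\<^bsub>GL2 \<O>\<^esub> n = \<one>\<^bsub>GL2 \<O>\<^esub>"
    using eq1[of "A [^]\<^bsub>GL2 \<O>\<^esub> n"] GL2_entry[OF H.nat_pow_closed[OF Acar]] zn by (simp add: GL2_simps)
  have B2: "B [^]\<^bsub>GL2 \<O>\<^esub> (2::nat) = \<one>\<^bsub>GL2 \<O>\<^esub>"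
    using Bcar BB by (simp add: numeral_2_eq_2 GL2_simps)
  have inv: "B \<otimes>\<^bsub>GL2 \<O>\<^esub> A \<otimes>\<^bsub>GL2 \<O>\<^esub> B = inv\<^bsub>GL2 \<O>\<^esub> A"
    using H.inv_equality[of "B \<otimes>\<^bsub>GL2 \<O>\<^esub> A \<otimes>\<^bsub>GL2 \<O>\<^esub> B" A] BABA Acar Bcar H.m_closed by (simp add: GL2_simps)
  obtain \<phi> where \<phi>: "\<phi> \<in> hom (dihedral n) (GL2 \<O>)" "\<phi> (dih_a n) = A" "\<phi> dih_b = B"
    using dihedral_universal[OF n H.is_group Acar Bcar An B2 inv] by blast
  then have "frame n \<phi> f" using fK indep A(2) B(2) by (simp add: frame_def fc_def)
  then show ?thesis using that \<phi> by blast
qed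

text \<open>The second lattice is stable under conjugation because \<open>cnj lam\<close> is
  \<open>lam\<close> times the unit -\<open>cnj \<zeta>\<close>.\<close>

lemma stable_lattice_ext:
  assumes I: "fractional_ideal K I"
  shows "stable_lattice (ext I)" "stable_lattice ((\<lambda>u. lam * u) ` ext I)"
proof -
  note Iadd = fractional_idealD(3)[OF I] and Imult = fractional_idealD(4)[OF I]
  note IK = fractional_idealD(1)[OF I]
  note neg = fractional_idealD(5)[OF I]
  have zext: "\<zeta> * (x + y * \<zeta>) = - y + (x + \<tau> * y) * \<zeta>" for x y
  proof -
    have "\<zeta> * (x + y * \<zeta>) = x * \<zeta> + y * (\<zeta> * \<zeta>)" by (simp add: algebra_simps)
    then show ?thesis unfolding z_sq by (simp add: algebra_simps)
  qed
  have add: "u + v \<in> ext I" if uv: "u \<in> ext I" "v \<in> ext I" for u v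
  proof -
    obtain x y x' y' where "u = x + y * \<zeta>" "v = x' + y' * \<zeta>" and xy: "x \<in> I" "y \<in> I" "x' \<in> I" "y' \<in> I"
      using uv unfolding ext_def by blast
    then have "u + v = (x + x') + (y + y') * \<zeta>" by (simp add: algebra_simps)
    then show ?thesis using extI Iadd xy by metis
  qed
  have mult: "r * u \<in> ext I" if ru: "r \<in> \<O>" "u \<in> ext I" for r u
  proof -
    obtain x y where "u = x + y * \<zeta>" and xy: "x \<in> I" "y \<in> I" using ru unfolding ext_def by blast
    then have "r * u = r * x + (r * y) * \<zeta>" by (simp add: algebra_simps)
    then show ?thesis using extI Imult ru xy by metis
  qed
  have z: "\<zeta> * u \<in> ext I" if u: "u \<in> ext I" for u
  proof -
    obtain x y where "u = x + y * \<zeta>" and xy: "x \<in> I" "y \<in> I" using u unfolding ext_def by blast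
    then show ?thesis using zext extI Iadd Imult[OF tau_O] neg by metis
  qed
  have cz: "cnj u \<in> ext I" if u: "u \<in> ext I" for u
  proof -
    obtain x y where "u = x + y * \<zeta>" and xy: "x \<in> I" "y \<in> I" using u unfolding ext_def by blast
    moreover have "cnj x = x" "cnj y = y" using xy IK cnj_mem by blast+
    ultimately have "cnj u = x + y * (\<tau> - \<zeta>)" by (simp add: cnj_z)
    then have "cnj u = (x + \<tau> * y) + (- y) * \<zeta>" by (simp add: algebra_simps)
    then show ?thesis using extI Iadd Imult[OF tau_O] neg xy by metis
  qed
  show st: "stable_lattice (ext I)"
    unfolding stable_lattice_def
  proof (intro conjI ballI add z cz mult)
    show "ext I \<subseteq> ext K" using IK unfolding ext_def by blast
  qed
  have extK: "lam * u \<in> ext K" if u: "u \<in> ext K" for u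
  proof -
    obtain x y where u: "u = x + y * \<zeta>" and xy: "x \<in> K" "y \<in> K" using u unfolding ext_def by blast
    have "lam * u = u - \<zeta> * u" by (simp add: lam_def algebra_simps)
    also have "\<dots> = (x + y) + (y - x - \<tau> * y) * \<zeta>" unfolding u zext by (simp add: algebra_simps)
    finally show ?thesis using xy tau_O O_mem by (auto intro!: extI)
  qed
  have cl: "cnj lam = lam * (- cnj \<zeta>)" using z_cnj by (simp add: lam_def algebra_simps)
  show "stable_lattice ((\<lambda>u. lam * u) ` ext I)"
    unfolding stable_lattice_def
  proof (intro conjI ballI subsetI)
    fix u assume "u \<in> (\<lambda>u. lam * u) ` ext I"
    then obtain w where w: "u = lam * w" "w \<in> ext I" by blast
    show "u \<in> ext K" unfolding w(1) using w(2) IK by (intro extK) (auto simp: ext_def)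
    show "\<zeta> * u \<in> (\<lambda>u. lam * u) ` ext I" using w z[OF w(2)] by (intro image_eqI[of _ _ "\<zeta> * w"]) auto
    show "r * u \<in> (\<lambda>u. lam * u) ` ext I" if "r \<in> \<O>" for r
      using w mult[OF that w(2)] by (intro image_eqI[of _ _ "r * w"]) auto
    show "cnj u \<in> (\<lambda>u. lam * u) ` ext I"
    proof (rule image_eqI[of _ _ "- (cnj \<zeta> * cnj w)"])
      show "cnj u = lam * - (cnj \<zeta> * cnj w)" by (simp add: w cl)
      have "- (cnj \<zeta> * cnj w) = -1 * cnj (\<zeta> * w)" by simp
      then show "- (cnj \<zeta> * cnj w) \<in> ext I" using mult[of "-1"] cz[OF z[OF w(2)]] O_uminus[OF O_one] by metis
    qed
    fix v assume "v \<in> (\<lambda>u. lam * u) ` ext I"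
    then obtain w' where w': "v = lam * w'" "w' \<in> ext I" by blast
    show "u + v \<in> (\<lambda>u. lam * u) ` ext I"
      using w w' add[OF w(2) w'(2)] by (intro image_eqI[of _ _ "w + w'"]) (auto simp: algebra_simps)
  qed
qed

text \<open>Dividing by \<mu> and taking coordinates in 1 and \<zeta> is \<open>\<O>\<close>-linear,
  so the entries of f become a basis of I x I. The condition on I is therefore the same for every
  type \<mu>.\<close>

lemma lattice_square_principal:
  assumes I: "I \<subseteq> K" and m: "\<mu> \<noteq> 0" and eq: "lat \<O> f = (\<lambda>u. \<mu> * u) ` ext I"
    and indep: "\<forall>s\<in>K. \<forall>t\<in>K. f $ 1 * s + f $ 2 * t = 0 \<longrightarrow> s = 0 \<and> t = 0"
  shows "fractional_ideal K I" "\<exists>D\<in>K. D \<noteq> 0 \<and> frac_ideal_mult I I = (\<lambda>r. D * r) ` \<O>"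
proof -
  note base = lattice_base[OF semiring_sets(2), of f, unfolded eq]
  obtain a c where f1: "f $ 1 = \<mu> * (a + c * \<zeta>)" "a \<in> I" "c \<in> I" using base[of 1] unfolding ext_def by blast
  obtain b d where f2: "f $ 2 = \<mu> * (b + d * \<zeta>)" "b \<in> I" "d \<in> I" using base[of 2] unfolding ext_def by blast
  have abcd: "a \<in> K" "b \<in> K" "c \<in> K" "d \<in> K" using f1 f2 I by auto
  have D: "a * d - b * c \<noteq> 0"
  proof
    assume 0: "a * d - b * c = 0"
    have "f $ 1 * d + f $ 2 * (- c) = \<mu> * (a * d - b * c)"
      "f $ 1 * b + f $ 2 * (- a) = - \<mu> * (a * d - b * c) * \<zeta>"
      by (simp_all add: f1 f2 algebra_simps)
    then have z: "f $ 1 * d + f $ 2 * (- c) = 0" "f $ 1 * b + f $ 2 * (- a) = 0" using 0 by auto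
    have "d = 0" "- c = 0" using indep[rule_format, OF _ _ z(1)] abcd by auto
    moreover have "b = 0" "- a = 0" using indep[rule_format, OF _ _ z(2)] abcd by auto
    ultimately show False using indep[rule_format, of 1 0] f1 by auto
  qed
  have lin: "f $ 1 * s + f $ 2 * t = \<mu> * ((a * s + b * t) + (c * s + d * t) * \<zeta>)" for s t
    by (simp add: f1 f2 algebra_simps)
  have "{(a * s + b * t, c * s + d * t) | s t. s \<in> \<O> \<and> t \<in> \<O>} = I \<times> I"
  proof (intro equalityI subsetI)
    fix w assume "w \<in> {(a * s + b * t, c * s + d * t) | s t. s \<in> \<O> \<and> t \<in> \<O>}"
    then obtain s t where w: "w = (a * s + b * t, c * s + d * t)" and st: "s \<in> \<O>" "t \<in> \<O>" by blast
    have "\<mu> * ((a * s + b * t) + (c * s + d * t) * \<zeta>) \<in> (\<lambda>u. \<mu> * u) ` ext I"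
      using latticeI[OF st, of f] unfolding eq lin .
    then have "(a * s + b * t) + (c * s + d * t) * \<zeta> \<in> ext I" using m by auto
    then obtain x y where xy: "(a * s + b * t) + (c * s + d * t) * \<zeta> = x + y * \<zeta>" "x \<in> I" "y \<in> I"
      unfolding ext_def by blast
    have "a * s + b * t \<in> K" "c * s + d * t \<in> K" using abcd st O_mem by blast+
    then have "a * s + b * t = x" "c * s + d * t = y" using coords_unique[OF _ _ _ _ xy(1)] xy I by auto
    then show "w \<in> I \<times> I" using w xy by simp
  next
    fix w assume "w \<in> I \<times> I"
    then obtain x y where w: "w = (x, y)" "x \<in> I" "y \<in> I" by auto
    then have "\<mu> * (x + y * \<zeta>) \<in> lat \<O> f" unfolding eq by (intro imageI extI)
    then obtain s t where st: "\<mu> * (x + y * \<zeta>) = f $ 1 * s + f $ 2 * t" "s \<in> \<O>" "t \<in> \<O>" unfolding lat_def by blast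
    then have e: "x + y * \<zeta> = (a * s + b * t) + (c * s + d * t) * \<zeta>" using m unfolding lin by simp
    have "a * s + b * t \<in> K" "c * s + d * t \<in> K" using abcd st O_mem by blast+
    then have "x = a * s + b * t" "y = c * s + d * t" using coords_unique[OF _ _ _ _ e] w I by auto
    then show "w \<in> {(a * s + b * t, c * s + d * t) | s t. s \<in> \<O> \<and> t \<in> \<O>}" using w st by blast
  qed
  from square_principal_if_free[OF abcd D this]
  show "fractional_ideal K I" "\<exists>D\<in>K. D \<noteq> 0 \<and> frac_ideal_mult I I = (\<lambda>r. D * r) ` \<O>"
    using D abcd by (auto intro!: bexI[of _ "a * d - b * c"])
qed

lemma lattice_of_square_principal:
  assumes I: "fractional_ideal K I" and sq: "frac_ideal_mult I I = (\<lambda>r. D * r) ` \<O>" and D: "D \<noteq> 0"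
    and m: "\<mu> \<noteq> 0" and st: "stable_lattice ((\<lambda>u. \<mu> * u) ` ext I)"
  obtains f where "lat \<O> f = (\<lambda>u. \<mu> * u) ` ext I" "\<forall>j. f $ j \<in> ext K"
    "\<forall>s\<in>K. \<forall>t\<in>K. f $ 1 * s + f $ 2 * t = 0 \<longrightarrow> s = 0 \<and> t = 0"
proof -
  obtain a b c d where abcd: "a \<in> K" "b \<in> K" "c \<in> K" "d \<in> K" "a * d - b * c = D"
    and eq: "{(a * s + b * t, c * s + d * t) | s t. s \<in> \<O> \<and> t \<in> \<O>} = I \<times> I"
    by (rule free_if_square_principal[OF I sq D])
  define f :: "complex^2" where "f = (\<chi> j. if j = 1 then \<mu> * (a + c * \<zeta>) else \<mu> * (b + d * \<zeta>))"
  have lin: "f $ 1 * s + f $ 2 * t = \<mu> * ((a * s + b * t) + (c * s + d * t) * \<zeta>)" for s t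
    by (simp add: f_def algebra_simps)
  have lat: "lat \<O> f = (\<lambda>u. \<mu> * u) ` ext I"
  proof (intro equalityI subsetI)
    fix u assume "u \<in> lat \<O> f"
    then obtain s t where u: "u = \<mu> * ((a * s + b * t) + (c * s + d * t) * \<zeta>)" and st: "s \<in> \<O>" "t \<in> \<O>"
      unfolding lat_def lin by blast
    have "(a * s + b * t, c * s + d * t) \<in> I \<times> I" using eq st by blast
    then show "u \<in> (\<lambda>u. \<mu> * u) ` ext I" unfolding u by (auto intro: extI)
  next
    fix u assume "u \<in> (\<lambda>u. \<mu> * u) ` ext I"
    then obtain x y where u: "u = \<mu> * (x + y * \<zeta>)" "x \<in> I" "y \<in> I" unfolding ext_def by blast
    then obtain s t where "x = a * s + b * t" "y = c * s + d * t" "s \<in> \<O>" "t \<in> \<O>" using eq by blast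
    then show "u \<in> lat \<O> f" unfolding lat_def lin using u by blast
  qed
  have fK: "\<forall>j. f $ j \<in> ext K"
  proof
    fix j
    have "f $ j \<in> (\<lambda>u. \<mu> * u) ` ext I" using lattice_base[OF semiring_sets(2), of f j] unfolding lat .
    then show "f $ j \<in> ext K" using st unfolding stable_lattice_def by blast
  qed
  have indep: "s = 0 \<and> t = 0" if st: "s \<in> K" "t \<in> K" "f $ 1 * s + f $ 2 * t = 0" for s t
  proof -
    have "(a * s + b * t) + (c * s + d * t) * \<zeta> = 0 + 0 * \<zeta>" using st(3) m unfolding lin by simp
    then have z: "a * s + b * t = 0" "c * s + d * t = 0"
      using coords_unique[of "a * s + b * t" "c * s + d * t" 0 0] abcd st by auto
    have "D * s = d * (a * s + b * t) - b * (c * s + d * t)" "D * t = a * (c * s + d * t) - c * (a * s + b * t)"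
      unfolding abcd(5)[symmetric] by (simp_all add: algebra_simps)
    then show ?thesis unfolding z using D by simp
  qed
  show ?thesis by (rule that[OF lat fK]) (use indep in simp)
qed


end

section \<open>Counting\<close>

context number_field
begin

text \<open>The coset of I modulo principal ideals, written as the set of its multiples by K*;
  \<open>r_coset_principal\<close> makes the identification for fractional ideals.\<close>

definition ideal_class :: "complex set \<Rightarrow> complex set set" where
  "ideal_class I = {(\<lambda>r. x * r) ` I | x. x \<in> K \<and> x \<noteq> 0}"

lemma ideal_classI: "x \<in> K \<Longrightarrow> x \<noteq> 0 \<Longrightarrow> (\<lambda>r. x * r) ` I \<in> ideal_class I"
  by (auto simp: ideal_class_def)

lemma frac_ideal_mult_scale:
  "frac_ideal_mult ((\<lambda>r. x * r) ` I) ((\<lambda>r. y * r) ` J) = (\<lambda>r. (x * y) * r) ` frac_ideal_mult I J"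
proof
  show "frac_ideal_mult ((\<lambda>r. x * r) ` I) ((\<lambda>r. y * r) ` J) \<subseteq> (\<lambda>r. (x * y) * r) ` frac_ideal_mult I J"
  proof (rule frac_ideal_mult_least)
    show "0 \<in> (\<lambda>r. (x * y) * r) ` frac_ideal_mult I J"
      using frac_ideal_mult_zero by (intro image_eqI[of _ _ 0]) auto
    show "u + v \<in> (\<lambda>r. (x * y) * r) ` frac_ideal_mult I J"
      if "u \<in> (\<lambda>r. (x * y) * r) ` frac_ideal_mult I J" "v \<in> (\<lambda>r. (x * y) * r) ` frac_ideal_mult I J" for u v
      using that frac_ideal_mult_add by (force simp flip: distrib_left)
    show "u * v \<in> (\<lambda>r. (x * y) * r) ` frac_ideal_mult I J"
      if uv: "u \<in> (\<lambda>r. x * r) ` I" "v \<in> (\<lambda>r. y * r) ` J" for u v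
    proof -
      obtain i j where "u = x * i" "v = y * j" "i \<in> I" "j \<in> J" using uv by blast
      then show ?thesis using frac_ideal_mult_base[of i I j J] by (intro image_eqI[of _ _ "i * j"]) auto
    qed
  qed
  have "frac_ideal_mult I J \<subseteq> {w. (x * y) * w \<in> frac_ideal_mult ((\<lambda>r. x * r) ` I) ((\<lambda>r. y * r) ` J)}"
  proof (rule frac_ideal_mult_least)
    show "i * j \<in> {w. (x * y) * w \<in> frac_ideal_mult ((\<lambda>r. x * r) ` I) ((\<lambda>r. y * r) ` J)}"
      if "i \<in> I" "j \<in> J" for i j
    proof -
      have "(x * i) * (y * j) \<in> frac_ideal_mult ((\<lambda>r. x * r) ` I) ((\<lambda>r. y * r) ` J)"
        using that by (intro frac_ideal_mult_base imageI)
      then show ?thesis by (simp add: mult_ac)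
    qed
  qed (auto simp: distrib_left intro: frac_ideal_mult_zero frac_ideal_mult_add)
  then show "(\<lambda>r. (x * y) * r) ` frac_ideal_mult I J \<subseteq> frac_ideal_mult ((\<lambda>r. x * r) ` I) ((\<lambda>r. y * r) ` J)"
    by blast
qed

lemma frac_ideal_mult_one:
  assumes "fractional_ideal K I"
  shows "frac_ideal_mult \<O> I = I"
proof
  show "frac_ideal_mult \<O> I \<subseteq> I"
    by (rule frac_ideal_mult_least) (use assms in \<open>auto simp: fractional_ideal_def\<close>)
  show "I \<subseteq> frac_ideal_mult \<O> I"
    using frac_ideal_mult_base[OF O_one, of _ I] by auto
qed

lemma frac_ideal_mult_principal:
  assumes "fractional_ideal K I"
  shows "frac_ideal_mult ((\<lambda>r. x * r) ` \<O>) I = (\<lambda>r. x * r) ` I"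
  using frac_ideal_mult_scale[of x \<O> 1 I] frac_ideal_mult_one[OF assms] by simp

lemma r_coset_principal:
  assumes "fractional_ideal K I"
  shows "principal_frac_ideals K #>\<^bsub>frac_ideal_group K\<^esub> I = ideal_class I"
  using frac_ideal_mult_principal[OF assms]
  by (auto simp: r_coset_def principal_frac_ideals_def frac_ideal_group_def ideal_class_def)

lemma carrier_class_group: "carrier (class_group K) = ideal_class ` {I. fractional_ideal K I}"
  using r_coset_principal
  by (auto simp: class_group_def FactGroup_def RCOSETS_def frac_ideal_group_def[of K])

lemma ideal_class_square:
  "ideal_class I <#>\<^bsub>frac_ideal_group K\<^esub> ideal_class I = ideal_class (frac_ideal_mult I I)"
proof (intro equalityI subsetI)
  fix J assume "J \<in> ideal_class I <#>\<^bsub>frac_ideal_group K\<^esub> ideal_class I"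
  then obtain x y where "x \<in> K" "x \<noteq> 0" "y \<in> K" "y \<noteq> 0" "J = frac_ideal_mult ((\<lambda>r. x * r) ` I) ((\<lambda>r. y * r) ` I)"
    unfolding set_mult_def ideal_class_def frac_ideal_group_def by auto
  then show "J \<in> ideal_class (frac_ideal_mult I I)"
    unfolding ideal_class_def frac_ideal_mult_scale by (intro CollectI exI[of _ "x * y"]) auto
next
  fix J assume "J \<in> ideal_class (frac_ideal_mult I I)"
  then obtain x where x: "x \<in> K" "x \<noteq> 0" "J = (\<lambda>r. x * r) ` frac_ideal_mult I I" unfolding ideal_class_def by blast
  have "J = frac_ideal_mult ((\<lambda>r. x * r) ` I) ((\<lambda>r. 1 * r) ` I)" unfolding frac_ideal_mult_scale x(3) by simp
  moreover have "(\<lambda>r. x * r) ` I \<in> ideal_class I" "(\<lambda>r. 1 * r) ` I \<in> ideal_class I"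
    by (intro ideal_classI x one_mem one_neq_zero)+
  ultimately show "J \<in> ideal_class I <#>\<^bsub>frac_ideal_group K\<^esub> ideal_class I"
    unfolding set_mult_def frac_ideal_group_def monoid.simps by blast
qed

lemma ideal_class_eq_iff:
  "ideal_class I = ideal_class J \<longleftrightarrow> (\<exists>c\<in>K. c \<noteq> 0 \<and> I = (\<lambda>r. c * r) ` J)"
proof
  assume eq: "ideal_class I = ideal_class J"
  have "(\<lambda>r. 1 * r) ` I \<in> ideal_class I" by (intro ideal_classI one_mem one_neq_zero)
  then have "I \<in> ideal_class J" unfolding eq by simp
  then show "\<exists>c\<in>K. c \<noteq> 0 \<and> I = (\<lambda>r. c * r) ` J" unfolding ideal_class_def by blast
next
  assume "\<exists>c\<in>K. c \<noteq> 0 \<and> I = (\<lambda>r. c * r) ` J"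
  then obtain c where c: "c \<in> K" "c \<noteq> 0" "I = (\<lambda>r. c * r) ` J" by blast
  have 1: "(\<lambda>r. x * r) ` I = (\<lambda>r. (x * c) * r) ` J" for x by (simp add: c(3) image_image mult.assoc)
  have 2: "(\<lambda>r. x * r) ` J = (\<lambda>r. (x / c) * r) ` I" for x using c(2) by (simp add: c(3) image_image)
  show "ideal_class I = ideal_class J"
  proof (intro equalityI subsetI)
    fix L assume "L \<in> ideal_class I"
    then obtain x where x: "x \<in> K" "x \<noteq> 0" "L = (\<lambda>r. x * r) ` I" unfolding ideal_class_def by blast
    then have "L = (\<lambda>r. (x * c) * r) ` J" "x * c \<in> K" "x * c \<noteq> 0" using 1[of x] c by auto
    then show "L \<in> ideal_class J" unfolding ideal_class_def by blast
  next
    fix L assume "L \<in> ideal_class J"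
    then obtain x where x: "x \<in> K" "x \<noteq> 0" "L = (\<lambda>r. x * r) ` J" unfolding ideal_class_def by blast
    then have "L = (\<lambda>r. (x / c) * r) ` I" "x / c \<in> K" "x / c \<noteq> 0" using 2[of x] c by auto
    then show "L \<in> ideal_class I" unfolding ideal_class_def by blast
  qed
qed

lemma class_group_2_torsion_eq:
  "class_group_2_torsion K =
     ideal_class ` {I. fractional_ideal K I \<and> (\<exists>D\<in>K. D \<noteq> 0 \<and> frac_ideal_mult I I = (\<lambda>r. D * r) ` \<O>)}"
proof -
  have one: "\<one>\<^bsub>class_group K\<^esub> = ideal_class \<O>"
    by (auto simp: class_group_def FactGroup_def principal_frac_ideals_def ideal_class_def)
  have mult: "c \<otimes>\<^bsub>class_group K\<^esub> c' = c <#>\<^bsub>frac_ideal_group K\<^esub> c'" for c c'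
    by (simp add: class_group_def FactGroup_def)
  have key: "ideal_class I <#>\<^bsub>frac_ideal_group K\<^esub> ideal_class I = ideal_class \<O> \<longleftrightarrow>
      (\<exists>D\<in>K. D \<noteq> 0 \<and> frac_ideal_mult I I = (\<lambda>r. D * r) ` \<O>)" for I
    unfolding ideal_class_square by (rule ideal_class_eq_iff)
  have "class_group_2_torsion K = ideal_class ` {I. fractional_ideal K I \<and>
      ideal_class I <#>\<^bsub>frac_ideal_group K\<^esub> ideal_class I = ideal_class \<O>}"
    unfolding class_group_2_torsion_def carrier_class_group one mult by blast
  then show ?thesis unfolding key .
qed

end

text \<open>\<open>Q\<close> is a relation because the invariant of a form is read off from a chosen
  frame and ideal; \<open>compat\<close> contains its uniqueness. Of \<open>r\<close> just
  \<open>eqv\<close> on A is asked, since conjugacy is considered on all functions but is an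
  equivalence among homomorphisms.\<close>

lemma card_quotient_by_invariant:
  assumes eqv: "\<And>x y. x \<in> A \<Longrightarrow> y \<in> A \<Longrightarrow> r `` {x} = r `` {y} \<longleftrightarrow> (x, y) \<in> r"
    and total: "\<And>x. x \<in> A \<Longrightarrow> \<exists>s\<in>S. Q x s" and surj: "\<And>s. s \<in> S \<Longrightarrow> \<exists>x\<in>A. Q x s"
    and compat: "\<And>x y s t. x \<in> A \<Longrightarrow> y \<in> A \<Longrightarrow> Q x s \<Longrightarrow> Q y t \<Longrightarrow> (x, y) \<in> r \<longleftrightarrow> s = t"
  shows "card (A // r) = card S"
proof -
  obtain g where g: "\<And>s. s \<in> S \<Longrightarrow> g s \<in> A \<and> Q (g s) s" using surj by metis
  have "bij_betw (\<lambda>s. r `` {g s}) S (A // r)"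
  proof (rule bij_betwI')
    show "r `` {g s} = r `` {g t} \<longleftrightarrow> s = t" if "s \<in> S" "t \<in> S" for s t
      using eqv[of "g s" "g t"] compat[of "g s" "g t" s t] g that by blast
    show "r `` {g s} \<in> A // r" if "s \<in> S" for s using g that by (auto simp: quotient_def)
    show "\<exists>s\<in>S. Y = r `` {g s}" if Y: "Y \<in> A // r" for Y
    proof -
      obtain x where x: "x \<in> A" "Y = r `` {x}" using Y by (auto simp: quotient_def)
      obtain s where "s \<in> S" "Q x s" using total x(1) by blast
      then show ?thesis using eqv[of x "g s"] compat[of x "g s" s s] g x by blast
    qed
  qed
  then show ?thesis by (metis bij_betw_same_card)
qed

section \<open>Counting by ideal class and lattice type\<close>

context rotation_field
begin

lemma ext_scale:
  assumes "c \<in> K"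
  shows "(\<lambda>u. c * u) ` ext I = ext ((\<lambda>r. c * r) ` I)"
proof (intro equalityI subsetI)
  fix u assume "u \<in> (\<lambda>u. c * u) ` ext I"
  then obtain x y where "u = c * (x + y * \<zeta>)" and xy: "x \<in> I" "y \<in> I" unfolding ext_def by blast
  then have "u = c * x + (c * y) * \<zeta>" by (simp add: algebra_simps)
  then show "u \<in> ext ((\<lambda>r. c * r) ` I)" using extI xy by (metis imageI)
next
  fix u assume "u \<in> ext ((\<lambda>r. c * r) ` I)"
  then obtain x y where "u = c * x + (c * y) * \<zeta>" and xy: "x \<in> I" "y \<in> I" unfolding ext_def by blast
  then have "u = c * (x + y * \<zeta>)" by (simp add: algebra_simps)
  then show "u \<in> (\<lambda>u. c * u) ` ext I" using extI xy by blast
qed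

lemma ext_inject:
  assumes "0 \<in> I" "0 \<in> J" "I \<subseteq> K" "J \<subseteq> K" "ext I = ext J"
  shows "I = J"
  by (metis ext_Int[OF assms(1,3)] ext_Int[OF assms(2,4)] assms(5))

text \<open>\<open>S\<close> lists the types of lattices by a multiplier, later {1} or {1,
  \<open>lam\<close>}. If the lattice of a form is \<mu> \<open>ext I\<close>, its invariant is the
  class of I together with \<mu>; scaling by K* changes neither, and every pair with I^2 principal
  occurs.\<close>

lemma card_integral_form_classes:
  assumes n: "n > 0" and zn: "\<zeta> ^ n = 1"
    and \<psi>: "\<psi> \<in> hom (dihedral n) (GL2 K)" "frame n \<psi> f0"
    and S: "\<And>\<mu> I. \<mu> \<in> S \<Longrightarrow> fractional_ideal K I \<Longrightarrow> stable_lattice ((\<lambda>u. \<mu> * u) ` ext I)" "0 \<notin> S"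
    and classify: "\<And>M. stable_lattice M \<Longrightarrow> \<exists>\<mu>\<in>S. \<exists>I\<subseteq>K. M = (\<lambda>u. \<mu> * u) ` ext I"
    and distinct: "\<And>\<mu> \<mu>' c I I'. \<mu> \<in> S \<Longrightarrow> \<mu>' \<in> S \<Longrightarrow> c \<in> K \<Longrightarrow> c \<noteq> 0 \<Longrightarrow> fractional_ideal K I \<Longrightarrow> fractional_ideal K I' \<Longrightarrow>
      (\<lambda>u. \<mu> * u) ` ext I = (\<lambda>u. c * u) ` (\<lambda>u. \<mu>' * u) ` ext I' \<Longrightarrow> \<mu> = \<mu>'"
  shows "card (integral_form_classes (dihedral n) K \<psi>) = card S * h2 K"
proof -
  let ?G = "dihedral n"
  have OK: "\<O> \<subseteq> K" using O_mem by blast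
  note grpO = group_GL2[OF semiring_sets(2)]
  define r where "r = {(\<phi>, \<phi>'). conjugate_homs ?G (GL2 \<O>) \<phi> \<phi>'}"
  define A where "A = integral_forms ?G K \<psi>"
  have A_hom: "\<phi> \<in> hom ?G (GL2 \<O>)" "conjugate_homs ?G (GL2 K) \<psi> \<phi>" if "\<phi> \<in> A" for \<phi>
    using that by (auto simp: A_def integral_forms_def)
  define Q where "Q \<phi> s \<longleftrightarrow> (\<exists>f I. frame n \<phi> f \<and> fractional_ideal K I \<and>
      lat \<O> f = (\<lambda>u. snd s * u) ` ext I \<and> fst s = ideal_class I \<and> snd s \<in> S)" for \<phi> and s :: "complex set set \<times> complex"
  have "card (A // r) = card (class_group_2_torsion K \<times> S)"
  proof (rule card_quotient_by_invariant[of A r _ Q])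
    fix \<phi> \<phi>' assume \<phi>: "\<phi> \<in> A" "\<phi>' \<in> A"
    show "r `` {\<phi>} = r `` {\<phi>'} \<longleftrightarrow> (\<phi>, \<phi>') \<in> r"
    proof
      assume "r `` {\<phi>} = r `` {\<phi>'}"
      moreover have "(\<phi>', \<phi>') \<in> r" using conjugate_homs_refl[OF grpO] A_hom \<phi> by (auto simp: r_def)
      ultimately show "(\<phi>, \<phi>') \<in> r" by blast
    next
      assume 1: "(\<phi>, \<phi>') \<in> r"
      then have 2: "(\<phi>', \<phi>) \<in> r" using conjugate_homs_sym[OF grpO A_hom(1)[OF \<phi>(1)]] by (auto simp: r_def)
      show "r `` {\<phi>} = r `` {\<phi>'}"
        using 1 2 conjugate_homs_trans[OF grpO A_hom(1)[OF \<phi>(1)]] conjugate_homs_trans[OF grpO A_hom(1)[OF \<phi>(2)]]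
        unfolding r_def by blast
    qed
  next
    fix \<phi> assume \<phi>: "\<phi> \<in> A"
    obtain f where f: "frame n \<phi> f"
      using frame_conjugate[OF semiring_sets(1) order.refl n \<psi> A_hom(2)[OF \<phi>]] by blast
    obtain \<mu> I where I: "\<mu> \<in> S" "I \<subseteq> K" "lat \<O> f = (\<lambda>u. \<mu> * u) ` ext I"
      using classify[OF stable_lattice_frame[OF n A_hom(1)[OF \<phi>] f]] by blast
    have m0: "\<mu> \<noteq> 0" using I(1) S(2) by blast
    have "\<forall>s\<in>K. \<forall>t\<in>K. f $ 1 * s + f $ 2 * t = 0 \<longrightarrow> s = 0 \<and> t = 0" using f by (simp add: frame_def)
    note sq = lattice_square_principal[OF I(2) m0 I(3) this]
    then have "ideal_class I \<in> class_group_2_torsion K" unfolding class_group_2_torsion_eq by blast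
    moreover have "Q \<phi> (ideal_class I, \<mu>)" unfolding Q_def using f sq(1) I by auto
    ultimately show "\<exists>s\<in>class_group_2_torsion K \<times> S. Q \<phi> s" using I(1) by blast
  next
    fix s assume "s \<in> class_group_2_torsion K \<times> S"
    then obtain I D \<mu> where s: "s = (ideal_class I, \<mu>)" "\<mu> \<in> S" and I: "fractional_ideal K I"
      and D: "D \<in> K" "D \<noteq> 0" "frac_ideal_mult I I = (\<lambda>r. D * r) ` \<O>"
      unfolding class_group_2_torsion_eq by blast
    have m0: "\<mu> \<noteq> 0" using s(2) S(2) by blast
    have st: "stable_lattice ((\<lambda>u. \<mu> * u) ` ext I)" by (rule S(1)[OF s(2) I])
    obtain f where f: "lat \<O> f = (\<lambda>u. \<mu> * u) ` ext I" "\<forall>j. f $ j \<in> ext K"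
      "\<forall>s\<in>K. \<forall>t\<in>K. f $ 1 * s + f $ 2 * t = 0 \<longrightarrow> s = 0 \<and> t = 0"
      using lattice_of_square_principal[OF I D(3,2) m0 st] by blast
    obtain \<phi> where \<phi>: "\<phi> \<in> hom ?G (GL2 \<O>)" "frame n \<phi> f"
      using hom_of_stable_lattice[OF n zn f(2,3)] st f(1) by metis
    have f0: "\<forall>j. f0 $ j \<in> ext K" "\<forall>s\<in>K. \<forall>t\<in>K. f0 $ 1 * s + f0 $ 2 * t = 0 \<longrightarrow> s = 0 \<and> t = 0"
      using \<psi>(2) by (simp_all add: frame_def)
    have "conjugate_homs ?G (GL2 K) \<psi> \<phi>"
      using frames_conjugate[OF n semiring_sets(1) order.refl \<psi> hom_GL2_mono[OF OK \<phi>(1)] \<phi>(2)]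
        lattice_ext[OF f0] lattice_ext[OF f(2,3)] f(2) f0(1) by simp
    then have "\<phi> \<in> A" using \<phi>(1) by (simp add: A_def integral_forms_def)
    moreover have "Q \<phi> s" unfolding Q_def using \<phi>(2) I f(1) s by auto
    ultimately show "\<exists>\<phi>\<in>A. Q \<phi> s" by blast
  next
    fix \<phi> \<phi>' s s' assume \<phi>: "\<phi> \<in> A" "\<phi>' \<in> A" and QQ: "Q \<phi> s" "Q \<phi>' s'"
    obtain \<mu> where m: "\<mu> = snd s" by blast
    obtain \<mu>' where m': "\<mu>' = snd s'" by blast
    obtain f I where f: "frame n \<phi> f" "fractional_ideal K I" "lat \<O> f = (\<lambda>u. \<mu> * u) ` ext I"
      "fst s = ideal_class I" "\<mu> \<in> S" using QQ(1) unfolding Q_def m by blast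
    obtain f' I' where f': "frame n \<phi>' f'" "fractional_ideal K I'" "lat \<O> f' = (\<lambda>u. \<mu>' * u) ` ext I'"
      "fst s' = ideal_class I'" "\<mu>' \<in> S" using QQ(2) unfolding Q_def m' by blast
    have I: "0 \<in> I" "I \<subseteq> K" "0 \<in> I'" "I' \<subseteq> K" using f(2) f'(2) by (auto simp: fractional_ideal_def)
    have m0: "\<mu> \<noteq> 0" "\<mu>' \<noteq> 0" using f f' S(2) by auto
    show "(\<phi>, \<phi>') \<in> r \<longleftrightarrow> s = s'"
    proof
      assume "(\<phi>, \<phi>') \<in> r"
      then have c: "conjugate_homs ?G (GL2 \<O>) \<phi> \<phi>'" by (simp add: r_def)
      \<comment> \<open>Conjugation carries f to a frame of \<phi>' with the same span; by
        uniqueness of frames it differs from f' by a scalar in K*, so the two lattices do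
        too.\<close>
      obtain g where g: "frame n \<phi>' g" "lat \<O> g = lat \<O> f"
        using frame_conjugate[OF semiring_sets(2) OK n A_hom(1)[OF \<phi>(1)] f(1) c] by blast
      have "\<phi>' (dih_a n) $ i $ j \<in> K" for i j
        using A_hom(1)[OF \<phi>(2)] dihedral_relations(1)[OF n] GL2_entry O_mem by (auto simp: hom_def Pi_iff)
      then obtain c where c: "c \<in> K" "c \<noteq> 0" "g = c *s f'" using frame_unique[OF _ f'(1) g(1)] by blast
      have eq: "(\<lambda>u. \<mu> * u) ` ext I = (\<lambda>u. c * u) ` (\<lambda>u. \<mu>' * u) ` ext I'"
        using g(2) frame_scale(2)[OF f'(1) c(1,2), of \<O>] f(3) f'(3) c(3) by simp
      have mm: "\<mu> = \<mu>'" by (rule distinct[OF f(5) f'(5) c(1,2) f(2) f'(2) eq])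
      have "(\<lambda>u. \<mu> * u) ` ext I = (\<lambda>u. \<mu> * u) ` ((\<lambda>u. c * u) ` ext I')"
        using eq unfolding mm by (simp add: image_image mult.left_commute)
      moreover have "inj (\<lambda>u. \<mu> * u)" using m0 by (simp add: inj_on_def)
      ultimately have "ext I = (\<lambda>u. c * u) ` ext I'" by (simp add: inj_image_eq_iff)
      then have "ext I = ext ((\<lambda>r. c * r) ` I')" by (simp add: ext_scale[OF c(1)])
      moreover have "0 \<in> (\<lambda>r. c * r) ` I'" "(\<lambda>r. c * r) ` I' \<subseteq> K" using I c by (force, blast)
      ultimately have "I = (\<lambda>r. c * r) ` I'" using ext_inject I by metis
      then have "fst s = fst s'" unfolding f(4) f'(4) ideal_class_eq_iff using c by blast
      then show "s = s'" using mm m m' by (simp add: prod_eq_iff)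
    next
      assume ss: "s = s'"
      then have mm: "\<mu> = \<mu>'" by (simp add: m m')
      have "ideal_class I = ideal_class I'" using ss f f' by simp
      then obtain c where c: "c \<in> K" "c \<noteq> 0" "I = (\<lambda>r. c * r) ` I'" unfolding ideal_class_eq_iff by blast
      have "lat \<O> f = lat \<O> (c *s f')"
        unfolding frame_scale(2)[OF f'(1) c(1,2)] f(3) f'(3) c(3) ext_scale[OF c(1), symmetric] mm
        by (simp add: image_image mult.left_commute)
      then have "conjugate_homs ?G (GL2 \<O>) \<phi> \<phi>'"
        using frames_conjugate[OF n semiring_sets(2) OK A_hom(1)[OF \<phi>(1)] f(1) A_hom(1)[OF \<phi>(2)] frame_scale(1)[OF f'(1) c(1,2)]]
          lattice_base[OF semiring_sets(2)] by metis
      then show "(\<phi>, \<phi>') \<in> r" by (simp add: r_def)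
    qed
  qed
  then show ?thesis
    by (simp add: integral_form_classes_def A_def r_def h2_def card_cartesian_product mult.commute)
qed


lemma card_unramified:
  assumes n: "n > 0" and zn: "\<zeta> ^ n = 1"
    and \<psi>: "\<psi> \<in> hom (dihedral n) (GL2 K)" "frame n \<psi> f0"
    and unit: "inverse (\<tau>\<^sup>2 - 4) \<in> \<O>"
  shows "card (integral_form_classes (dihedral n) K \<psi>) = h2 K"
proof -
  have "card (integral_form_classes (dihedral n) K \<psi>) = card {1 :: complex} * h2 K"
  proof (rule card_integral_form_classes[OF n zn \<psi>])
    show "\<exists>\<mu>\<in>{1}. \<exists>I\<subseteq>K. M = (\<lambda>u. \<mu> * u) ` ext I" if "stable_lattice M" for M
      using unramified_lattice[OF that unit] by (intro bexI[of _ 1] exI[of _ "M \<inter> K"]) simp_all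
  qed (use stable_lattice_ext in auto)
  then show ?thesis by simp
qed

text \<open>Stated for a general multiplier m so that it applies both with 1 - \<zeta> and with 1 +
  \<zeta>, which is \<open>lam\<close> formed for -\<zeta>.\<close>

lemma card_ramified_aux:
  assumes n: "n > 0" and zn: "\<zeta> ^ n = 1"
    and \<psi>: "\<psi> \<in> hom (dihedral n) (GL2 K)" "frame n \<psi> f0"
    and m: "m \<noteq> 0" "m \<noteq> 1"
    and st: "\<And>I. fractional_ideal K I \<Longrightarrow> stable_lattice ((\<lambda>u. m * u) ` ext I)"
    and classify: "\<And>M. stable_lattice M \<Longrightarrow> \<exists>I\<subseteq>K. M = ext I \<or> M = (\<lambda>u. m * u) ` ext I"
    and distinct: "\<And>c I I'. c \<in> K \<Longrightarrow> c \<noteq> 0 \<Longrightarrow> fractional_ideal K I \<Longrightarrow> fractional_ideal K I' \<Longrightarrow>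
      ext I \<noteq> (\<lambda>u. c * (m * u)) ` ext I'"
  shows "card (integral_form_classes (dihedral n) K \<psi>) = 2 * h2 K"
proof -
  have "card (integral_form_classes (dihedral n) K \<psi>) = card {1, m} * h2 K"
  proof (rule card_integral_form_classes[OF n zn \<psi>])
    show "\<exists>\<mu>\<in>{1, m}. \<exists>I\<subseteq>K. M = (\<lambda>u. \<mu> * u) ` ext I" if "stable_lattice M" for M
      using classify[OF that] by auto
    show "stable_lattice ((\<lambda>u. \<mu> * u) ` ext I)" if "\<mu> \<in> {1, m}" "fractional_ideal K I" for \<mu> I
      using that st stable_lattice_ext(1) by auto
    show "0 \<notin> {1, m}" using m by simp
    fix \<mu> \<mu>' c I I'
    assume a: "\<mu> \<in> {1, m}" "\<mu>' \<in> {1, m}" "c \<in> K" "c \<noteq> 0" "fractional_ideal K I" "fractional_ideal K I'"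
      "(\<lambda>u. \<mu> * u) ` ext I = (\<lambda>u. c * u) ` (\<lambda>u. \<mu>' * u) ` ext I'"
    show "\<mu> = \<mu>'"
    proof (rule ccontr)
      assume "\<mu> \<noteq> \<mu>'"
      then consider "\<mu> = 1" "\<mu>' = m" | "\<mu> = m" "\<mu>' = 1" using a(1,2) by blast
      then show False
      proof cases
        case 1
        then show False using distinct[OF a(3-6)] a(7) by (simp add: image_image)
      next
        case 2
        have "(\<lambda>u. inverse c * u) ` (\<lambda>u. m * u) ` ext I = (\<lambda>u. inverse c * u) ` (\<lambda>u. c * u) ` ext I'"
          using a(7) 2 by (simp add: image_image)
        then have "(\<lambda>u. inverse c * (m * u)) ` ext I = ext I'"
          using a(4) by (simp add: image_image mult.assoc[symmetric])
        then show False using distinct[OF inverse_mem[OF a(3)] _ a(6,5)] a(4) by simp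
      qed
    qed
  qed
  then show ?thesis using m by simp
qed

lemma rotation_field_uminus: "rotation_field K (- \<zeta>)"
proof
  show "cnj x = x" if "x \<in> K" for x using that by (rule cnj_mem)
  show "- \<zeta> + cnj (- \<zeta>) \<in> K" using uminus_mem[OF trace_mem] by simp
qed (use z_nonreal z_cnj z_algebraic_int in auto)

text \<open>Changing the sign of \<zeta> alters neither the stable lattices nor \<open>ext I\<close>
  for I closed under negation, so the classification for -\<zeta> can be read as one for
  \<zeta>.\<close>

lemma card_ramified:
  assumes "n > 0" "\<zeta> ^ n = 1" "\<psi> \<in> hom (dihedral n) (GL2 K)" "frame n \<psi> f0"
    and ram: "ramified_rotation_field K \<zeta> p N \<or> ramified_rotation_field K (- \<zeta>) p N"
  shows "card (integral_form_classes (dihedral n) K \<psi>) = 2 * h2 K"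
  using ram
proof
  assume "ramified_rotation_field K \<zeta> p N"
  then interpret ramified_rotation_field K \<zeta> p N .
  show ?thesis
  proof (rule card_ramified_aux[OF assms(1-4) lambda_nz])
    show "lam \<noteq> 1" using z_cnj by (auto simp: lam_def)
    show "\<exists>I\<subseteq>K. M = ext I \<or> M = (\<lambda>u. lam * u) ` ext I" if "stable_lattice M" for M
      using ramified_lattice[OF that] by metis
  qed (use stable_lattice_ext ext_ne_lambda_ext in auto)
next
  assume "ramified_rotation_field K (- \<zeta>) p N"
  then interpret N: ramified_rotation_field K "- \<zeta>" p N .
  have ext_eq: "N.ext I = ext I" if I: "\<forall>x\<in>I. - x \<in> I" for I
  proof (intro equalityI subsetI)
    fix u assume "u \<in> N.ext I"
    then obtain x y where "u = x + (- y) * \<zeta>" "x \<in> I" "y \<in> I" unfolding N.ext_def by auto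
    then show "u \<in> ext I" using I extI by blast
  next
    fix u assume "u \<in> ext I"
    then obtain x y where "u = x + (- y) * (- \<zeta>)" "x \<in> I" "y \<in> I" unfolding ext_def by auto
    then show "u \<in> N.ext I" using I N.extI by blast
  qed
  have extK: "N.ext K = ext K" using ext_eq uminus_mem by blast
  have stable_eq: "N.stable_lattice M \<longleftrightarrow> stable_lattice M" for M
  proof -
    have "(\<forall>u\<in>M. - \<zeta> * u \<in> M) \<longleftrightarrow> (\<forall>u\<in>M. \<zeta> * u \<in> M)" if "\<forall>r\<in>\<O>. \<forall>u\<in>M. r * u \<in> M"
    proof -
      have "- u \<in> M" if "u \<in> M" for u
        using \<open>\<forall>r\<in>\<O>. \<forall>u\<in>M. r * u \<in> M\<close> O_uminus[OF O_one] that by fastforce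
      then show ?thesis by (metis minus_minus mult_minus_left)
    qed
    then show ?thesis unfolding N.stable_lattice_def stable_lattice_def extK by blast
  qed
  have frac_neg: "\<forall>x\<in>I. - x \<in> I" if "fractional_ideal K I" for I
    using fractional_idealD(5)[OF that] by blast
  show ?thesis
  proof (rule card_ramified_aux[OF assms(1-4) N.lambda_nz])
    show "N.lam \<noteq> 1" using z_cnj by (auto simp: N.lam_def)
    show "stable_lattice ((\<lambda>u. N.lam * u) ` ext I)" if "fractional_ideal K I" for I
      using N.stable_lattice_ext(2)[OF that] ext_eq[OF frac_neg[OF that]] stable_eq by simp
    show "\<exists>I\<subseteq>K. M = ext I \<or> M = (\<lambda>u. N.lam * u) ` ext I" if "stable_lattice M" for M
      using N.ramified_lattice[of M] that ext_eq unfolding stable_eq by metis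
    show "ext I \<noteq> (\<lambda>u. c * (N.lam * u)) ` ext I'"
      if "c \<in> K" "c \<noteq> 0" "fractional_ideal K I" "fractional_ideal K I'" for c I I'
      using N.ext_ne_lambda_ext[OF that(3,4,1,2)] ext_eq[OF frac_neg[OF that(3)]] ext_eq[OF frac_neg[OF that(4)]]
      by simp
  qed
qed

lemma card_by_order:
  assumes n: "n \<ge> 3" and z: "primitive_root_of_unity n \<zeta>" and K: "K \<subseteq> int_fractions \<tau>"
    and \<psi>: "\<psi> \<in> hom (dihedral n) (GL2 K)" "frame n \<psi> f0"
  shows "card (integral_form_classes (dihedral n) K \<psi>) =
    (if primepow n \<or> (\<exists>q. primepow q \<and> n = 2 * q) then 2 * h2 K else h2 K)"
proof (cases "primepow n \<or> (\<exists>q. primepow q \<and> n = 2 * q)")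
  case False
  have "\<zeta> ^ n = 1" using z by (simp add: primitive_root_of_unity_def)
  then have "card (integral_form_classes (dihedral n) K \<psi>) = h2 K"
    using card_unramified[OF _ _ \<psi> disc_unit[OF z n False]] n by simp
  then show ?thesis unfolding if_not_P[OF False] .
next
  case True
  have pow: "\<zeta> ^ k = 1 \<longleftrightarrow> n dvd k" for k using primitive_root_power_eq_1_iff[OF z] n by simp
  have "\<exists>p N. ramified_rotation_field K \<zeta> p N \<or> ramified_rotation_field K (- \<zeta>) p N"
  proof (cases "primepow n")
    case True
    then obtain p k where p: "prime p" "k > 0" "n = p ^ k" unfolding primepow_def by blast
    then obtain j where "k = Suc j" using gr0_implies_Suc by blast
    then show ?thesis using ramified[of p j] p z n K by blast
  next
    case False
    then obtain p k where p: "prime p" "k > 0" and nq: "n = 2 * p ^ k"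
      using True unfolding primepow_def by blast
    \<comment> \<open>For p = 2, n itself would be a power of 2, which belongs to the other case.
      Hence p^k is odd, and -\<zeta> has this order.\<close>
    have "p \<noteq> 2"
    proof
      assume "p = 2"
      then have "n = 2 ^ Suc k" using nq by simp
      then show False using False unfolding primepow_def by (metis two_is_prime_nat zero_less_Suc)
    qed
    then have odd: "odd (p ^ k)" using p prime_odd_nat[of p] prime_ge_2_nat[of p] by auto
    define q where "q = p ^ k"
    have oddq: "odd q" using odd by (simp add: q_def)
    have nq': "n = 2 * q" using nq by (simp add: q_def)
    have q3: "q \<ge> 3" using oddq n unfolding nq' by presburger
    have half: "\<zeta> ^ q = -1"
    proof -
      have "(\<zeta> ^ q)\<^sup>2 = 1" using pow[of "q * 2"] nq' by (simp flip: power_mult)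
      moreover have "\<zeta> ^ q \<noteq> 1" using pow[of q] nq' q3 by (auto dest: dvd_imp_le)
      ultimately show ?thesis by (simp add: power2_eq_1_iff)
    qed
    have "primitive_root_of_unity q (- \<zeta>)"
    proof (rule primitive_root_of_unityI)
      fix i
      have q2: "(- \<zeta>) ^ q = 1" using half oddq by simp
      show "(- \<zeta>) ^ i = 1 \<longleftrightarrow> q dvd i"
      proof
        assume "(- \<zeta>) ^ i = 1"
        then have "((- \<zeta>)\<^sup>2) ^ i = 1" by (metis power_mult mult.commute power_one)
        then have "2 * q dvd 2 * i" using pow[of "2 * i"] nq by (simp add: q_def power_mult)
        then show "q dvd i" by simp
      next
        assume "q dvd i"
        then show "(- \<zeta>) ^ i = 1" using q2 by (auto simp: power_mult)
      qed
    qed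
    moreover obtain j where "k = Suc j" using p gr0_implies_Suc by blast
    moreover have "K \<subseteq> int_fractions (rotation_field.\<tau> (- \<zeta>))"
    proof
      fix x assume "x \<in> K"
      then obtain M F where M: "M \<noteq> 0" "of_int M * x = poly (of_int_poly F) \<tau>" using K unfolding int_fractions_def by blast
      have "rotation_field.\<tau> (- \<zeta>) = - \<tau>"
        using rotation_field.\<tau>_def[OF rotation_field_uminus] by (simp add: \<tau>_def)
      then have "of_int M * x = poly (of_int_poly (pcompose F [:0, -1:])) (rotation_field.\<tau> (- \<zeta>))"
        using M by (simp add: of_int_hom.map_poly_pcompose poly_pcompose of_int_hom.map_poly_pCons_hom)
      then show "x \<in> int_fractions (rotation_field.\<tau> (- \<zeta>))" using M(1) int_fractionsI by blast
    qed
    ultimately show ?thesis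
      using rotation_field.ramified[OF rotation_field_uminus, of p j] p(1) q3 unfolding q_def by blast
  qed
  moreover have "\<zeta> ^ n = 1" using pow by simp
  ultimately show ?thesis using card_ramified[OF _ _ \<psi>] n True by auto
qed

end


section \<open>Eigenvectors of a faithful irreducible representation\<close>

lemma (in number_field) hom_GL2_facts:
  assumes n: "n > 0" and \<psi>: "\<psi> \<in> hom (dihedral n) (GL2 K)"
  shows "g \<in> carrier (dihedral n) \<Longrightarrow> \<psi> g $ i $ j \<in> K"
    and "g \<in> carrier (dihedral n) \<Longrightarrow> h \<in> carrier (dihedral n) \<Longrightarrow> \<psi> (g \<otimes>\<^bsub>dihedral n\<^esub> h) = \<psi> g ** \<psi> h"
    and "\<psi> \<one>\<^bsub>dihedral n\<^esub> = mat 1"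
  using \<psi> GL2_entry hom_mult[OF \<psi>] hom_one[OF \<psi> group_dihedral[OF n] group_GL2[OF semiring_sets(1)]]
  by (auto simp: hom_def Pi_iff GL2_simps)

text \<open>The annihilator of a common row eigenvector is a line of column vectors stable under the
  whole group.\<close>

lemma (in number_field) irreducible_no_eigenrow:
  fixes w :: "complex^2"
  assumes n: "n > 0" and \<psi>: "\<psi> \<in> hom (dihedral n) (GL2 K)" and irr: "irreducible_rep (dihedral n) K \<psi>"
    and w: "w \<noteq> 0" "\<And>j. w $ j \<in> K" "w v* \<psi> (dih_a n) = c *s w" "w v* \<psi> dih_b = c' *s w"
  shows False
proof -
  let ?G = "dihedral n"
  interpret G: group ?G by (rule group_dihedral[OF n])
  note rel = dihedral_relations[OF n]
  note ent = hom_GL2_facts(1)[OF n \<psi>] and mult = hom_GL2_facts(2)[OF n \<psi>] and one = hom_GL2_facts(3)[OF n \<psi>]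
  define V where "V = {v :: complex^2. (\<forall>i. v $ i \<in> K) \<and> w $ 1 * v $ 1 + w $ 2 * v $ 2 = 0}"
  have "K_subspace K V"
    unfolding K_subspace_def
  proof (intro conjI ballI)
    show "v + u \<in> V" if "v \<in> V" "u \<in> V" for v u
    proof -
      have "w $ 1 * (v $ 1 + u $ 1) + w $ 2 * (v $ 2 + u $ 2) =
          (w $ 1 * v $ 1 + w $ 2 * v $ 2) + (w $ 1 * u $ 1 + w $ 2 * u $ 2)" by (simp add: algebra_simps)
      then show ?thesis using that by (auto simp: V_def)
    qed
    show "d *s v \<in> V" if "d \<in> K" "v \<in> V" for d v
    proof -
      have "w $ 1 * (d * v $ 1) + w $ 2 * (d * v $ 2) = d * (w $ 1 * v $ 1 + w $ 2 * v $ 2)"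
        by (simp add: algebra_simps)
      then show ?thesis using that by (auto simp: V_def)
    qed
  qed (auto simp: V_def)
  moreover have "\<psi> g *v v \<in> V" if g: "g \<in> carrier ?G" and v: "v \<in> V" for g v
  proof -
    have pow: "\<exists>d. w v* \<psi> (dih_a n [^]\<^bsub>?G\<^esub> k) = d *s w" for k :: nat
    proof (induction k)
      case 0
      then show ?case by (intro exI[of _ 1]) (simp add: one)
    next
      case (Suc k)
      then obtain d where "w v* \<psi> (dih_a n [^]\<^bsub>?G\<^esub> k) = d *s w" by blast
      then have "w v* \<psi> (dih_a n [^]\<^bsub>?G\<^esub> Suc k) = (d * c) *s w"
        using rel(1) w(3) by (simp add: mult scalar_vector_matrix_assoc flip: vector_matrix_mul_assoc)
      then show ?case by blast
    qed
    obtain i s where gis: "g = (i, s)" by (cases g)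
    obtain d where d: "w v* \<psi> (dih_a n [^]\<^bsub>?G\<^esub> nat i) = d *s w" using pow by blast
    have "\<exists>e. w v* \<psi> g = e *s w"
    proof (cases s)
      case True
      have g_eq: "g = dih_a n [^]\<^bsub>?G\<^esub> nat i \<otimes>\<^bsub>?G\<^esub> dih_b"
        using dihedral_normal_form[OF g[unfolded gis]] True gis by simp
      have "w v* \<psi> g = (d * c') *s w"
        unfolding g_eq using rel(1,2) w(4) d
        by (simp add: mult scalar_vector_matrix_assoc flip: vector_matrix_mul_assoc)
      then show ?thesis by blast
    next
      case False
      have "g = dih_a n [^]\<^bsub>?G\<^esub> nat i"
        using dihedral_normal_form[OF g[unfolded gis]] False gis rel(1) by simp
      then show ?thesis using d by blast
    qed
    then obtain e where e: "w v* \<psi> g = e *s w" by blast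
    have "w $ 1 * (\<psi> g *v v) $ 1 + w $ 2 * (\<psi> g *v v) $ 2 =
        (w v* \<psi> g) $ 1 * v $ 1 + (w v* \<psi> g) $ 2 * v $ 2"
      by (simp add: matrix_vector_mult_def vector_matrix_2 sum_2 algebra_simps)
    also have "\<dots> = e * (w $ 1 * v $ 1 + w $ 2 * v $ 2)" by (simp add: e algebra_simps)
    also have "\<dots> = 0" using v by (simp add: V_def)
    finally have "w $ 1 * (\<psi> g *v v) $ 1 + w $ 2 * (\<psi> g *v v) $ 2 = 0" .
    moreover have "(\<psi> g *v v) $ i \<in> K" for i
    proof -
      have vK: "v $ j \<in> K" for j using v by (simp add: V_def)
      have "(\<psi> g *v v) $ i = \<psi> g $ i $ 1 * v $ 1 + \<psi> g $ i $ 2 * v $ 2"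
        by (simp add: matrix_vector_mult_def sum_2)
      also have "\<dots> \<in> K" by (intro add_mem mult_mem ent[OF g] vK)
      finally show ?thesis .
    qed
    ultimately show ?thesis unfolding V_def by blast
  qed
  ultimately have "V = {0} \<or> V = {v. \<forall>i. v $ i \<in> K}" using irr unfolding irreducible_rep_def by blast
  moreover have "V \<noteq> {0}"
  proof -
    define v :: "complex^2" where "v = (\<chi> i. if i = 1 then w $ 2 else - w $ 1)"
    have "v \<in> V" using w(2) by (auto simp: V_def v_def)
    moreover have "v \<noteq> 0" using w(1) by (auto simp: v_def vec_eq_iff forall_2)
    ultimately show ?thesis by blast
  qed
  moreover have "V \<noteq> {v. \<forall>i. v $ i \<in> K}"
  proof
    assume V: "V = {v. \<forall>i. v $ i \<in> K}"
    define e1 :: "complex^2" where "e1 = (\<chi> i. if i = 1 then 1 else 0)"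
    define e2 :: "complex^2" where "e2 = (\<chi> i. if i = 1 then 0 else 1)"
    have "e1 \<in> V" "e2 \<in> V" unfolding V by (auto simp: e1_def e2_def)
    then have "w $ 1 = 0" "w $ 2 = 0" by (auto simp: V_def e1_def e2_def)
    then show False using w(1) by (simp add: vec_eq_iff forall_2)
  qed
  ultimately show False by blast
qed

text \<open>If \<open>w B = - w\<close> and \<open>u = w A\<close>, the relations force \<open>u A = \<alpha> u - w\<close>; then \<open>u - \<zeta>\<^sup>-\<^sup>1 w\<close> is an eigenvector for
  each root \<open>\<zeta>\<close> of \<open>X\<^sup>2 - \<alpha> X + 1\<close>.\<close>

lemma faithful_irreducible_frame:
  assumes n: "n \<ge> 3" and x: "primitive_root_of_unity n \<xi>" and K: "K = rat_adjoin (\<xi> + inverse \<xi>)"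
    and \<psi>: "\<psi> \<in> hom (dihedral n) (GL2 K)" and inj: "inj_on \<psi> (carrier (dihedral n))"
    and irr: "irreducible_rep (dihedral n) K \<psi>"
  obtains \<zeta> f where "primitive_root_of_unity n \<zeta>" "rotation_field K \<zeta>" "rotation_field.frame K \<zeta> n \<psi> f"
proof -
  let ?G = "dihedral n"
  have n0: "n > 0" using n by simp
  have "rotation_field K \<xi>"
    unfolding K by (rule rotation_field_real_subfield[OF x x n])
      (simp add: primitive_root_basics(3)[OF x n] rat_adjoin_base)
  then interpret X: rotation_field K \<xi> .
  interpret G: group ?G by (rule group_dihedral[OF n0])
  note rel = dihedral_relations[OF n0]
  define A where "A = \<psi> (dih_a n)"
  define B where "B = \<psi> dih_b"
  note ent = X.hom_GL2_facts(1)[OF n0 \<psi>] and mult = X.hom_GL2_facts(2)[OF n0 \<psi>]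
    and one = X.hom_GL2_facts(3)[OF n0 \<psi>]
  have AK: "A $ i $ j \<in> K" and BK: "B $ i $ j \<in> K" for i j using ent rel by (auto simp: A_def B_def)
  have faithful: "g = \<one>\<^bsub>?G\<^esub>" if "g \<in> carrier ?G" "\<psi> g = mat 1" for g
    using inj_onD[OF inj _ that(1) G.one_closed] that one by simp
  have bb: "dih_b \<otimes>\<^bsub>?G\<^esub> dih_b = \<one>\<^bsub>?G\<^esub>" using rel(2,4) by (simp add: numeral_2_eq_2)
  have BB: "B ** B = mat 1" using mult[OF rel(2,2)] bb one by (simp add: B_def)
  have "dih_b \<otimes>\<^bsub>?G\<^esub> dih_a n \<otimes>\<^bsub>?G\<^esub> dih_b \<otimes>\<^bsub>?G\<^esub> dih_a n = \<one>\<^bsub>?G\<^esub>" using rel by simp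
  then have "\<psi> (dih_b \<otimes>\<^bsub>?G\<^esub> dih_a n \<otimes>\<^bsub>?G\<^esub> dih_b \<otimes>\<^bsub>?G\<^esub> dih_a n) = mat 1" using one by simp
  then have BABA: "B ** A ** B ** A = mat 1" using rel(1,2) by (simp add: mult A_def B_def)
  have no_eigenrow: False if "w \<noteq> 0" "\<And>j. w $ j \<in> K" "w v* A = c *s w" "w v* B = c' *s w" for w c c'
    by (rule X.irreducible_no_eigenrow[OF n0 \<psi> irr that(1,2) that(3,4)[unfolded A_def B_def]])
  have "B \<noteq> mat 1"
  proof
    assume "B = mat 1"
    then have "dih_b = \<one>\<^bsub>?G\<^esub>" using faithful[OF rel(2)] by (simp add: B_def)
    then show False by (simp add: dih_b_def dihedral_simps)
  qed
  then obtain i0 j0 where ij: "B $ i0 $ j0 \<noteq> (mat 1 :: complex^2^2) $ i0 $ j0" by (auto simp: vec_eq_iff)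
  \<comment> \<open>A nonzero row of B - 1; since B^2 = 1, it satisfies w B = -w.\<close>
  define w :: "complex^2" where "w = (\<chi> j. B $ i0 $ j - (mat 1 :: complex^2^2) $ i0 $ j)"
  have w0: "w \<noteq> 0" using ij by (auto simp: w_def vec_eq_iff)
  have wK: "w $ j \<in> K" for j using BK by (auto simp: w_def mat_def)
  have wB: "w v* B = - w"
  proof -
    have "(w v* B) $ j = (B ** B) $ i0 $ j - B $ i0 $ j" for j
      using exhaust_2[of i0] by (auto simp: vector_matrix_2 w_def matrix_matrix_mult_def sum_2 mat_def algebra_simps)
    then show ?thesis unfolding BB by (simp add: vec_eq_iff w_def)
  qed
  define u where "u = w v* A"
  have uK: "u $ j \<in> K" for j unfolding u_def vector_matrix_2 by (intro X.add_mem X.mult_mem wK AK)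
  define D where "D = u $ 1 * w $ 2 - u $ 2 * w $ 1"
  \<comment> \<open>If u were proportional to w, then w would be a common row eigenvector of A and
    B.\<close>
  have D0: "D \<noteq> 0"
  proof
    assume 0: "D = 0"
    have "\<exists>c. u = c *s w"
    proof (cases "w $ 1 = 0")
      case True
      then have "w $ 2 \<noteq> 0" using w0 by (simp add: vec_eq_iff forall_2)
      moreover have "u $ 1 = 0" using 0 True \<open>w $ 2 \<noteq> 0\<close> by (simp add: D_def)
      ultimately show ?thesis using True by (intro exI[of _ "u $ 2 / w $ 2"]) (simp add: vec_eq_iff forall_2)
    next
      case False
      then show ?thesis using 0
        by (intro exI[of _ "u $ 1 / w $ 1"]) (simp add: vec_eq_iff forall_2 D_def field_simps)
    qed
    then obtain c where "w v* A = c *s w" by (auto simp: u_def)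
    moreover have "w v* B = (-1) *s w" using wB by simp
    ultimately show False using no_eigenrow[OF w0 wK] by blast
  qed
  have cramer: "v = ((v $ 1 * w $ 2 - v $ 2 * w $ 1) / D) *s u + ((u $ 1 * v $ 2 - u $ 2 * v $ 1) / D) *s w" for v :: "complex^2"
  proof -
    have "D * v $ 1 = (v $ 1 * w $ 2 - v $ 2 * w $ 1) * u $ 1 + (u $ 1 * v $ 2 - u $ 2 * v $ 1) * w $ 1"
      "D * v $ 2 = (v $ 1 * w $ 2 - v $ 2 * w $ 1) * u $ 2 + (u $ 1 * v $ 2 - u $ 2 * v $ 1) * w $ 2"
      by (simp_all add: D_def algebra_simps)
    then show ?thesis using D0 by (simp add: vec_eq_iff forall_2 field_simps)
  qed
  have indep: "p = 0 \<and> q = 0" if "p *s u + q *s w = 0" for p q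
  proof -
    have e: "p * u $ 1 + q * w $ 1 = 0" "p * u $ 2 + q * w $ 2 = 0" using that by (auto simp: vec_eq_iff)
    have "D * p = w $ 2 * (p * u $ 1 + q * w $ 1) - w $ 1 * (p * u $ 2 + q * w $ 2)"
      "D * q = u $ 1 * (p * u $ 2 + q * w $ 2) - u $ 2 * (p * u $ 1 + q * w $ 1)"
      by (simp_all add: D_def algebra_simps)
    then show ?thesis unfolding e using D0 by simp
  qed
  have fixed: "M = mat 1" if M: "u v* M = u" "w v* M = w" for M :: "complex^2^2"
  proof -
    have "v v* M = v" for v
      by (subst (1 2) cramer[of v]) (simp add: vector_matrix_left_distrib scalar_vector_matrix_assoc M)
    then have v: "v v* M = v v* mat 1" for v by simp
    define e1 :: "complex^2" where "e1 = (\<chi> i. if i = 1 then 1 else 0)"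
    define e2 :: "complex^2" where "e2 = (\<chi> i. if i = 1 then 0 else 1)"
    show ?thesis using v[of e1] v[of e2] by (simp add: vec_eq_iff vector_matrix_2 forall_2 e1_def e2_def mat_def)
  qed
  define \<alpha> where "\<alpha> = ((u v* A) $ 1 * w $ 2 - (u v* A) $ 2 * w $ 1) / D"
  define \<beta> where "\<beta> = (u $ 1 * (u v* A) $ 2 - u $ 2 * (u v* A) $ 1) / D"
  have uA: "u v* A = \<alpha> *s u + \<beta> *s w" unfolding \<alpha>_def \<beta>_def by (rule cramer)
  have alK: "\<alpha> \<in> K" unfolding \<alpha>_def D_def vector_matrix_2
    by (intro X.divide_mem X.diff_mem X.add_mem X.mult_mem uK wK AK)
  have row_neg: "(- v) v* M = - (v v* M)" and row_diff: "(v - v') v* M = v v* M - v' v* M"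
    for v v' :: "complex^2" and M :: "complex^2^2"
    by (simp_all add: vec_eq_iff vector_matrix_2 algebra_simps)
  obtain p q where uB: "u v* B = p *s u + q *s w" using cramer by blast
  \<comment> \<open>The relation B A B A = 1 applied to w, where w B = -w and w A = u.\<close>
  have "u v* B v* A = - w"
  proof -
    have "- (u v* B v* A) = w v* B v* A v* B v* A" by (simp add: wB row_neg u_def)
    also have "\<dots> = w" by (simp add: vector_matrix_mul_assoc matrix_mul_assoc BABA)
    finally show ?thesis by (metis minus_minus)
  qed
  then have "(p * \<alpha> + q) *s u + (p * \<beta> + 1) *s w = 0"
    unfolding uB by (simp add: vector_matrix_left_distrib scalar_vector_matrix_assoc uA flip: u_def)
      (simp add: vec_eq_iff algebra_simps)
  then have 1: "p * \<alpha> + q = 0" "p * \<beta> + 1 = 0" using indep by blast+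
  have "u v* B v* B = u" by (simp add: vector_matrix_mul_assoc BB)
  then have "(p * p - 1) *s u + (p * q - q) *s w = 0"
    unfolding uB by (simp add: vector_matrix_left_distrib scalar_vector_matrix_assoc uB wB)
      (simp add: vec_eq_iff algebra_simps)
  then have 2: "p * p = 1" "p * q = q" using indep by fastforce+
  \<comment> \<open>The other sign forces \<alpha> = 0 and u A = w, hence A^2 = 1, against
    faithfulness for n \<ge> 3.\<close>
  have "p = 1"
  proof (rule ccontr)
    assume "p \<noteq> 1"
    then have "p = -1" "q = 0" using 2 by (auto simp: square_eq_1_iff)
    then have "\<alpha> = 0" "\<beta> = 1" using 1 by auto
    then have "u v* A = w" using uA by simp
    then have "A ** A = mat 1" by (intro fixed) (simp_all flip: vector_matrix_mul_assoc u_def)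
    then have "dih_a n \<otimes>\<^bsub>?G\<^esub> dih_a n = \<one>\<^bsub>?G\<^esub>"
      using faithful[of "dih_a n \<otimes>\<^bsub>?G\<^esub> dih_a n"] rel(1) by (simp add: mult A_def)
    then show False using n by (simp add: dih_a_def dihedral_simps)
  qed
  then have bq: "\<beta> = -1" "q = - \<alpha>" using 1 by (auto simp: add_eq_0_iff2)
  \<comment> \<open>A root of X^2 - \<alpha> X + 1; the other root \<open>\<zeta>'\<close> is its
    inverse and turns out to be its conjugate once \<zeta> is known to be a root of unity.\<close>
  define \<zeta> where "\<zeta> = (\<alpha> + csqrt (\<alpha>\<^sup>2 - 4)) / 2"
  define \<zeta>' where "\<zeta>' = \<alpha> - \<zeta>"
  have zz: "\<zeta> * \<zeta>' = 1"
  proof -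
    have "4 * (\<zeta> * \<zeta>') = \<alpha>\<^sup>2 - (csqrt (\<alpha>\<^sup>2 - 4))\<^sup>2"
      by (simp add: \<zeta>_def \<zeta>'_def power2_eq_square field_simps)
    then show ?thesis by simp
  qed
  have al: "\<alpha> = \<zeta> + \<zeta>'" by (simp add: \<zeta>'_def)
  define f where "f = u - \<zeta>' *s w"
  define f' where "f' = u - \<zeta> *s w"
  have fA: "f v* A = \<zeta> *s f" "f' v* A = \<zeta>' *s f'"
  proof -
    have "f v* A = \<alpha> *s u - w - \<zeta>' *s u" "f' v* A = \<alpha> *s u - w - \<zeta> *s u"
      by (simp_all add: f_def f'_def row_diff scalar_vector_matrix_assoc uA bq flip: u_def)
    then show "f v* A = \<zeta> *s f" "f' v* A = \<zeta>' *s f'"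
      using zz by (simp_all add: al f_def f'_def vec_eq_iff algebra_simps)
  qed
  have fB: "f v* B = f'"
    by (simp add: f_def f'_def row_diff scalar_vector_matrix_assoc uB bq \<open>p = 1\<close> wB)
      (simp add: vec_eq_iff al algebra_simps)
  have f0: "f \<noteq> 0" "f' \<noteq> 0"
    using indep[of 1 "- \<zeta>'"] indep[of 1 "- \<zeta>"] by (auto simp: f_def f'_def)
  have powf: "v v* \<psi> (dih_a n [^]\<^bsub>?G\<^esub> k) = d ^ k *s v" if "v v* A = d *s v" for v d and k :: nat
  proof (induction k)
    case 0
    then show ?case by (simp add: one)
  next
    case (Suc k)
    then show ?case
      using rel(1) that
      by (simp add: mult scalar_vector_matrix_assoc mult.commute flip: vector_matrix_mul_assoc A_def)
  qed
  have zn: "\<zeta> ^ n = 1"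
  proof -
    have "\<zeta> ^ n *s f = f" using powf[OF fA(1), of n] rel(3) by (simp add: one)
    moreover obtain j where "f $ j \<noteq> 0" using f0 by (auto simp: vec_eq_iff)
    ultimately show ?thesis by (auto simp: vec_eq_iff)
  qed
  \<comment> \<open>A double root \<zeta> = \<alpha> / 2 would lie in K, and f would be a common row
    eigenvector with entries in K.\<close>
  have zne: "\<zeta> \<noteq> \<zeta>'"
  proof
    assume eq: "\<zeta> = \<zeta>'"
    then have half: "\<zeta> = \<alpha> / 2" using al by simp
    have zK: "\<zeta> \<in> K" by (subst half) (use X.divide_mem[OF alK X.of_int_mem[of 2]] in simp)
    have "f $ j \<in> K" for j using uK wK zK eq by (auto simp: f_def)
    moreover have "f v* B = 1 *s f" using fB eq by (simp add: f_def f'_def)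
    ultimately show False using no_eigenrow[OF f0(1) _ fA(1)] by blast
  qed
  have prim: "primitive_root_of_unity n \<zeta>"
    unfolding primitive_root_of_unity_def
  proof (intro conjI allI impI notI zn)
    fix m assume m: "0 < m \<and> m < n" and zm: "\<zeta> ^ m = 1"
    have "\<zeta>' ^ m = 1" using zz zm by (metis mult_1 power_mult_distrib power_one)
    \<comment> \<open>If \<zeta>^m = 1, the image of a^m fixes f and f', hence u and w, so it is the
      identity; faithfulness then makes a^m trivial.\<close>
    define M where "M = \<psi> (dih_a n [^]\<^bsub>?G\<^esub> m)"
    have ff: "f v* M = f" "f' v* M = f'"
      using powf[OF fA(1), of m] powf[OF fA(2), of m] zm \<open>\<zeta>' ^ m = 1\<close> by (simp_all add: M_def)
    have diff: "f - f' = (\<zeta> - \<zeta>') *s w" by (simp add: vec_eq_iff f_def f'_def algebra_simps)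
    have w_eq: "w = (1 / (\<zeta> - \<zeta>')) *s (f - f')"
      unfolding diff vector_smult_assoc using zne by simp
    have wM: "w v* M = w"
      by (subst (1 2) w_eq) (simp add: scalar_vector_matrix_assoc row_diff ff)
    have u_eq: "u = f + \<zeta>' *s w" by (simp add: f_def)
    have "u v* M = u" by (subst (1 2) u_eq) (simp add: vector_matrix_left_distrib scalar_vector_matrix_assoc ff wM)
    then have "M = mat 1" using wM fixed by blast
    then have "dih_a n [^]\<^bsub>?G\<^esub> m = \<one>\<^bsub>?G\<^esub>" using faithful[of "dih_a n [^]\<^bsub>?G\<^esub> m"] rel(1) by (simp add: M_def)
    then show False using m by (simp add: dih_a_pow dihedral_simps)
  qed
  have cz: "cnj \<zeta> = \<zeta>'"
    using primitive_root_basics(2,5)[OF prim n] zz by (metis mult_left_cancel)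
  have rot: "rotation_field K \<zeta>"
    unfolding K by (rule rotation_field_real_subfield[OF prim x n]) (use alK cz al K in simp)
  then interpret Z: rotation_field K \<zeta> .
  have "Z.frame n \<psi> f"
    unfolding Z.frame_def
  proof (intro conjI ballI allI impI)
    \<comment> \<open>Substituting \<alpha> - \<zeta> for \<open>\<zeta>'\<close> exhibits the
      coordinates of f in 1 and \<zeta>, which lie in K.\<close>
    have fj: "f $ j = (u $ j - \<alpha> * w $ j) + w $ j * \<zeta>" for j
      by (simp add: f_def al algebra_simps)
    show "f $ j \<in> Z.ext K" for j unfolding fj using uK wK alK by (auto intro!: Z.extI)
    show "f v* \<psi> (dih_a n) = \<zeta> *s f" using fA by (simp add: A_def)
    have "cnj (u $ j) = u $ j" "cnj (w $ j) = w $ j" for j using uK wK Z.cnj_mem by auto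
    then have "f' = (\<chi> j. cnj (f $ j))" using cz by (simp add: f'_def f_def vec_eq_iff) (metis complex_cnj_cnj)
    then show "f v* \<psi> dih_b = (\<chi> j. cnj (f $ j))" using fB by (simp add: B_def)
    fix s t assume st: "s \<in> K" "t \<in> K" "f $ 1 * s + f $ 2 * t = 0"
    have "((u $ 1 - \<alpha> * w $ 1) * s + (u $ 2 - \<alpha> * w $ 2) * t) + (w $ 1 * s + w $ 2 * t) * \<zeta> = 0 + 0 * \<zeta>"
      using st(3) unfolding fj by (simp add: algebra_simps)
    then have e: "(u $ 1 - \<alpha> * w $ 1) * s + (u $ 2 - \<alpha> * w $ 2) * t = 0" "w $ 1 * s + w $ 2 * t = 0"
      by (rule Z.coords_unique[of _ _ 0 0, rotated -1];
        intro X.zero_mem X.add_mem X.diff_mem X.mult_mem uK wK alK st(1,2))+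
    have "u $ 1 * s + u $ 2 * t = ((u $ 1 - \<alpha> * w $ 1) * s + (u $ 2 - \<alpha> * w $ 2) * t) + \<alpha> * (w $ 1 * s + w $ 2 * t)"
      by (simp add: algebra_simps)
    then have us: "u $ 1 * s + u $ 2 * t = 0" by (simp only: e) simp
    have "D * s = w $ 2 * (u $ 1 * s + u $ 2 * t) - u $ 2 * (w $ 1 * s + w $ 2 * t)"
      "D * t = u $ 1 * (w $ 1 * s + w $ 2 * t) - w $ 1 * (u $ 1 * s + u $ 2 * t)"
      by (simp_all add: D_def algebra_simps)
    then have "D * s = 0" "D * t = 0" unfolding us e(2) by simp_all
    then show "s = 0" "t = 0" using D0 by auto
  qed
  then show ?thesis using that prim rot by blast
qed

theorem theorem4:
  fixes n :: nat and \<xi> :: complex and K :: "complex set"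
    and \<psi> :: "int \<times> bool \<Rightarrow> complex^2^2"
  assumes "n \<ge> 3"
    and "primitive_root_of_unity n \<xi>"
    and "K = rat_adjoin (\<xi> + inverse \<xi>)"
    and "\<psi> \<in> hom (dihedral n) (GL2 K)"
    and "inj_on \<psi> (carrier (dihedral n))"
    and "irreducible_rep (dihedral n) K \<psi>"
  shows "card (integral_form_classes (dihedral n) K \<psi>) =
           (if primepow n \<or> (\<exists>q. primepow q \<and> n = 2 * q) then 2 * h2 K else h2 K)"
proof -
  obtain \<zeta> f where z: "primitive_root_of_unity n \<zeta>" and rot: "rotation_field K \<zeta>"
    and f: "rotation_field.frame K \<zeta> n \<psi> f"
    using faithful_irreducible_frame[OF assms] by blast
  interpret rotation_field K \<zeta> by (rule rot)
  have "K \<subseteq> int_fractions \<tau>"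
    unfolding \<tau>_def assms(3) by (rule real_subfield_subset[OF z assms(2,1)])
  then show ?thesis by (rule card_by_order[OF assms(1) z _ assms(4) f])
qed

end
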